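(* Let $J$ be a bounded Jacobi operator on $\ell^2(\mathbb{Z})$, let $Q$ be the projection-valued measure on $I=[0,\pi)$ associated with $J$ (defined in the context), and let $\mathcal{F}=\operatorname{span}(\mathcal{F}_1\cup\mathcal{F}_2\cup\mathcal{F}_3)\subseteq C(\mathbb{R})$, where $\mathcal{F}_1=\{x^n:n\in\mathbb{N}\}$, $\mathcal{F}_2=\{e^{itx}:t\in\mathbb{R}\}$, $\mathcal{F}_3=\{(x-z)^{-1}:z\in\mathbb{C},\ \operatorname{Im}z>0\}$. Then for any $F\in\mathcal{F}$, $$\int_IF(J_\theta)\,dQ(\theta)=F(J)Q(I).$$
   Context: A bounded Jacobi operator $J$ on $\ell^2(\mathbb{Z})$ is $(J\psi)(n)=a_{n-1}\psi(n-1)+a_n\psi(n+1)+b_n\psi(n)$, with $(a_n),(b_n)$ bounded real sequences and $a_n>0$ for all $n\in\mathbb{Z}$. $P$ is its spectral measure, $\mu_\psi(B)=\langle P(B)\psi,\psi\rangle$, $\mu_{kj}(B)=\langle P(B)\delta_k,\delta_j\rangle$, $\mu=\mu_{\delta_0}+\mu_{\delta_1}$, and $\mu_s$ is the part of $\mu$ singular with respect to Lebesgue measure. $M_{kj}(z)=\int\frac{d\mu_{kj}(E)}{E-z}$ and $M(z)=\int\frac{d\mu(E)}{E-z}$ for $\operatorname{Im}z>0$. $F(J)$, $F(J_\theta)$ are defined by the functional calculus. Let $\mathbb{Z}_+=\{1,2,\dots\}$, $\mathbb{Z}_-=\{0,-1,\dots\}$ and $J_\pm$ the compression of $J$ to $\ell^2(\mathbb{Z}_\pm)$.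 For $\theta\in[0,\pi)$, $$J_\theta=\big(J_--\cot\theta\,\langle\delta_0,\cdot\rangle\delta_0\big)\oplus\big(J_+-\tan\theta\,\langle\delta_1,\cdot\rangle\delta_1\big),$$ with the following conventions where $\cot\theta$ or $\tan\theta$ is undefined. For $\theta=0$ the first summand is replaced by the compression of $J$ to $\ell^2(\{-1,-2,\dots\})$, extended by $0$ on $\delta_0$ (and the second is $J_+$); for $\theta=\pi/2$ the second summand is replaced by the compression of $J$ to $\ell^2(\{2,3,\dots\})$, extended by $0$ on $\delta_1$ (and the first is $J_-$). Solutions at energy $E$ are functions $u:\mathbb{Z}\to\mathbb{C}$ with $a_{n-1}u(n-1)+a_nu(n+1)+b_nu(n)=Eu(n)$ for all $n$. For $L>1$ let $\|u\|_L=\big[\sum_{n=1}^{\lfloor L\rfloor}|u(n)|^2+(L-\lfloor L\rfloor)|u(\lfloor L\rfloor+1)|^2\big]^{1/2}$ on $\mathbb{Z}_+$, and analogously on $\mathbb{Z}_-$ (starting at $0$, going left). A nonzero solution $u$ is subordinate if for every linearly independent solution $v$ at the same energy $\|u\|_L/\|v\|_L\to0$ as $L\to\infty$, both on $\mathbb{Z}_+$ and on $\mathbb{Z}_-$. $S$ is the set of $E\in\mathbb{R}$ admitting a subordinate solution. For $\theta\in[0,\pi)$, $S_\theta$ is the set of $E\in S$ whose subordinate solution (unique up to scalars) satisfies $u(0)\cos\theta+u(1)\sin\theta=0$; thus $S=\bigcup_\theta S_\theta$. $\widetilde S\subseteq S$ is a fixed Borel set with $\mu_s(\mathbb{R}\setminus\widetilde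 S)=0$ such that for all $E\in\widetilde S$, $k,j\in\mathbb{Z}$, $\lim_{\epsilon\to0}\frac{\mu_{kj}((E-\epsilon,E+\epsilon))}{\mu((E-\epsilon,E+\epsilon))}=\lim_{\epsilon\to0}\frac{M_{kj}(E+i\epsilon)}{M(E+i\epsilon)}=u_E(k)u_E(j)$, where $u_E$ is the real-valued subordinate solution with $|u_E(0)|^2+|u_E(1)|^2=1$ (unique up to sign); such a set exists. For Borel $B\subseteq[0,\pi)$, $S_B=\bigcup_{\theta\in B}S_\theta\cap\widetilde S$ (a Borel set), and $Q(B)=P(S_B)$; $Q$ is a projection-valued measure. Integrals: for an operator-valued $G$ on $[a,b]$, $\int_a^bG\,dQ$ is the operator-norm limit, as the mesh $\max_j|x_j-x_{j-1}|\to0$, of the sums $\sum_jG(t_j)Q([x_{j-1},x_j))$ over partitions $a=x_0<\dots<x_n=b$ and points $t_j\in[x_{j-1},x_j)$. Over an open interval $(a,b)$ the integral is the strong limit of $\int_{a'}^{b'}G\,dQ$ as $a'\to a$, $b'\to b$ ($a<a'<b'<b$). The integral over $I=[0,\pi)$ is the sum of the integrals over $(0,\pi/2)$ and $(\pi/2,\pi)$ and of $G(0)Q(\{0\})+G(\pi/2)Q(\{\pi/2\})$.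
   Formalization: In J_θ the boundary terms cot θ and tan θ are replaced by a_0 cot θ and a_0 tan θ; without the factor a_0 the identity fails, e.g. for a_0 = 2, other a_n = 1, b = 0, F(x) = x. *)

theory Defs
  imports "HOL-Analysis.Analysis" "HOL-Computational_Algebra.Polynomial"
begin

section \<open>The Hilbert space of square-summable complex sequences indexed by the integers\<close>

typedef ell2 = "{f :: int \<Rightarrow> complex. (\<lambda>n. (cmod (f n))\<^sup>2) summable_on UNIV}"
  morphisms coord Abs_ell2
  by (rule exI[of _ "\<lambda>_. 0"]) simp

setup_lifting type_definition_ell2

lemma ell2_prod_abs_summable:
  fixes f g :: "int \<Rightarrow> complex"
  assumes "(\<lambda>n. (cmod (f n))\<^sup>2) summable_on UNIV" "(\<lambda>n. (cmod (g n))\<^sup>2) summable_on UNIV"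
  shows "(\<lambda>n. norm (cnj (f n) * g n)) summable_on UNIV"
proof -
  have "(\<lambda>n. norm (cnj (f n) * cnj (f n))) summable_on UNIV" "(\<lambda>n. norm (g n * g n)) summable_on UNIV"
    using assms by (simp_all add: norm_mult power2_eq_square)
  then show ?thesis by (rule Infinite_Sum.abs_summable_product)
qed

lemma ell2_lin_summable:
  fixes f g :: "int \<Rightarrow> complex"
  assumes "(\<lambda>n. (cmod (f n))\<^sup>2) summable_on UNIV" "(\<lambda>n. (cmod (g n))\<^sup>2) summable_on UNIV"
  shows "(\<lambda>n. (cmod (f n + g n))\<^sup>2) summable_on UNIV"
proof (rule summable_on_comparison_test)
  show "(\<lambda>n. 2 * (cmod (f n))\<^sup>2 + 2 * (cmod (g n))\<^sup>2) summable_on UNIV"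
    by (intro summable_on_add summable_on_cmult_right assms)
  fix n
  have "(cmod (f n + g n))\<^sup>2 \<le> (cmod (f n) + cmod (g n))\<^sup>2"
    by (intro power_mono norm_triangle_ineq) simp
  also have "\<dots> \<le> 2 * (cmod (f n))\<^sup>2 + 2 * (cmod (g n))\<^sup>2"
    using zero_le_power2[of "cmod (f n) - cmod (g n)"] by (simp add: power2_eq_square algebra_simps)
  finally show "(cmod (f n + g n))\<^sup>2 \<le> 2 * (cmod (f n))\<^sup>2 + 2 * (cmod (g n))\<^sup>2" .
qed simp

lemma ell2_scale_summable:
  fixes f :: "int \<Rightarrow> complex"
  assumes "(\<lambda>n. (cmod (f n))\<^sup>2) summable_on UNIV"
  shows "(\<lambda>n. (cmod (c * f n))\<^sup>2) summable_on UNIV"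
  using summable_on_cmult_right[OF assms, of "(cmod c)\<^sup>2"] by (simp add: norm_mult power_mult_distrib)

lift_definition cscale :: "complex \<Rightarrow> ell2 \<Rightarrow> ell2" is "\<lambda>c f n. c * f n"
  by (rule ell2_scale_summable)

(* Antilinear in the first argument, linear in the second. *)
definition cinner :: "ell2 \<Rightarrow> ell2 \<Rightarrow> complex" where
  "cinner f g = (\<Sum>\<^sub>\<infinity>n. cnj (coord f n) * coord g n)"

lemma coord_sq_summable: "(\<lambda>n. (cmod (coord f n))\<^sup>2) summable_on UNIV"
  using coord[of f] by simp

lemma cinner_summable: "(\<lambda>n. cnj (coord f n) * coord g n) summable_on UNIV"
  by (rule Infinite_Sum.abs_summable_summable[OF ell2_prod_abs_summable[OF coord_sq_summable coord_sq_summable]])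

instantiation ell2 :: real_inner
begin

lift_definition zero_ell2 :: ell2 is "\<lambda>_. 0" by simp

lift_definition plus_ell2 :: "ell2 \<Rightarrow> ell2 \<Rightarrow> ell2" is "\<lambda>f g n. f n + g n"
  by (rule ell2_lin_summable)

lift_definition uminus_ell2 :: "ell2 \<Rightarrow> ell2" is "\<lambda>f n. - f n" by simp

lift_definition minus_ell2 :: "ell2 \<Rightarrow> ell2 \<Rightarrow> ell2" is "\<lambda>f g n. f n - g n"
  subgoal for f g using ell2_lin_summable[of f "\<lambda>n. - g n"] by simp
  done

lift_definition scaleR_ell2 :: "real \<Rightarrow> ell2 \<Rightarrow> ell2" is "\<lambda>r f n. of_real r * f n"
  by (rule ell2_scale_summable)

definition inner_ell2 :: "ell2 \<Rightarrow> ell2 \<Rightarrow> real" where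
  "inner_ell2 f g = Re (cinner f g)"

definition norm_ell2 :: "ell2 \<Rightarrow> real" where
  "norm_ell2 f = sqrt (inner f f)"

definition sgn_ell2 :: "ell2 \<Rightarrow> ell2" where
  "sgn_ell2 f = scaleR (inverse (norm f)) f"

definition dist_ell2 :: "ell2 \<Rightarrow> ell2 \<Rightarrow> real" where
  "dist_ell2 f g = norm (f - g)"

definition uniformity_ell2 :: "(ell2 \<times> ell2) filter" where
  "uniformity_ell2 = (INF e\<in>{0 <..}. principal {(x, y). dist x y < e})"

definition open_ell2 :: "ell2 set \<Rightarrow> bool" where
  "open_ell2 U = (\<forall>x\<in>U. \<forall>\<^sub>F (x', y) in uniformity. x' = x \<longrightarrow> y \<in> U)"

instance
proof
  fix f g h :: ell2 and r s :: real
  show "f + g + h = f + (g + h)" "f + g = g + f" "0 + f = f" "- f + f = 0" "f - g = f + - g"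
    by (transfer, simp add: algebra_simps)+
  show "r *\<^sub>R (f + g) = r *\<^sub>R f + r *\<^sub>R g" "(r + s) *\<^sub>R f = r *\<^sub>R f + s *\<^sub>R f"
    "r *\<^sub>R s *\<^sub>R f = (r * s) *\<^sub>R f" "1 *\<^sub>R f = f"
    by (transfer, simp add: algebra_simps)+
  show "inner f g = inner g f"
  proof -
    have "cinner g f = cnj (cinner f g)"
      unfolding cinner_def infsum_cnj[symmetric] by (simp add: mult.commute)
    then show ?thesis by (simp add: inner_ell2_def)
  qed
  show "inner (f + g) h = inner f h + inner g h"
    unfolding inner_ell2_def cinner_def
    by (simp add: plus_ell2.rep_eq distrib_right infsum_add cinner_summable)
  show "inner (r *\<^sub>R f) g = r * inner f g"
    unfolding inner_ell2_def cinner_def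
    by (simp add: scaleR_ell2.rep_eq mult.assoc infsum_cmult_right')
  have sq: "inner f f = (\<Sum>\<^sub>\<infinity>n. (cmod (coord f n))\<^sup>2)"
  proof -
    have "cinner f f = (\<Sum>\<^sub>\<infinity>n. of_real ((cmod (coord f n))\<^sup>2))"
      unfolding cinner_def by (simp add: complex_norm_square mult.commute del: of_real_power)
    also have "\<dots> = of_real (\<Sum>\<^sub>\<infinity>n. (cmod (coord f n))\<^sup>2)"
      by (intro infsumI has_sum_of_real has_sum_infsum coord_sq_summable)
    finally show ?thesis by (simp add: inner_ell2_def)
  qed
  show "0 \<le> inner f f"
    unfolding sq by (intro infsum_nonneg) simp
  show "(inner f f = 0) = (f = 0)"
  proof
    assume "inner f f = 0"
    then have "(\<Sum>\<^sub>\<infinity>n. (cmod (coord f n))\<^sup>2) \<le> 0" by (simp only: sq)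
    then have "(cmod (coord f n))\<^sup>2 = 0" for n
      by (rule nonneg_infsum_le_0D[OF _ coord_sq_summable]) simp_all
    then show "f = 0"
      by (intro coord_inject[THEN iffD1] ext) (simp add: zero_ell2.rep_eq)
  next
    assume "f = 0"
    then show "inner f f = 0" unfolding sq by (simp add: zero_ell2.rep_eq)
  qed
  show "dist f g = norm (f - g)" by (rule dist_ell2_def)
  show "sgn f = scaleR (inverse (norm f)) f" by (rule sgn_ell2_def)
  show "norm f = sqrt (inner f f)" by (rule norm_ell2_def)
  show "uniformity = (INF e\<in>{0 <..}. principal {(x, y). dist (x::ell2) y < e})"
    by (rule uniformity_ell2_def)
  show "open U = (\<forall>x\<in>U. \<forall>\<^sub>F (x', y) in uniformity. x' = x \<longrightarrow> y \<in> U)" for U :: "ell2 set"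
    by (rule open_ell2_def)
qed

end

lemma norm_ell2_sq: "(norm f)\<^sup>2 = (\<Sum>\<^sub>\<infinity>n. (cmod (coord f n))\<^sup>2)"
proof -
  have "cinner f f = (\<Sum>\<^sub>\<infinity>n. of_real ((cmod (coord f n))\<^sup>2))"
    unfolding cinner_def by (simp add: complex_norm_square mult.commute del: of_real_power)
  also have "\<dots> = of_real (\<Sum>\<^sub>\<infinity>n. (cmod (coord f n))\<^sup>2)"
    by (intro infsumI has_sum_of_real has_sum_infsum coord_sq_summable)
  finally show ?thesis by (simp add: power2_norm_eq_inner inner_ell2_def)
qed

lift_definition delta :: "int \<Rightarrow> ell2" is "\<lambda>k n. if n = k then 1 else 0"
  by (rule finite_nonzero_values_imp_summable_on) simp

lift_definition restrict_to :: "int set \<Rightarrow> ell2 \<Rightarrow> ell2" is "\<lambda>A f n. if n \<in> A then f n else 0"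
  by (erule summable_on_comparison_test) auto

section \<open>Bounded operators\<close>

(* Elements of this type are bounded real-linear maps; complex-linearity of the operators below
   holds by construction, or, for projections, by symmetry with respect to cinner. *)
type_synonym operator = "ell2 \<Rightarrow>\<^sub>L ell2"

definition scalar_op :: "complex \<Rightarrow> operator" where
  "scalar_op c = Blinfun (cscale c)"

definition rank_one :: "int \<Rightarrow> operator" where
  "rank_one k = Blinfun (\<lambda>\<psi>. cscale (cinner (delta k) \<psi>) (delta k))"

(* Compression to the square-summable sequences on A, extended by 0 on the complement. *)
definition compression :: "int set \<Rightarrow> operator \<Rightarrow> operator" where
  "compression A T = Blinfun (restrict_to A) o\<^sub>L T o\<^sub>L Blinfun (restrict_to A)"

lemma bounded_linear_ell2I:
  fixes T :: "ell2 \<Rightarrow> ell2"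
  assumes "\<And>f g. T (f + g) = T f + T g" "\<And>r f. T (r *\<^sub>R f) = r *\<^sub>R T f"
    and "\<And>f. norm (T f) \<le> norm f * C"
  shows "bounded_linear T"
  using assms by (rule bounded_linear_intro)

lemma norm_cscale: "norm (cscale c f) = cmod c * norm f"
proof -
  have "(norm (cscale c f))\<^sup>2 = (cmod c * norm f)\<^sup>2"
    unfolding power_mult_distrib norm_ell2_sq
    by (simp add: cscale.rep_eq norm_mult power_mult_distrib infsum_cmult_right')
  then show ?thesis by (simp add: power2_eq_iff_nonneg)
qed

lemma bounded_linear_cscale: "bounded_linear (cscale c)"
proof (rule bounded_linear_ell2I)
  show "cscale c (f + g) = cscale c f + cscale c g" for f g by transfer (simp add: algebra_simps)
  show "cscale c (r *\<^sub>R f) = r *\<^sub>R cscale c f" for r f by transfer (simp add: algebra_simps)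
  show "norm (cscale c f) \<le> norm f * cmod c" for f by (simp add: norm_cscale mult.commute)
qed

lemma bounded_linear_restrict_to: "bounded_linear (restrict_to A)"
proof (rule bounded_linear_ell2I)
  show "restrict_to A (f + g) = restrict_to A f + restrict_to A g" for f g
    by transfer (auto simp: fun_eq_iff)
  show "restrict_to A (r *\<^sub>R f) = r *\<^sub>R restrict_to A f" for r f
    by transfer (auto simp: fun_eq_iff)
  fix f
  have "(norm (restrict_to A f))\<^sup>2 \<le> (norm f)\<^sup>2"
    unfolding norm_ell2_sq
    by (intro infsum_mono coord_sq_summable) (simp add: restrict_to.rep_eq)
  then show "norm (restrict_to A f) \<le> norm f * 1"
    by (simp add: power2_le_iff_abs_le)
qed

lemma cinner_delta: "cinner (delta k) \<psi> = coord \<psi> k"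
proof -
  have "cinner (delta k) \<psi> = (\<Sum>\<^sub>\<infinity>n\<in>{k}. cnj (coord (delta k) n) * coord \<psi> n)"
    unfolding cinner_def by (rule infsum_cong_neutral) (auto simp: delta.rep_eq)
  then show ?thesis by (simp add: delta.rep_eq)
qed

lemma rank_one_apply: "rank_one k \<psi> = cscale (cinner (delta k) \<psi>) (delta k)"
proof -
  have eq: "(\<lambda>\<psi>. cscale (cinner (delta k) \<psi>) (delta k)) = restrict_to {k}"
    by (intro ext coord_inject[THEN iffD1])
       (auto simp: cinner_delta cscale.rep_eq restrict_to.rep_eq delta.rep_eq)
  have "bounded_linear (\<lambda>\<psi>. cscale (cinner (delta k) \<psi>) (delta k))"
    unfolding eq by (rule bounded_linear_restrict_to)
  then show ?thesis unfolding rank_one_def by (simp add: bounded_linear_Blinfun_apply)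
qed

lemma scalar_op_apply: "scalar_op c \<psi> = cscale c \<psi>"
  unfolding scalar_op_def by (simp add: bounded_linear_Blinfun_apply bounded_linear_cscale)

lemma compression_apply: "compression A T \<psi> = restrict_to A (T (restrict_to A \<psi>))"
  unfolding compression_def by (simp add: bounded_linear_Blinfun_apply bounded_linear_restrict_to)

definition orthogonal_projection :: "operator \<Rightarrow> bool" where
  "orthogonal_projection T \<longleftrightarrow>
     T o\<^sub>L T = T \<and> (\<forall>\<phi> \<psi>. cinner (T \<phi>) \<psi> = cinner \<phi> (T \<psi>))"

definition op_spectrum :: "operator \<Rightarrow> complex set" where
  "op_spectrum T = {z. \<not> (\<exists>R. R o\<^sub>L (T - scalar_op z) = id_blinfun \<and>
                            (T - scalar_op z) o\<^sub>L R = id_blinfun)}"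

definition op_poly :: "complex poly \<Rightarrow> operator \<Rightarrow> operator" where
  "op_poly p T = (\<Sum>i\<le>degree p. scalar_op (coeff p i) o\<^sub>L (((o\<^sub>L) T) ^^ i) id_blinfun)"

(* F(T) for bounded self-adjoint T and continuous F: the operator-norm limit of p_n(T) for
   polynomials p_n converging to F uniformly on the spectrum of T. *)
definition functional_calculus :: "(real \<Rightarrow> complex) \<Rightarrow> operator \<Rightarrow> operator" where
  "functional_calculus F T = (THE S. \<exists>p :: nat \<Rightarrow> complex poly.
     uniform_limit {x. of_real x \<in> op_spectrum T} (\<lambda>n x. poly (p n) (of_real x)) F sequentially \<and>
     (\<lambda>n. op_poly (p n) T) \<longlonglongrightarrow> S)"

section \<open>Spectral measures\<close>

type_synonym proj_measure = "real set \<Rightarrow> operator"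

definition form_measure :: "proj_measure \<Rightarrow> ell2 \<Rightarrow> real measure" where
  "form_measure P \<psi> = measure_of UNIV (sets borel) (\<lambda>B. ennreal (Re (cinner (P B \<psi>) \<psi>)))"

definition projection_valued_measure :: "proj_measure \<Rightarrow> bool" where
  "projection_valued_measure P \<longleftrightarrow>
     (\<forall>B\<in>sets borel. orthogonal_projection (P B)) \<and> P UNIV = id_blinfun \<and>
     (\<forall>B :: nat \<Rightarrow> real set. range B \<subseteq> sets borel \<longrightarrow> disjoint_family B \<longrightarrow>
        (\<forall>\<psi>. (\<lambda>n. P (B n) \<psi>) sums P (\<Union>n. B n) \<psi>))"

(* The projection-valued measure P with T equal to the integral of the identity against P. *)
definition is_spectral_measure :: "operator \<Rightarrow> proj_measure \<Rightarrow> bool" where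
  "is_spectral_measure T P \<longleftrightarrow> projection_valued_measure P \<and>
     (\<forall>\<psi>. integrable (form_measure P \<psi>) (\<lambda>x. x) \<and>
          cinner (T \<psi>) \<psi> = of_real (\<integral>x. x \<partial>form_measure P \<psi>))"

definition entry_measure :: "proj_measure \<Rightarrow> int \<Rightarrow> int \<Rightarrow> real set \<Rightarrow> complex" where
  "entry_measure P k j B = cinner (P B (delta k)) (delta j)"

definition total_measure :: "proj_measure \<Rightarrow> real measure" where
  "total_measure P = measure_of UNIV (sets borel)
     (\<lambda>B. emeasure (form_measure P (delta 0)) B + emeasure (form_measure P (delta 1)) B)"

(* The integral of 1 / (E - z) against the complex measure entry_measure P k j, which by
   polarization is the combination below of the positive measures form_measure P. *)
definition entry_borel_transform :: "proj_measure \<Rightarrow> int \<Rightarrow> int \<Rightarrow> complex \<Rightarrow> complex" where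
  "entry_borel_transform P k j z =
     (\<Sum>c\<in>{1, \<i>, -1, -\<i>}. cnj c *
        (\<integral>E. 1 / (of_real E - z) \<partial>form_measure P (delta k + cscale c (delta j)))) / 4"

definition total_borel_transform :: "proj_measure \<Rightarrow> complex \<Rightarrow> complex" where
  "total_borel_transform P z = (\<integral>E. 1 / (of_real E - z) \<partial>total_measure P)"

(* The singular term of the Lebesgue decomposition. *)
definition singular_part :: "real measure \<Rightarrow> real measure" where
  "singular_part \<mu> = (THE \<nu>. sets \<nu> = sets borel \<and>
     (\<exists>N\<in>null_sets lborel. emeasure \<nu> (UNIV - N) = 0) \<and>
     (\<exists>\<rho>. sets \<rho> = sets borel \<and> absolutely_continuous lborel \<rho> \<and>
        (\<forall>B\<in>sets borel. emeasure \<mu> B = emeasure \<rho> B + emeasure \<nu> B)))"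

section \<open>Jacobi operators\<close>

definition jacobi_coeffs :: "(int \<Rightarrow> real) \<Rightarrow> (int \<Rightarrow> real) \<Rightarrow> bool" where
  "jacobi_coeffs a b \<longleftrightarrow> bounded (range a) \<and> bounded (range b) \<and> (\<forall>n. a n > 0)"

definition jacobi_map :: "(int \<Rightarrow> real) \<Rightarrow> (int \<Rightarrow> real) \<Rightarrow> (int \<Rightarrow> complex) \<Rightarrow> int \<Rightarrow> complex" where
  "jacobi_map a b u n = of_real (a (n - 1)) * u (n - 1) + of_real (a n) * u (n + 1) + of_real (b n) * u n"

definition jacobi :: "(int \<Rightarrow> real) \<Rightarrow> (int \<Rightarrow> real) \<Rightarrow> operator" where
  "jacobi a b = Blinfun (\<lambda>\<psi>. Abs_ell2 (jacobi_map a b (coord \<psi>)))"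

lemma ell2_translate:
  "(\<lambda>n. (cmod (coord f (n + k)))\<^sup>2) summable_on UNIV"
  "(\<Sum>\<^sub>\<infinity>n. (cmod (coord f (n + k)))\<^sup>2) = (norm f)\<^sup>2"
proof -
  have bij: "bij (\<lambda>n::int. n + k)" by (rule bij_plus_right)
  show "(\<lambda>n. (cmod (coord f (n + k)))\<^sup>2) summable_on UNIV"
    using summable_on_reindex_bij_betw[OF bij, of "\<lambda>n. (cmod (coord f n))\<^sup>2"] coord_sq_summable by simp
  show "(\<Sum>\<^sub>\<infinity>n. (cmod (coord f (n + k)))\<^sup>2) = (norm f)\<^sup>2"
    using infsum_reindex_bij_betw[OF bij, of "\<lambda>n. (cmod (coord f n))\<^sup>2"] by (simp add: norm_ell2_sq)
qed

lemma jacobi_apply: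
  assumes "jacobi_coeffs a b"
  shows "coord (jacobi a b \<psi>) n =
    of_real (a (n - 1)) * coord \<psi> (n - 1) + of_real (a n) * coord \<psi> (n + 1) + of_real (b n) * coord \<psi> n"
proof -
  obtain A where A: "\<And>n. \<bar>a n\<bar> \<le> A" using assms unfolding jacobi_coeffs_def bounded_iff by auto
  obtain B where B: "\<And>n. \<bar>b n\<bar> \<le> B" using assms unfolding jacobi_coeffs_def bounded_iff by auto
  define C where "C = max A B"
  have C: "\<bar>a n\<bar> \<le> C" "\<bar>b n\<bar> \<le> C" for n using A[of n] B[of n] by (auto simp: C_def)
  have C0: "0 \<le> C" using C(1)[of 0] by linarith
  let ?s = "\<lambda>\<psi> n. (cmod (coord \<psi> (n + (-1))))\<^sup>2 + (cmod (coord \<psi> (n + 1)))\<^sup>2 + (cmod (coord \<psi> (n + 0)))\<^sup>2"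
  have s: "?s \<psi> summable_on UNIV" for \<psi> by (intro summable_on_add ell2_translate(1))
  have si: "infsum (?s \<psi>) UNIV = 3 * (norm \<psi>)\<^sup>2" for \<psi>
    using ell2_translate(2)[of \<psi> "-1"] ell2_translate(2)[of \<psi> 1] ell2_translate(2)[of \<psi> 0]
      infsum_add[OF summable_on_add[OF ell2_translate(1)[of \<psi> "-1"] ell2_translate(1)[of \<psi> 1]]
        ell2_translate(1)[of \<psi> 0]]
      infsum_add[OF ell2_translate(1)[of \<psi> "-1"] ell2_translate(1)[of \<psi> 1]] by linarith
  have bd: "(cmod (jacobi_map a b (coord \<psi>) n))\<^sup>2 \<le> 3 * C\<^sup>2 * ?s \<psi> n" for \<psi> n
  proof -
    let ?x = "cmod (coord \<psi> (n - 1))" and ?y = "cmod (coord \<psi> (n + 1))" and ?z = "cmod (coord \<psi> n)"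
    have "cmod (jacobi_map a b (coord \<psi>) n) \<le> \<bar>a (n - 1)\<bar> * ?x + \<bar>a n\<bar> * ?y + \<bar>b n\<bar> * ?z"
      unfolding jacobi_map_def by (intro norm_triangle_mono order_eq_refl) (simp_all add: norm_mult)
    also have "\<dots> \<le> C * ?x + C * ?y + C * ?z"
      by (intro add_mono mult_right_mono C) auto
    finally have "(cmod (jacobi_map a b (coord \<psi>) n))\<^sup>2 \<le> (C * ?x + C * ?y + C * ?z)\<^sup>2"
      by (intro power_mono) auto
    also have "\<dots> = C\<^sup>2 * (?x + ?y + ?z)\<^sup>2" by (simp add: power2_eq_square algebra_simps)
    also have "\<dots> \<le> C\<^sup>2 * (3 * (?x\<^sup>2 + ?y\<^sup>2 + ?z\<^sup>2))"
    proof (rule mult_left_mono)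
      have "0 \<le> (?x - ?y)\<^sup>2 + (?y - ?z)\<^sup>2 + (?x - ?z)\<^sup>2" by simp
      then show "(?x + ?y + ?z)\<^sup>2 \<le> 3 * (?x\<^sup>2 + ?y\<^sup>2 + ?z\<^sup>2)"
        by (simp add: power2_eq_square algebra_simps)
    qed simp
    finally show ?thesis by (simp add: algebra_simps)
  qed
  have sm: "(\<lambda>n. (cmod (jacobi_map a b (coord \<psi>) n))\<^sup>2) summable_on UNIV" for \<psi>
    by (rule summable_on_comparison_test[OF summable_on_cmult_right[OF s, of "3 * C\<^sup>2" \<psi>]])
       (simp_all only: bd, simp)
  let ?T = "\<lambda>\<psi>. Abs_ell2 (jacobi_map a b (coord \<psi>))"
  have T: "coord (?T \<psi>) = jacobi_map a b (coord \<psi>)" for \<psi>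
    using sm by (intro Abs_ell2_inverse) simp
  have "bounded_linear ?T"
  proof (rule bounded_linear_ell2I)
    show "?T (f + g) = ?T f + ?T g" for f g
      by (intro coord_inject[THEN iffD1] ext, unfold T)
         (simp add: T plus_ell2.rep_eq, simp add: jacobi_map_def algebra_simps)
    show "?T (r *\<^sub>R f) = r *\<^sub>R ?T f" for r f
      by (intro coord_inject[THEN iffD1] ext, unfold T)
         (simp add: T scaleR_ell2.rep_eq, simp add: jacobi_map_def algebra_simps)
    fix f
    have "(norm (?T f))\<^sup>2 \<le> infsum (\<lambda>n. 3 * C\<^sup>2 * ?s f n) UNIV"
      unfolding norm_ell2_sq T
      by (intro infsum_mono sm summable_on_cmult_right s bd)
    also have "\<dots> = 3 * C\<^sup>2 * (3 * (norm f)\<^sup>2)" by (simp only: infsum_cmult_right' si)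
    also have "\<dots> = (norm f * (3 * C))\<^sup>2" by (simp add: power2_eq_square)
    finally show "norm (?T f) \<le> norm f * (3 * C)"
      using C0 by (simp add: power2_le_iff_abs_le)
  qed
  then show ?thesis
    unfolding jacobi_def by (simp add: bounded_linear_Blinfun_apply T jacobi_map_def)
qed

(* The factor a 0 in the boundary terms makes the operator match the boundary condition
   u 0 * cos \<theta> + u 1 * sin \<theta> = 0 used in S_theta below: for a solution u at energy E satisfying it,
   a 0 * u 0 = - (a 0 * tan \<theta>) * u 1 and a 0 * u 1 = - (a 0 * cot \<theta>) * u 0, so that u is a formal
   eigenfunction of J_theta at E.  When a 0 = 1, the terms are cot \<theta> and tan \<theta>. *)
definition J_theta :: "(int \<Rightarrow> real) \<Rightarrow> (int \<Rightarrow> real) \<Rightarrow> real \<Rightarrow> operator" where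
  "J_theta a b \<theta> =
     (if \<theta> = 0 then compression {..-1} (jacobi a b) + compression {1..} (jacobi a b)
      else if \<theta> = pi / 2 then compression {..0} (jacobi a b) + compression {2..} (jacobi a b)
      else (compression {..0} (jacobi a b) - (a 0 * cot \<theta>) *\<^sub>R rank_one 0)
         + (compression {1..} (jacobi a b) - (a 0 * tan \<theta>) *\<^sub>R rank_one 1))"

section \<open>Subordinate solutions\<close>

definition solution :: "(int \<Rightarrow> real) \<Rightarrow> (int \<Rightarrow> real) \<Rightarrow> real \<Rightarrow> (int \<Rightarrow> complex) \<Rightarrow> bool" where
  "solution a b E u \<longleftrightarrow> (\<forall>n. jacobi_map a b u n = of_real E * u n)"

definition lin_indep :: "(int \<Rightarrow> complex) \<Rightarrow> (int \<Rightarrow> complex) \<Rightarrow> bool" where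
  "lin_indep u v \<longleftrightarrow> (\<forall>c d :: complex. (\<forall>n. c * u n + d * v n = 0) \<longrightarrow> c = 0 \<and> d = 0)"

definition norm_right :: "(int \<Rightarrow> complex) \<Rightarrow> real \<Rightarrow> real" where
  "norm_right u L = sqrt ((\<Sum>n\<in>{1..\<lfloor>L\<rfloor>}. (cmod (u n))\<^sup>2) +
                          (L - of_int \<lfloor>L\<rfloor>) * (cmod (u (\<lfloor>L\<rfloor> + 1)))\<^sup>2)"

(* The reflection n \<mapsto> 1 - n exchanges 1, 2, 3, ... and 0, -1, -2, .... *)
definition norm_left :: "(int \<Rightarrow> complex) \<Rightarrow> real \<Rightarrow> real" where
  "norm_left u L = norm_right (\<lambda>n. u (1 - n)) L"

definition subordinate :: "(int \<Rightarrow> real) \<Rightarrow> (int \<Rightarrow> real) \<Rightarrow> real \<Rightarrow> (int \<Rightarrow> complex) \<Rightarrow> bool" where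
  "subordinate a b E u \<longleftrightarrow> solution a b E u \<and> (\<exists>n. u n \<noteq> 0) \<and>
     (\<forall>v. solution a b E v \<longrightarrow> lin_indep u v \<longrightarrow>
        ((\<lambda>L. norm_right u L / norm_right v L) \<longlongrightarrow> 0) at_top \<and>
        ((\<lambda>L. norm_left u L / norm_left v L) \<longlongrightarrow> 0) at_top)"

definition S_set :: "(int \<Rightarrow> real) \<Rightarrow> (int \<Rightarrow> real) \<Rightarrow> real set" where
  "S_set a b = {E. \<exists>u. subordinate a b E u}"

definition S_theta :: "(int \<Rightarrow> real) \<Rightarrow> (int \<Rightarrow> real) \<Rightarrow> real \<Rightarrow> real set" where
  "S_theta a b \<theta> = {E. \<exists>u. subordinate a b E u \<and> u 0 * of_real (cos \<theta>) + u 1 * of_real (sin \<theta>) = 0}"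

(* The real-valued normalized subordinate solution is unique up to sign, so the products
   u k * u j do not depend on the choice of u. *)
definition normalized_subordinate :: "(int \<Rightarrow> real) \<Rightarrow> (int \<Rightarrow> real) \<Rightarrow> real \<Rightarrow> (int \<Rightarrow> complex) \<Rightarrow> bool" where
  "normalized_subordinate a b E u \<longleftrightarrow>
     subordinate a b E u \<and> (\<forall>n. u n \<in> \<real>) \<and> (cmod (u 0))\<^sup>2 + (cmod (u 1))\<^sup>2 = 1"

definition admissible_set :: "(int \<Rightarrow> real) \<Rightarrow> (int \<Rightarrow> real) \<Rightarrow> proj_measure \<Rightarrow> real set \<Rightarrow> bool" where
  "admissible_set a b P S \<longleftrightarrow> S \<in> sets borel \<and> S \<subseteq> S_set a b \<and>
     emeasure (singular_part (total_measure P)) (UNIV - S) = 0 \<and>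
     (\<forall>E\<in>S. \<exists>u. normalized_subordinate a b E u \<and> (\<forall>k j.
        ((\<lambda>\<epsilon>. entry_measure P k j {E - \<epsilon><..<E + \<epsilon>} /
               of_real (measure (total_measure P) {E - \<epsilon><..<E + \<epsilon>})) \<longlongrightarrow> u k * u j) (at_right 0) \<and>
        ((\<lambda>\<epsilon>. entry_borel_transform P k j (Complex E \<epsilon>) /
               total_borel_transform P (Complex E \<epsilon>)) \<longlongrightarrow> u k * u j) (at_right 0)))"

definition Q_measure ::
    "(int \<Rightarrow> real) \<Rightarrow> (int \<Rightarrow> real) \<Rightarrow> proj_measure \<Rightarrow> real set \<Rightarrow> proj_measure" where
  "Q_measure a b P S B = P ((\<Union>\<theta>\<in>B. S_theta a b \<theta>) \<inter> S)"

section \<open>Operator-valued integrals\<close>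

definition has_mesh_integral ::
    "(real \<Rightarrow> operator) \<Rightarrow> proj_measure \<Rightarrow> real \<Rightarrow> real \<Rightarrow> operator \<Rightarrow> bool" where
  "has_mesh_integral G Q a b T \<longleftrightarrow> (\<forall>e>0. \<exists>d>0. \<forall>(n::nat) x t.
     x 0 = a \<and> x n = b \<and> (\<forall>i<n. x i < x (Suc i) \<and> x (Suc i) - x i < d \<and> t i \<in> {x i..<x (Suc i)}) \<longrightarrow>
       norm ((\<Sum>i<n. G (t i) o\<^sub>L Q {x i..<x (Suc i)}) - T) < e)"

definition has_open_integral ::
    "(real \<Rightarrow> operator) \<Rightarrow> proj_measure \<Rightarrow> real \<Rightarrow> real \<Rightarrow> operator \<Rightarrow> bool" where
  "has_open_integral G Q a b T \<longleftrightarrow> (\<exists>H.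
     (\<forall>a' b'. a < a' \<longrightarrow> a' < b' \<longrightarrow> b' < b \<longrightarrow> has_mesh_integral G Q a' b' (H a' b')) \<and>
     (\<forall>\<psi>. ((\<lambda>(a', b'). H a' b' \<psi>) \<longlongrightarrow> T \<psi>) (at_right a \<times>\<^sub>F at_left b)))"

definition has_angle_integral :: "(real \<Rightarrow> operator) \<Rightarrow> proj_measure \<Rightarrow> operator \<Rightarrow> bool" where
  "has_angle_integral G Q T \<longleftrightarrow> (\<exists>T1 T2.
     has_open_integral G Q 0 (pi / 2) T1 \<and> has_open_integral G Q (pi / 2) pi T2 \<and>
     T = T1 + T2 + (G 0 o\<^sub>L Q {0}) + (G (pi / 2) o\<^sub>L Q {pi / 2}))"

section \<open>The class of functions\<close>

definition monomials :: "(real \<Rightarrow> complex) set" where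
  "monomials = {(\<lambda>x. of_real x ^ n) | n :: nat. True}"

definition exponentials :: "(real \<Rightarrow> complex) set" where
  "exponentials = {(\<lambda>x. exp (\<i> * of_real t * of_real x)) | t :: real. True}"

definition resolvent_functions :: "(real \<Rightarrow> complex) set" where
  "resolvent_functions = {(\<lambda>x. 1 / (of_real x - z)) | z :: complex. Im z > 0}"

definition complex_span :: "(real \<Rightarrow> complex) set \<Rightarrow> (real \<Rightarrow> complex) set" where
  "complex_span A = {(\<lambda>x. \<Sum>g\<in>B. c g * g x) | B c. finite B \<and> B \<subseteq> A}"

end

theory Submission
  imports Defs "HOL-Computational_Algebra.Fundamental_Theorem_Algebra"
begin

text \<open>
  Apart from the two exceptional angles, \<open>J\<^sub>\<theta> - J\<close> has rank one: it is the functional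
  \<open>\<phi> \<mapsto> cos \<theta> \<phi>(0) + sin \<theta> \<phi>(1)\<close>, the inner product with a boundary vector \<open>\<chi>\<^sub>\<theta>\<close>, times a fixed
  vector (\<open>norm_J_theta_minus_jacobi_le\<close>).  At an energy of angle \<open>\<theta>\<close> the spectral measure of \<open>\<chi>\<^sub>t\<close>
  has density \<open>(cos t u(0) + sin t u(1))\<^sup>2 = sin\<^sup>2(t - \<theta>)\<close> with respect to the total measure \<open>\<mu>\<close>, so
  that \<open>\<parallel>Q(B) \<chi>\<^sub>t\<parallel>\<^sup>2\<close> is at most a constant times \<open>\<delta>\<^sup>2 \<mu>(S\<^sub>B)\<close> when all angles in \<open>B\<close> are within \<open>\<delta>\<close>
  of \<open>t\<close> (\<open>boundary_vector_small\<close>).  Over a partition with projections \<open>Q\<^sub>i\<close>, the masses \<open>\<mu>(S\<^sub>B)\<close> of the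
  pieces add up to at most \<open>2\<close> and the squares \<open>\<parallel>Q\<^sub>i \<phi>\<parallel>\<^sup>2\<close> to at most \<open>\<parallel>\<phi>\<parallel>\<^sup>2\<close>.  The Cauchy--Schwarz
  inequality then bounds the sum of all \<open>\<bar>\<langle>\<chi>\<^sub>t, Q\<^sub>i \<phi>\<rangle>\<bar>\<close>, with \<open>t\<close> the node of the piece, by a constant
  times the mesh, whatever the number of pieces (\<open>sum_boundary_terms_le\<close>); on a closed interval
  without exceptional angles the same holds for the errors \<open>\<parallel>(J\<^sub>t - J) Q\<^sub>i \<phi>\<parallel>\<close>.

  To pass from the identity function to \<open>F\<close>, one telescopes \<open>J\<^sub>t\<^sup>k - J\<^sup>k\<close>, sums a power series, or uses
  the second resolvent identity.  In each case the functions of \<open>J\<close> on the right can be moved past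
  \<open>Q\<^sub>i\<close>, as \<open>P\<close> commutes with \<open>J\<close> (\<open>spectral_measure_commute\<close>), and the sum of the errors of \<open>F\<close> is
  bounded by a multiple of the sum of the errors of the identity (\<open>perturbation_stable_span\<close>).
  So the Riemann sums of \<open>F(J\<^sub>\<theta>)\<close> over \<open>[l, r)\<close> converge to \<open>F(J) Q([l, r))\<close>.  At the angles \<open>0\<close> and \<open>\<pi>/2\<close>
  the projection annihilates the boundary vector, and there \<open>J\<close> and \<open>J\<^sub>\<theta>\<close> agree on its range.

  Three foundations have to be laid.  The functional calculus, a limit of polynomials, is well
  defined because \<open>\<parallel>p(T)\<parallel>\<close> is attained by \<open>\<bar>p\<bar>\<close> on the spectrum of a symmetric \<open>T\<close>
  (\<open>norm_op_poly_attained\<close>).  The bound by the density follows from the limits of the ratios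
  on centred intervals by a covering argument special to the line
  (\<open>measure_le_if_interval_ratio_le\<close>); it loses a factor two, which is harmless.  The sets \<open>S\<^sub>B\<close> are Borel because the angle is a measurable
  function of the energy, being computed from limits of such ratios (\<open>angle_measurable\<close>).
\<close>

section \<open>The sesquilinear form on the sequence space\<close>

lemma ell2_eqI: "(\<And>n. coord f n = coord g n) \<Longrightarrow> f = g"
  by (metis coord_inject ext)

lemmas coord_simps = plus_ell2.rep_eq minus_ell2.rep_eq uminus_ell2.rep_eq zero_ell2.rep_eq
  scaleR_ell2.rep_eq cscale.rep_eq delta.rep_eq restrict_to.rep_eq

lemma cscale_simps [simp]:
  "cscale c (cscale d f) = cscale (c * d) f" "cscale 1 f = f" "cscale 0 f = 0" "cscale c 0 = 0"
  by (auto intro!: ell2_eqI simp: coord_simps)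

lemma cscale_add_right: "cscale c (f + g) = cscale c f + cscale c g"
  and cscale_diff_right: "cscale c (f - g) = cscale c f - cscale c g"
  and cscale_add_left: "cscale (c + d) f = cscale c f + cscale d f"
  and cscale_minus_left: "cscale (- c) f = - cscale c f"
  and cscale_of_real: "cscale (of_real r) f = r *\<^sub>R f"
  and cscale_scaleR: "cscale c (r *\<^sub>R f) = r *\<^sub>R cscale c f"
  by (auto intro!: ell2_eqI simp: coord_simps algebra_simps)

lemma cinner_cscale_left: "cinner (cscale c f) g = cnj c * cinner f g"
  unfolding cinner_def by (simp add: coord_simps mult.assoc infsum_cmult_right')

lemma cinner_cscale_right: "cinner f (cscale c g) = c * cinner f g"
  unfolding cinner_def by (simp add: coord_simps mult.left_commute[of _ c] infsum_cmult_right')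

lemma cinner_commute: "cinner g f = cnj (cinner f g)"
  unfolding cinner_def infsum_cnj[symmetric] by (simp add: mult.commute)

lemma Re_cinner: "Re (cinner f g) = inner f g"
  by (simp add: inner_ell2_def)

text \<open>The imaginary part of the form is its real part after a rotation of one argument, so that
  everything about \<^const>\<open>cinner\<close> is inherited from the real inner product.\<close>

lemma cinner_eq_inner: "cinner f g = Complex (inner f g) (inner (cscale \<i> f) g)"
  unfolding inner_ell2_def cinner_cscale_left by (simp add: complex_eq_iff)

lemma cinner_add_left: "cinner (f + g) h = cinner f h + cinner g h"
  and cinner_add_right: "cinner h (f + g) = cinner h f + cinner h g"
  and cinner_diff_left: "cinner (f - g) h = cinner f h - cinner g h"
  and cinner_diff_right: "cinner h (f - g) = cinner h f - cinner h g"
  and cinner_scaleR_left: "cinner (r *\<^sub>R f) h = of_real r * cinner f h"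
  and cinner_scaleR_right: "cinner h (r *\<^sub>R f) = of_real r * cinner h f"
  and cinner_zero_left: "cinner 0 h = 0" and cinner_zero_right: "cinner h 0 = 0"
  by (simp_all add: cinner_eq_inner complex_eq_iff cscale_add_right cscale_diff_right cscale_scaleR
      inner_add_left inner_add_right inner_diff_left inner_diff_right)

lemma cinner_self: "cinner f f = of_real ((norm f)\<^sup>2)"
proof -
  have "Im (cinner f f) = 0"
    using arg_cong[OF cinner_commute[of f f], of Im] by simp
  then show ?thesis
    by (simp add: complex_eq_iff Re_cinner power2_norm_eq_inner)
qed

text \<open>The complex Cauchy--Schwarz inequality, from the real one by rotating \<open>f\<close> until the form is
  real and nonnegative.\<close>

lemma norm_cinner_le: "cmod (cinner f g) \<le> norm f * norm g"
proof -
  define w where "w = cinner f g"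
  define c where "c = sgn w"
  have "cmod w = Re (cinner (cscale c f) g)"
  proof -
    have "cnj c * w = of_real (cmod w)"
      unfolding c_def sgn_eq
      by (cases "w = 0") (simp_all add: complex_norm_square[symmetric] mult.commute field_simps
          power2_eq_square)
    then show ?thesis by (simp add: cinner_cscale_left w_def)
  qed
  also have "\<dots> \<le> norm (cscale c f) * norm g"
    unfolding Re_cinner by (rule norm_cauchy_schwarz)
  also have "\<dots> \<le> norm f * norm g"
    by (intro mult_right_mono) (auto simp: norm_cscale c_def norm_sgn)
  finally show ?thesis by (simp add: w_def)
qed

lemma cinner_eqI:
  assumes "\<And>h. cinner h f = cinner h g"
  shows "f = g"
proof -
  have "cinner (f - g) (f - g) = 0"
    unfolding cinner_diff_right using assms by simp
  then show ?thesis by (simp add: cinner_self)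
qed

lemma norm_delta: "norm (delta k) = 1"
proof -
  have "complex_of_real ((norm (delta k))\<^sup>2) = 1"
    unfolding cinner_self[symmetric] cinner_delta by (simp add: coord_simps)
  then have "norm (delta k) = 1 \<or> norm (delta k) = - 1"
    by (simp only: of_real_eq_1_iff power2_eq_1_iff)
  then show ?thesis using norm_ge_zero[of "delta k"] by linarith
qed

lemma norm_coord_le: "cmod (coord f k) \<le> norm f"
  using norm_cinner_le[of "delta k" f] by (simp add: cinner_delta norm_delta)

section \<open>Completeness\<close>

lemma sum_coord_sq_le:
  assumes "finite A"
  shows "(\<Sum>n\<in>A. (cmod (coord f n))\<^sup>2) \<le> (norm f)\<^sup>2"
  unfolding norm_ell2_sq
  using finite_sum_le_infsum[OF coord_sq_summable[of f] assms] by simp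

instance ell2 :: banach
proof
  fix X :: "nat \<Rightarrow> ell2"
  assume X: "Cauchy X"
  have "Cauchy (\<lambda>i. coord (X i) n)" for n
  proof (rule metric_CauchyI)
    fix e :: real assume "0 < e"
    then obtain M where M: "\<And>i j. i \<ge> M \<Longrightarrow> j \<ge> M \<Longrightarrow> dist (X i) (X j) < e"
      using metric_CauchyD[OF X] by metis
    have "dist (coord (X i) n) (coord (X j) n) < e" if "i \<ge> M" "j \<ge> M" for i j
      using norm_coord_le[of "X i - X j" n] M[OF that] by (simp add: dist_norm coord_simps)
    then show "\<exists>M. \<forall>i\<ge>M. \<forall>j\<ge>M. dist (coord (X i) n) (coord (X j) n) < e" by blast
  qed
  then obtain g where g: "\<And>n. (\<lambda>i. coord (X i) n) \<longlonglongrightarrow> g n"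
    unfolding Cauchy_convergent_iff convergent_def by metis
  \<comment> \<open>A finite partial sum of the squared distance passes to the limit in the second index.\<close>
  have tail: "\<exists>M. \<forall>i\<ge>M. \<forall>A. finite A \<longrightarrow> (\<Sum>n\<in>A. (cmod (coord (X i) n - g n))\<^sup>2) \<le> e\<^sup>2"
    if e: "0 < e" for e
  proof -
    obtain M where M: "\<And>i j. i \<ge> M \<Longrightarrow> j \<ge> M \<Longrightarrow> dist (X i) (X j) < e"
      using metric_CauchyD[OF X e] by metis
    have "(\<Sum>n\<in>A. (cmod (coord (X i) n - g n))\<^sup>2) \<le> e\<^sup>2" if i: "i \<ge> M" and A: "finite A" for i A
    proof (rule LIMSEQ_le_const2)
      show "(\<lambda>j. \<Sum>n\<in>A. (cmod (coord (X i) n - coord (X j) n))\<^sup>2) \<longlonglongrightarrow>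
        (\<Sum>n\<in>A. (cmod (coord (X i) n - g n))\<^sup>2)"
        by (intro tendsto_intros g)
      have "(\<Sum>n\<in>A. (cmod (coord (X i) n - coord (X j) n))\<^sup>2) \<le> e\<^sup>2" if "j \<ge> M" for j
      proof -
        have "(\<Sum>n\<in>A. (cmod (coord (X i) n - coord (X j) n))\<^sup>2) \<le> (norm (X i - X j))\<^sup>2"
          using sum_coord_sq_le[OF A, of "X i - X j"] by (simp add: coord_simps)
        also have "\<dots> \<le> e\<^sup>2"
          using M[OF i that] by (intro power_mono) (auto simp: dist_norm)
        finally show ?thesis .
      qed
      then show "\<exists>N. \<forall>j\<ge>N. (\<Sum>n\<in>A. (cmod (coord (X i) n - coord (X j) n))\<^sup>2) \<le> e\<^sup>2" by blast
    qed
    then show ?thesis by blast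
  qed
  have summable: "(\<lambda>n. (cmod (coord (X i) n - g n))\<^sup>2) summable_on UNIV"
    if "\<And>A. finite A \<Longrightarrow> (\<Sum>n\<in>A. (cmod (coord (X i) n - g n))\<^sup>2) \<le> e\<^sup>2" for i e
    by (intro nonneg_bdd_above_summable_on bdd_aboveI2[where M = "e\<^sup>2"]) (auto intro: that)
  obtain i0 where i0: "\<And>A. finite A \<Longrightarrow> (\<Sum>n\<in>A. (cmod (coord (X i0) n - g n))\<^sup>2) \<le> 1\<^sup>2"
    using tail[of 1] by auto
  define d where "d = Abs_ell2 (\<lambda>n. coord (X i0) n - g n)"
  have d: "coord d n = coord (X i0) n - g n" for n
    unfolding d_def using summable[OF i0] by (subst Abs_ell2_inverse) auto
  have "X \<longlonglongrightarrow> X i0 - d"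
  proof (rule metric_LIMSEQ_I)
    fix e :: real assume "0 < e"
    then obtain M where
      M: "\<And>i A. i \<ge> M \<Longrightarrow> finite A \<Longrightarrow> (\<Sum>n\<in>A. (cmod (coord (X i) n - g n))\<^sup>2) \<le> (e/2)\<^sup>2"
      using tail[of "e/2"] by auto
    have "dist (X i) (X i0 - d) < e" if i: "i \<ge> M" for i
    proof -
      have "(norm (X i - (X i0 - d)))\<^sup>2 \<le> (e/2)\<^sup>2"
        unfolding norm_ell2_sq using M[OF i] summable[of i "e/2"]
        by (auto simp: coord_simps d intro!: infsum_le_finite_sums)
      then have "norm (X i - (X i0 - d)) \<le> e / 2"
        using \<open>0 < e\<close> by (simp add: power2_le_iff_abs_le)
      then show ?thesis using \<open>0 < e\<close> by (simp add: dist_norm)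
    qed
    then show "\<exists>no. \<forall>i\<ge>no. dist (X i) (X i0 - d) < e" by blast
  qed
  then show "convergent X" by (rule convergentI)
qed

section \<open>Symmetric operators and their spectrum\<close>

text \<open>Elements of \<^typ>\<open>operator\<close> are linear over the reals only; symmetry with respect to the
  sesquilinear form also gives linearity over the complex numbers.\<close>

definition symmetric_op :: "operator \<Rightarrow> bool" where
  "symmetric_op T \<longleftrightarrow> (\<forall>\<phi> \<psi>. cinner (T \<phi>) \<psi> = cinner \<phi> (T \<psi>))"

lemma symmetric_opD: "symmetric_op T \<Longrightarrow> cinner (T \<phi>) \<psi> = cinner \<phi> (T \<psi>)"
  by (simp add: symmetric_op_def)

lemma symmetric_op_cscale:
  assumes "symmetric_op T"
  shows "T (cscale c f) = cscale c (T f)"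
  by (rule cinner_eqI)
    (simp add: assms[THEN symmetric_opD, symmetric] cinner_cscale_right)

lemma symmetric_op_add: "symmetric_op S \<Longrightarrow> symmetric_op T \<Longrightarrow> symmetric_op (S + T)"
  and symmetric_op_diff: "symmetric_op S \<Longrightarrow> symmetric_op T \<Longrightarrow> symmetric_op (S - T)"
  and symmetric_op_scaleR: "symmetric_op S \<Longrightarrow> symmetric_op (r *\<^sub>R S)"
  by (simp_all add: symmetric_op_def blinfun.bilinear_simps cinner_add_left cinner_add_right
      cinner_diff_left cinner_diff_right cinner_scaleR_left cinner_scaleR_right)

lemma invertible_compose:
  fixes S T :: operator
  assumes "\<exists>R. R o\<^sub>L S = id_blinfun \<and> S o\<^sub>L R = id_blinfun"
    and "\<exists>R. R o\<^sub>L T = id_blinfun \<and> T o\<^sub>L R = id_blinfun"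
  shows "\<exists>R. R o\<^sub>L (S o\<^sub>L T) = id_blinfun \<and> (S o\<^sub>L T) o\<^sub>L R = id_blinfun"
proof -
  obtain U V where UV: "U o\<^sub>L S = id_blinfun" "S o\<^sub>L U = id_blinfun"
    "V o\<^sub>L T = id_blinfun" "T o\<^sub>L V = id_blinfun" using assms by blast
  have pt: "U (S x) = x" "S (U x) = x" "V (T x) = x" "T (V x) = x" for x
    using UV by (metis blinfun_apply_blinfun_compose blinfun_apply_id_blinfun id_apply)+
  have "(V o\<^sub>L U) o\<^sub>L (S o\<^sub>L T) = id_blinfun" "(S o\<^sub>L T) o\<^sub>L (V o\<^sub>L U) = id_blinfun"
    by (auto intro!: blinfun_eqI simp: pt)
  then show ?thesis by blast
qed

text \<open>The Lax--Milgram argument: for small \<open>\<rho>\<close> the map \<open>\<phi> \<mapsto> \<phi> - \<rho> (S \<phi> - \<psi>)\<close> is a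
  contraction, and its fixed point solves \<open>S \<phi> = \<psi>\<close>.\<close>

lemma coercive_invertible:
  fixes S :: operator
  assumes c: "0 < c" and coercive: "\<And>\<phi>. c * (norm \<phi>)\<^sup>2 \<le> inner (S \<phi>) \<phi>"
  shows "\<exists>R. R o\<^sub>L S = id_blinfun \<and> S o\<^sub>L R = id_blinfun"
proof -
  \<comment> \<open>Any \<open>M\<close> above both \<open>\<parallel>S\<parallel>\<close> and \<open>c\<close> will do; \<open>c \<le> M\<close> keeps the square root below real.\<close>
  define M where "M = norm S + c"
  have M: "0 < M" "norm S \<le> M" "c \<le> M" using c by (auto simp: M_def add_nonneg_pos)
  have below: "c * norm \<phi> \<le> norm (S \<phi>)" for \<phi>
  proof (cases "\<phi> = 0")
    case False
    have "c * (norm \<phi>)\<^sup>2 \<le> norm (S \<phi>) * norm \<phi>"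
      using coercive[of \<phi>] norm_cauchy_schwarz[of "S \<phi>" \<phi>] by linarith
    then show ?thesis using False by (simp add: power2_eq_square)
  qed simp
  \<comment> \<open>This \<open>\<rho>\<close> minimizes the bound \<open>1 - 2 \<rho> c + \<rho>\<^sup>2 M\<^sup>2\<close> for the squared contraction factor.\<close>
  define \<rho> where "\<rho> = c / M\<^sup>2"
  have \<rho>: "0 < \<rho>" using c M by (simp add: \<rho>_def)
  define q where "q = sqrt (1 - c\<^sup>2 / M\<^sup>2)"
  have q1: "c\<^sup>2 / M\<^sup>2 \<le> 1" "0 < c\<^sup>2 / M\<^sup>2" using c M by (simp_all add: power_mono)
  then have q: "0 \<le> q" "q < 1" by (auto simp: q_def)
  have contr: "norm (\<phi> - \<rho> *\<^sub>R S \<phi>) \<le> q * norm \<phi>" for \<phi>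
  proof -
    have "(norm (S \<phi>))\<^sup>2 \<le> (M * norm \<phi>)\<^sup>2"
      using order_trans[OF norm_blinfun[of S \<phi>] mult_right_mono[OF M(2) norm_ge_zero]]
      by (intro power_mono) auto
    then have "\<rho>\<^sup>2 * (norm (S \<phi>))\<^sup>2 \<le> \<rho>\<^sup>2 * (M * norm \<phi>)\<^sup>2" by (intro mult_left_mono) auto
    moreover have "2 * \<rho> * (c * (norm \<phi>)\<^sup>2) \<le> 2 * \<rho> * inner (S \<phi>) \<phi>"
      using \<rho> coercive[of \<phi>] by (intro mult_left_mono) auto
    moreover have "(norm (\<phi> - \<rho> *\<^sub>R S \<phi>))\<^sup>2 =
        (norm \<phi>)\<^sup>2 - 2 * \<rho> * inner (S \<phi>) \<phi> + \<rho>\<^sup>2 * (norm (S \<phi>))\<^sup>2"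
      unfolding power2_norm_eq_inner
      by (simp add: inner_diff_left inner_diff_right inner_commute power2_eq_square algebra_simps)
    ultimately have "(norm (\<phi> - \<rho> *\<^sub>R S \<phi>))\<^sup>2 \<le>
        (norm \<phi>)\<^sup>2 - 2 * \<rho> * (c * (norm \<phi>)\<^sup>2) + \<rho>\<^sup>2 * (M * norm \<phi>)\<^sup>2" by linarith
    also have "\<dots> = (1 - c\<^sup>2 / M\<^sup>2) * (norm \<phi>)\<^sup>2"
      using M by (simp add: \<rho>_def field_simps power2_eq_square)
    also have "\<dots> = (q * norm \<phi>)\<^sup>2" using q1 by (simp add: q_def power_mult_distrib)
    finally show ?thesis using q by (simp add: power2_le_iff_abs_le)
  qed
  have ex: "\<exists>\<phi>. S \<phi> = \<psi>" for \<psi>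
  proof -
    have "\<exists>!\<phi>. \<phi> - \<rho> *\<^sub>R (S \<phi> - \<psi>) = \<phi>"
    proof (rule banach_fix_type[OF q], intro allI)
      fix x y
      have "x - \<rho> *\<^sub>R (S x - \<psi>) - (y - \<rho> *\<^sub>R (S y - \<psi>)) = (x - y) - \<rho> *\<^sub>R S (x - y)"
        by (simp add: blinfun.bilinear_simps algebra_simps)
      then show "dist (x - \<rho> *\<^sub>R (S x - \<psi>)) (y - \<rho> *\<^sub>R (S y - \<psi>)) \<le> q * dist x y"
        using contr[of "x - y"] by (simp only: dist_norm)
    qed
    then show ?thesis using \<rho> by auto
  qed
  have inj: "\<phi> = \<phi>'" if "S \<phi> = S \<phi>'" for \<phi> \<phi>'
    using below[of "\<phi> - \<phi>'"] that c by (simp add: blinfun.bilinear_simps mult_le_0_iff)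
  define r where "r = (\<lambda>\<psi>. SOME \<phi>. S \<phi> = \<psi>)"
  have Sr: "S (r \<psi>) = \<psi>" for \<psi> unfolding r_def by (rule someI_ex[OF ex])
  have "bounded_linear r"
  proof (rule bounded_linear_ell2I)
    show "r (f + g) = r f + r g" for f g by (rule inj) (simp add: Sr blinfun.bilinear_simps)
    show "r (s *\<^sub>R f) = s *\<^sub>R r f" for s f by (rule inj) (simp add: Sr blinfun.bilinear_simps)
    show "norm (r f) \<le> norm f * (1 / c)" for f using below[of "r f"] c by (simp add: Sr field_simps)
  qed
  then have r: "blinfun_apply (Blinfun r) = r" by (rule bounded_linear_Blinfun_apply)
  have rS: "r (S \<phi>) = \<phi>" for \<phi> by (rule inj) (rule Sr)
  have "Blinfun r o\<^sub>L S = id_blinfun" "S o\<^sub>L Blinfun r = id_blinfun"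
    by (rule blinfun_eqI, simp add: r rS Sr)+
  then show ?thesis by blast
qed

text \<open>The numerical range of \<open>S\<close> only has to keep away from zero in some direction \<open>w\<close>.\<close>

lemma invertible_of_rotated_coercive:
  fixes S :: operator
  assumes c: "0 < c" and w: "w \<noteq> 0"
    and coercive: "\<And>\<phi>. c * (norm \<phi>)\<^sup>2 \<le> Re (cinner (cscale w (S \<phi>)) \<phi>)"
  shows "\<exists>R. R o\<^sub>L S = id_blinfun \<and> S o\<^sub>L R = id_blinfun"
proof -
  have 1: "\<exists>R. R o\<^sub>L (scalar_op w o\<^sub>L S) = id_blinfun \<and> (scalar_op w o\<^sub>L S) o\<^sub>L R = id_blinfun"
    by (rule coercive_invertible[OF c]) (use coercive in \<open>simp add: scalar_op_apply Re_cinner\<close>)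
  have "scalar_op w o\<^sub>L scalar_op (1 / w) = id_blinfun \<and>
    scalar_op (1 / w) o\<^sub>L scalar_op w = id_blinfun"
    using w by (auto intro!: blinfun_eqI simp: scalar_op_apply)
  then have 2: "\<exists>R. R o\<^sub>L scalar_op (1 / w) = id_blinfun \<and> scalar_op (1 / w) o\<^sub>L R = id_blinfun"
    by blast
  have "scalar_op (1 / w) o\<^sub>L (scalar_op w o\<^sub>L S) = S"
    using w by (auto intro!: blinfun_eqI simp: scalar_op_apply)
  then show ?thesis using invertible_compose[OF 2 1] by simp
qed

lemma cinner_symmetric_op_self:
  assumes "symmetric_op T"
  shows "cinner (T \<phi>) \<phi> = of_real (inner (T \<phi>) \<phi>)"
proof -
  have "Im (cinner (T \<phi>) \<phi>) = 0"
    using arg_cong[OF cinner_commute[of "T \<phi>" \<phi>], of Im] symmetric_opD[OF assms, of \<phi> \<phi>] by simp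
  then show ?thesis by (simp add: complex_eq_iff Re_cinner)
qed

text \<open>Multiplied by \<open>\<plusminus>\<i>\<close>, the operator \<open>T - z\<close> with \<open>Im z \<noteq> 0\<close> is coercive with constant
  \<open>\<bar>Im z\<bar>\<close>, because the quadratic form of \<open>T\<close> is real.\<close>

lemma symmetric_op_resolvent:
  assumes T: "symmetric_op T" and z: "Im z \<noteq> 0"
  shows "\<exists>R. R o\<^sub>L (T - scalar_op z) = id_blinfun \<and> (T - scalar_op z) o\<^sub>L R = id_blinfun"
proof (rule invertible_of_rotated_coercive)
  let ?w = "of_real (sgn (Im z)) * \<i>"
  show "0 < \<bar>Im z\<bar>" "?w \<noteq> 0" using z by (auto simp: sgn_eq_0_iff)
  fix \<phi>
  have "Re (cinner (cscale ?w ((T - scalar_op z) \<phi>)) \<phi>) = \<bar>Im z\<bar> * (norm \<phi>)\<^sup>2"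
    by (simp add: cinner_cscale_left blinfun.bilinear_simps scalar_op_apply cinner_diff_left
        cinner_symmetric_op_self[OF T] cinner_self abs_sgn[of "Im z"] algebra_simps
        del: of_real_power)
  then show "\<bar>Im z\<bar> * (norm \<phi>)\<^sup>2 \<le> Re (cinner (cscale ?w ((T - scalar_op z) \<phi>)) \<phi>)" by simp
qed

lemma symmetric_op_spectrum_real: "symmetric_op T \<Longrightarrow> z \<in> op_spectrum T \<Longrightarrow> Im z = 0"
  unfolding op_spectrum_def using symmetric_op_resolvent by blast

text \<open>For real \<open>x\<close> with \<open>\<bar>x\<bar> > \<parallel>T\<parallel>\<close>, the operator \<open>x - T\<close> or its negative is coercive.\<close>

lemma op_spectrum_real_bounded:
  assumes T: "symmetric_op T" and "complex_of_real x \<in> op_spectrum T"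
  shows "\<bar>x\<bar> \<le> norm T"
proof (rule ccontr)
  assume neg: "\<not> \<bar>x\<bar> \<le> norm T"
  have "\<exists>R. R o\<^sub>L (T - scalar_op x) = id_blinfun \<and> (T - scalar_op x) o\<^sub>L R = id_blinfun"
  proof (rule invertible_of_rotated_coercive)
    let ?w = "of_real (- sgn x) :: complex"
    show "0 < \<bar>x\<bar> - norm T" using neg by simp
    show "?w \<noteq> 0" using neg norm_ge_zero[of T] by (auto simp: sgn_eq_0_iff simp del: norm_ge_zero)
    fix \<phi>
    have "\<bar>inner (T \<phi>) \<phi>\<bar> \<le> norm (T \<phi>) * norm \<phi>" by (rule Cauchy_Schwarz_ineq2)
    also have "\<dots> \<le> norm T * norm \<phi> * norm \<phi>" by (intro mult_right_mono norm_blinfun) simp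
    finally have 1: "\<bar>inner (T \<phi>) \<phi>\<bar> \<le> norm T * (norm \<phi>)\<^sup>2" by (simp add: power2_eq_square mult.assoc)
    have "\<bar>sgn x * inner (T \<phi>) \<phi>\<bar> \<le> \<bar>inner (T \<phi>) \<phi>\<bar>"
      by (auto simp: abs_mult sgn_real_def)
    with 1 have 2: "sgn x * inner (T \<phi>) \<phi> \<le> norm T * (norm \<phi>)\<^sup>2" by linarith
    have "Re (cinner (cscale ?w ((T - scalar_op x) \<phi>)) \<phi>) =
        \<bar>x\<bar> * (norm \<phi>)\<^sup>2 - sgn x * inner (T \<phi>) \<phi>"
      by (simp add: cinner_cscale_left blinfun.bilinear_simps scalar_op_apply cinner_diff_left
          cinner_symmetric_op_self[OF T] cinner_self abs_sgn[of x] algebra_simps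
          del: of_real_power)
    with 2 show "(\<bar>x\<bar> - norm T) * (norm \<phi>)\<^sup>2 \<le> Re (cinner (cscale ?w ((T - scalar_op x) \<phi>)) \<phi>)"
      by (simp add: left_diff_distrib)
  qed
  then show False using assms(2) unfolding op_spectrum_def by blast
qed

section \<open>Polynomials of a symmetric operator\<close>

lemma scalar_op_simps:
  "scalar_op 0 = 0" "scalar_op 1 = id_blinfun" "scalar_op (c + d) = scalar_op c + scalar_op d"
  "scalar_op c o\<^sub>L scalar_op d = scalar_op (c * d)"
  by (auto intro!: blinfun_eqI simp: scalar_op_apply blinfun.bilinear_simps cscale_add_left)

lemma op_poly_eq_sum:
  assumes "degree p \<le> n"
  shows "op_poly p T = (\<Sum>i\<le>n. scalar_op (coeff p i) o\<^sub>L (((o\<^sub>L) T) ^^ i) id_blinfun)"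
  unfolding op_poly_def using assms
  by (intro sum.mono_neutral_left) (auto simp: coeff_eq_0 scalar_op_simps bounded_bilinear.zero_left[OF bounded_bilinear_blinfun_compose])

lemma op_poly_add: "op_poly (p + q) T = op_poly p T + op_poly q T"
proof -
  let ?n = "max (degree p) (degree q)"
  have "degree (p + q) \<le> ?n" by (rule degree_add_le_max)
  then show ?thesis
    by (simp add: op_poly_eq_sum[of _ ?n] scalar_op_simps sum.distrib[symmetric]
        bounded_bilinear.add_left[OF bounded_bilinear_blinfun_compose])
qed

lemma op_poly_smult: "op_poly (smult c p) T = scalar_op c o\<^sub>L op_poly p T"
proof -
  have "op_poly (smult c p) T =
      (\<Sum>i\<le>degree p. scalar_op (coeff (smult c p) i) o\<^sub>L (((o\<^sub>L) T) ^^ i) id_blinfun)"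
    by (intro op_poly_eq_sum degree_smult_le)
  also have "\<dots> = scalar_op c o\<^sub>L op_poly p T"
    unfolding op_poly_def bounded_bilinear.sum_right[OF bounded_bilinear_blinfun_compose]
    by (intro sum.cong refl) (auto intro!: blinfun_eqI simp: scalar_op_apply)
  finally show ?thesis .
qed

lemma op_poly_0: "op_poly 0 T = 0"
  by (simp add: op_poly_def scalar_op_simps)

lemma op_poly_const: "op_poly [:c:] T = scalar_op c"
  by (auto intro!: blinfun_eqI simp: op_poly_def)

lemma op_poly_diff: "op_poly (p - q) T = op_poly p T - op_poly q T"
  using op_poly_add[of "p - q" q T] by simp

lemma op_poly_pCons:
  assumes "symmetric_op T"
  shows "op_poly (pCons c p) T = scalar_op c + (T o\<^sub>L op_poly p T)"
proof -
  have "op_poly (pCons c p) T =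
      (\<Sum>i\<le>Suc (degree p). scalar_op (coeff (pCons c p) i) o\<^sub>L (((o\<^sub>L) T) ^^ i) id_blinfun)"
    by (intro op_poly_eq_sum degree_pCons_le)
  also have "\<dots> = scalar_op c + (T o\<^sub>L op_poly p T)"
    unfolding op_poly_def sum.atMost_Suc_shift bounded_bilinear.sum_right[OF bounded_bilinear_blinfun_compose]
    by (intro arg_cong2[of _ _ _ _ "(+)"] sum.cong refl)
      (auto intro!: blinfun_eqI simp: scalar_op_apply symmetric_op_cscale[OF assms])
  finally show ?thesis .
qed

lemma op_poly_mult:
  assumes "symmetric_op T"
  shows "op_poly (p * q) T = op_poly p T o\<^sub>L op_poly q T"
  by (induction p)
    (auto simp: op_poly_0 op_poly_add op_poly_smult op_poly_pCons[OF assms] scalar_op_simps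
      bounded_bilinear.add_left[OF bounded_bilinear_blinfun_compose] intro!: blinfun_eqI simp: blinfun.bilinear_simps)

lemma op_poly_commute:
  assumes T: "symmetric_op T" and A: "symmetric_op A" and AT: "\<And>\<phi>. A (T \<phi>) = T (A \<phi>)"
  shows "A (op_poly p T \<phi>) = op_poly p T (A \<phi>)"
  by (induction p arbitrary: \<phi>)
    (auto simp: op_poly_0 op_poly_pCons[OF T] blinfun.bilinear_simps scalar_op_apply
      symmetric_op_cscale[OF A] AT)

lemma op_poly_adjoint:
  assumes T: "symmetric_op T"
  shows "cinner (op_poly p T \<phi>) \<psi> = cinner \<phi> (op_poly (map_poly cnj p) T \<psi>)"
proof (induction p arbitrary: \<phi> \<psi>)
  case (pCons c p)
  have "cinner (T (op_poly p T \<phi>)) \<psi> = cinner \<phi> (T (op_poly (map_poly cnj p) T \<psi>))"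
    using pCons.IH[of \<phi> "T \<psi>"] op_poly_commute[OF T T, of "map_poly cnj p" \<psi>]
    by (simp add: symmetric_opD[OF T])
  then show ?case
    by (simp add: op_poly_pCons[OF T] map_poly_pCons blinfun.bilinear_simps scalar_op_apply
        cinner_add_left cinner_add_right cinner_cscale_left cinner_cscale_right)
qed (simp add: op_poly_0 cinner_zero_left cinner_zero_right)

text \<open>The part of the spectral mapping theorem that is needed: after splitting a polynomial into
  linear factors over the complex numbers, one of the factors must fail to be invertible.\<close>

lemma op_poly_not_invertible_root:
  assumes T: "symmetric_op T" and "q \<noteq> 0"
    and "\<nexists>R. R o\<^sub>L op_poly q T = id_blinfun \<and> op_poly q T o\<^sub>L R = id_blinfun"
  shows "\<exists>z\<in>op_spectrum T. poly q z = 0"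
  using assms(2,3)
proof (induction "degree q" arbitrary: q)
  case 0
  then obtain c where q: "q = [:c:]" by (metis degree_eq_zeroE)
  with 0 have "scalar_op (1 / c) o\<^sub>L op_poly q T = id_blinfun"
    "op_poly q T o\<^sub>L scalar_op (1 / c) = id_blinfun"
    by (auto simp: op_poly_const scalar_op_simps)
  with 0 show ?case by blast
next
  case (Suc n)
  have "\<not> constant (poly q)" using Suc.hyps(2) by (simp add: constant_degree)
  then obtain z where z: "poly q z = 0" using fundamental_theorem_of_algebra by blast
  then obtain r where r: "q = [:- z, 1:] * r" by (auto simp: poly_eq_0_iff_dvd elim: dvdE)
  have r0: "r \<noteq> 0" using Suc.prems r by auto
  have "degree q = Suc (degree r)" unfolding r using r0 by (subst degree_mult_eq) auto
  then have deg: "n = degree r" using Suc.hyps(2) by simp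
  have lin: "op_poly [:- z, 1:] T = T - scalar_op z"
    by (rule blinfun_eqI) (simp add: op_poly_pCons[OF T] op_poly_0 scalar_op_simps
        scalar_op_apply blinfun.bilinear_simps cscale_minus_left)
  have qr: "op_poly q T = (T - scalar_op z) o\<^sub>L op_poly r T"
    unfolding r op_poly_mult[OF T] lin ..
  show ?case
  proof (cases "z \<in> op_spectrum T")
    case False
    then have "\<exists>R. R o\<^sub>L (T - scalar_op z) = id_blinfun \<and> (T - scalar_op z) o\<^sub>L R = id_blinfun"
      by (simp add: op_spectrum_def)
    then have "\<nexists>R. R o\<^sub>L op_poly r T = id_blinfun \<and> op_poly r T o\<^sub>L R = id_blinfun"
      using Suc.prems(2) invertible_compose unfolding qr by blast
    from Suc.hyps(1)[OF deg r0 this] show ?thesis unfolding r by auto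
  qed (use z in blast)
qed

lemma blinfun_norm_le_if_square:
  fixes B :: operator
  assumes "\<And>\<phi>. (norm (B \<phi>))\<^sup>2 \<le> c * (norm \<phi>)\<^sup>2"
  shows "(norm B)\<^sup>2 \<le> c"
proof -
  have c: "0 \<le> c"
    using order_trans[OF zero_le_power2 assms[of "delta 0"]] by (simp add: norm_delta)
  have "norm B \<le> sqrt c"
  proof (rule norm_blinfun_bound)
    fix \<phi>
    have "(norm (B \<phi>))\<^sup>2 \<le> (sqrt c * norm \<phi>)\<^sup>2" using assms[of \<phi>] c by (simp add: power_mult_distrib)
    then show "norm (B \<phi>) \<le> sqrt c * norm \<phi>" using c by (simp add: power2_le_iff_abs_le)
  qed (use c in simp)
  then have "(norm B)\<^sup>2 \<le> (sqrt c)\<^sup>2" by (intro power_mono) auto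
  then show ?thesis using c by simp
qed

text \<open>If \<open>\<phi>\<close> is a unit vector on which \<open>B\<close> nearly attains its norm \<open>\<beta>\<close>, then \<open>B\<^sup>* B \<phi>\<close> is
  nearly \<open>\<beta>\<^sup>2 \<phi>\<close>; so \<open>B\<^sup>* B - \<beta>\<^sup>2\<close> has no bounded left inverse.\<close>

lemma adjoint_product_minus_norm_not_invertible:
  fixes B B' :: operator
  assumes adj: "\<And>\<phi> \<psi>. cinner (B \<phi>) \<psi> = cinner \<phi> (B' \<psi>)"
  shows "R o\<^sub>L ((B' o\<^sub>L B) - scalar_op (of_real ((norm B)\<^sup>2))) \<noteq> id_blinfun"
proof
  assume R: "R o\<^sub>L ((B' o\<^sub>L B) - scalar_op (of_real ((norm B)\<^sup>2))) = id_blinfun"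
  define \<beta> where "\<beta> = norm B"
  define k where "k = (norm R)\<^sup>2"
  have B': "norm (B' \<psi>) \<le> \<beta> * norm \<psi>" for \<psi>
  proof (cases "B' \<psi> = 0")
    case False
    have "(norm (B' \<psi>))\<^sup>2 = cmod (cinner (B (B' \<psi>)) \<psi>)"
      unfolding adj cinner_self norm_of_real by simp
    also have "\<dots> \<le> norm (B (B' \<psi>)) * norm \<psi>" by (rule norm_cinner_le)
    also have "\<dots> \<le> \<beta> * norm (B' \<psi>) * norm \<psi>"
      unfolding \<beta>_def by (intro mult_right_mono norm_blinfun) simp
    finally show ?thesis using False by (simp add: power2_eq_square algebra_simps)
  qed (simp add: \<beta>_def)
  \<comment> \<open>A left inverse of squared norm \<open>k\<close> keeps \<open>\<parallel>B \<phi>\<parallel>\<close> strictly below \<open>\<beta> \<parallel>\<phi>\<parallel>\<close>, uniformly in \<open>\<phi>\<close>.\<close>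
  have key: "(norm \<phi>)\<^sup>2 \<le> k * (2 * \<beta>^4 * (norm \<phi>)\<^sup>2 - 2 * \<beta>\<^sup>2 * (norm (B \<phi>))\<^sup>2)" for \<phi>
  proof -
    define \<xi> where "\<xi> = B' (B \<phi>) - \<beta>\<^sup>2 *\<^sub>R \<phi>"
    have "((B' o\<^sub>L B) - scalar_op (of_real ((norm B)\<^sup>2))) \<phi> = \<xi>"
      by (simp add: \<xi>_def \<beta>_def blinfun.bilinear_simps scalar_op_apply cscale_of_real
          del: of_real_power)
    then have "\<phi> = R \<xi>" using arg_cong[OF R, of "\<lambda>A. blinfun_apply A \<phi>"] by simp
    then have "norm \<phi> \<le> norm R * norm \<xi>" using norm_blinfun[of R \<xi>] by simp
    then have "(norm \<phi>)\<^sup>2 \<le> (norm R * norm \<xi>)\<^sup>2" by (intro power_mono) auto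
    then have 1: "(norm \<phi>)\<^sup>2 \<le> k * (norm \<xi>)\<^sup>2" by (simp add: k_def power_mult_distrib)
    have in1: "inner (B' (B \<phi>)) \<phi> = (norm (B \<phi>))\<^sup>2"
      using arg_cong[OF adj[of \<phi> "B \<phi>"], of Re]
      by (simp add: Re_cinner power2_norm_eq_inner inner_commute)
    have "norm (B' (B \<phi>)) \<le> \<beta> * (\<beta> * norm \<phi>)"
      using B'[of "B \<phi>"] mult_left_mono[OF norm_blinfun[of B \<phi>], of \<beta>] by (simp add: \<beta>_def)
    then have "(norm (B' (B \<phi>)))\<^sup>2 \<le> (\<beta> * (\<beta> * norm \<phi>))\<^sup>2" by (intro power_mono) auto
    then have 2: "(norm (B' (B \<phi>)))\<^sup>2 \<le> \<beta>^4 * (norm \<phi>)\<^sup>2"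
      by (simp add: power_mult_distrib power_mult[symmetric])
    have "(norm \<xi>)\<^sup>2 = (norm (B' (B \<phi>)))\<^sup>2 - 2 * \<beta>\<^sup>2 * inner (B' (B \<phi>)) \<phi> + \<beta>^4 * (norm \<phi>)\<^sup>2"
      unfolding \<xi>_def power2_norm_eq_inner
      by (simp add: inner_diff_left inner_diff_right inner_commute algebra_simps)
    then have "(norm \<xi>)\<^sup>2 \<le> 2 * \<beta>^4 * (norm \<phi>)\<^sup>2 - 2 * \<beta>\<^sup>2 * (norm (B \<phi>))\<^sup>2"
      using 2 in1 by simp
    then have "k * (norm \<xi>)\<^sup>2 \<le> k * (2 * \<beta>^4 * (norm \<phi>)\<^sup>2 - 2 * \<beta>\<^sup>2 * (norm (B \<phi>))\<^sup>2)"
      by (intro mult_left_mono) (auto simp: k_def)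
    with 1 show ?thesis by linarith
  qed
  have "k \<noteq> 0" and \<beta>: "\<beta> \<noteq> 0"
    using key[of "delta 0"] by (auto simp: norm_delta)
  then have k: "0 < k" by (simp add: k_def)
  have "(norm (B \<phi>))\<^sup>2 \<le> (\<beta>\<^sup>2 - 1 / (2 * k * \<beta>\<^sup>2)) * (norm \<phi>)\<^sup>2" for \<phi>
  proof -
    have "2 * k * \<beta>\<^sup>2 * (norm (B \<phi>))\<^sup>2 \<le> (2 * k * \<beta>^4 - 1) * (norm \<phi>)\<^sup>2"
      using key[of \<phi>] by (simp add: algebra_simps)
    also have "\<dots> = 2 * k * \<beta>\<^sup>2 * ((\<beta>\<^sup>2 - 1 / (2 * k * \<beta>\<^sup>2)) * (norm \<phi>)\<^sup>2)"
      using k \<beta> by (simp add: field_simps power2_eq_square power4_eq_xxxx)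
    finally show ?thesis using k \<beta> by (simp add: mult_le_cancel_left_pos)
  qed
  then have "\<beta>\<^sup>2 \<le> \<beta>\<^sup>2 - 1 / (2 * k * \<beta>\<^sup>2)"
    unfolding \<beta>_def by (rule blinfun_norm_le_if_square)
  moreover have "0 < 1 / (2 * k * \<beta>\<^sup>2)" using k \<beta> by simp
  ultimately show False by linarith
qed

text \<open>The operator \<open>p(T)\<^sup>* p(T) - \<parallel>p(T)\<parallel>\<^sup>2\<close> is not invertible and is a polynomial of \<open>T\<close>.  This polynomial
  vanishes at some point \<open>x\<close> of the spectrum, which for real \<open>x\<close> means \<open>\<bar>p(x)\<bar> = \<parallel>p(T)\<parallel>\<close>.  The
  statement includes that the spectrum is not empty.\<close>

lemma norm_op_poly_attained:
  assumes T: "symmetric_op T"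
  shows "\<exists>x. complex_of_real x \<in> op_spectrum T \<and> norm (op_poly p T) = cmod (poly p (of_real x))"
proof -
  define q where "q p = map_poly cnj p * p - [:of_real ((norm (op_poly p T))\<^sup>2):]" for p
  have attained: "\<exists>x. complex_of_real x \<in> op_spectrum T \<and> norm (op_poly p T) = cmod (poly p (of_real x))"
    if q0: "q p \<noteq> 0" for p
  proof -
    have "\<nexists>R. R o\<^sub>L op_poly (q p) T = id_blinfun \<and> op_poly (q p) T o\<^sub>L R = id_blinfun"
      using adjoint_product_minus_norm_not_invertible[OF op_poly_adjoint[OF T, of p]]
      by (simp add: q_def op_poly_diff op_poly_mult[OF T] op_poly_const)
    from op_poly_not_invertible_root[OF T q0 this]
    obtain z where z: "z \<in> op_spectrum T" "poly (q p) z = 0" by blast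
    have zr: "z = of_real (Re z)"
      using symmetric_op_spectrum_real[OF T z(1)] by (simp add: complex_eq_iff)
    have "cnj (poly p (of_real (Re z))) * poly p (of_real (Re z)) = of_real ((norm (op_poly p T))\<^sup>2)"
      using z(2) zr by (simp add: q_def) (metis complex_cnj_complex_of_real)
    then have "(cmod (poly p (of_real (Re z))))\<^sup>2 = (norm (op_poly p T))\<^sup>2"
      by (metis complex_norm_square mult.commute of_real_eq_iff)
    moreover have "complex_of_real (Re z) \<in> op_spectrum T" using z(1) zr by metis
    ultimately show ?thesis by (intro exI[of _ "Re z"]) (simp add: power2_eq_iff_nonneg)
  qed
  show ?thesis
  proof (cases "q p = 0")
    \<comment> \<open>Then \<open>\<bar>p\<bar>\<close> is constant on the reals and any point of the spectrum will do; the polynomial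
      \<open>x\<close>, for which \<open>q\<close> has degree two, provides one.\<close>
    case True
    have "q [:0, 1:] \<noteq> 0"
    proof
      assume "q [:0, 1:] = 0"
      then have "coeff (q [:0, 1:]) 2 = 0" by simp
      then show False by (simp add: q_def map_poly_pCons numeral_2_eq_2)
    qed
    then obtain x where x: "complex_of_real x \<in> op_spectrum T" using attained by blast
    have "cnj (poly p (of_real x)) * poly p (of_real x) = of_real ((norm (op_poly p T))\<^sup>2)"
      using arg_cong[OF True, of "\<lambda>r. poly r (of_real x)"] by (simp add: q_def)
    then have "(cmod (poly p (of_real x)))\<^sup>2 = (norm (op_poly p T))\<^sup>2"
      by (metis complex_norm_square mult.commute of_real_eq_iff)
    then show ?thesis using x by (auto simp: power2_eq_iff_nonneg)
  qed (rule attained)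
qed

section \<open>The continuous functional calculus\<close>

abbreviation (input) real_spectrum :: "operator \<Rightarrow> real set" where
  "real_spectrum T \<equiv> {x. complex_of_real x \<in> op_spectrum T}"

lemma norm_op_poly_le:
  assumes "symmetric_op T" "\<And>x. x \<in> real_spectrum T \<Longrightarrow> cmod (poly p (of_real x)) \<le> c"
  shows "norm (op_poly p T) \<le> c"
  using norm_op_poly_attained[OF assms(1), of p] assms(2) by auto

text \<open>The definite description in \<^const>\<open>functional_calculus\<close> is proper: two approximating sequences
  have close values at \<open>T\<close>, because their difference is small on the spectrum.\<close>

lemma functional_calculus_tendsto:
  assumes T: "symmetric_op T"
    and lim: "uniform_limit (real_spectrum T) (\<lambda>n x. poly (p n) (of_real x)) F sequentially"
  shows "(\<lambda>n. op_poly (p n) T) \<longlonglongrightarrow> functional_calculus F T"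
proof -
  have close: "\<exists>N. \<forall>m\<ge>N. \<forall>n\<ge>N. norm (op_poly (p m) T - op_poly (q n) T) \<le> e"
    if p: "uniform_limit (real_spectrum T) (\<lambda>n x. poly (p n) (of_real x)) F sequentially"
      and q: "uniform_limit (real_spectrum T) (\<lambda>n x. poly (q n) (of_real x)) F sequentially"
      and e: "0 < e" for p q :: "nat \<Rightarrow> complex poly" and e
  proof -
    obtain N1 where N1: "\<And>n x. n \<ge> N1 \<Longrightarrow> x \<in> real_spectrum T \<Longrightarrow>
        dist (poly (p n) (of_real x)) (F x) < e / 2"
      using uniform_limitD[OF p, of "e/2"] e unfolding eventually_sequentially by auto
    obtain N2 where N2: "\<And>n x. n \<ge> N2 \<Longrightarrow> x \<in> real_spectrum T \<Longrightarrow>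
        dist (poly (q n) (of_real x)) (F x) < e / 2"
      using uniform_limitD[OF q, of "e/2"] e unfolding eventually_sequentially by auto
    have "norm (op_poly (p m) T - op_poly (q n) T) \<le> e" if "m \<ge> max N1 N2" "n \<ge> max N1 N2" for m n
      unfolding op_poly_diff[symmetric]
    proof (rule norm_op_poly_le[OF T])
      fix x assume "x \<in> real_spectrum T"
      then have "dist (poly (p m) (of_real x)) (poly (q n) (of_real x)) < e"
        using dist_triangle_half_l[OF N1[of m x] N2[of n x]] that by simp
      then show "cmod (poly (p m - q n) (of_real x)) \<le> e" by (simp add: dist_norm)
    qed
    then show ?thesis by blast
  qed
  have "Cauchy (\<lambda>n. op_poly (p n) T)"
  proof (rule metric_CauchyI)
    fix e :: real assume e: "0 < e"
    then have "\<exists>N. \<forall>m\<ge>N. \<forall>n\<ge>N. norm (op_poly (p m) T - op_poly (p n) T) \<le> e / 2"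
      by (intro close[OF lim lim]) simp
    then obtain N where "\<And>m n. m \<ge> N \<Longrightarrow> n \<ge> N \<Longrightarrow> norm (op_poly (p m) T - op_poly (p n) T) \<le> e / 2"
      by blast
    then have "dist (op_poly (p m) T) (op_poly (p n) T) < e" if "m \<ge> N" "n \<ge> N" for m n
      using that e by (fastforce simp: dist_norm intro: order_le_less_trans[of _ "e / 2"])
    then show "\<exists>M. \<forall>m\<ge>M. \<forall>n\<ge>M. dist (op_poly (p m) T) (op_poly (p n) T) < e" by blast
  qed
  then obtain S where S: "(\<lambda>n. op_poly (p n) T) \<longlonglongrightarrow> S"
    by (auto simp: Cauchy_convergent_iff convergent_def)
  have "functional_calculus F T = S"
    unfolding functional_calculus_def
  proof (rule the_equality)
    show "\<exists>p. uniform_limit (real_spectrum T) (\<lambda>n x. poly (p n) (of_real x)) F sequentially \<and>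
      (\<lambda>n. op_poly (p n) T) \<longlonglongrightarrow> S"
      using lim S by blast
    fix S' assume "\<exists>p. uniform_limit (real_spectrum T) (\<lambda>n x. poly (p n) (of_real x)) F sequentially \<and>
      (\<lambda>n. op_poly (p n) T) \<longlonglongrightarrow> S'"
    then obtain q where q: "uniform_limit (real_spectrum T) (\<lambda>n x. poly (q n) (of_real x)) F sequentially"
      "(\<lambda>n. op_poly (q n) T) \<longlonglongrightarrow> S'" by blast
    have "(\<lambda>n. op_poly (p n) T - op_poly (q n) T) \<longlonglongrightarrow> 0"
    proof (rule LIMSEQ_I)
      fix r :: real assume r: "0 < r"
      then have "\<exists>N. \<forall>m\<ge>N. \<forall>n\<ge>N. norm (op_poly (p m) T - op_poly (q n) T) \<le> r / 2"
        by (intro close[OF lim q(1)]) simp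
      then obtain N where "\<And>n. n \<ge> N \<Longrightarrow> norm (op_poly (p n) T - op_poly (q n) T) \<le> r / 2"
        by blast
      then have "norm (op_poly (p n) T - op_poly (q n) T - 0) < r" if "n \<ge> N" for n
        using that r by (fastforce intro: order_le_less_trans[of _ "r / 2"])
      then show "\<exists>no. \<forall>n\<ge>no. norm (op_poly (p n) T - op_poly (q n) T - 0) < r" by blast
    qed
    moreover have "(\<lambda>n. op_poly (p n) T - op_poly (q n) T) \<longlonglongrightarrow> S - S'"
      by (intro tendsto_intros S q)
    ultimately show "S' = S" using LIMSEQ_unique by fastforce
  qed
  with S show ?thesis by simp
qed

lemma real_spectrum_subset:
  assumes "symmetric_op T" "norm T \<le> R"
  shows "real_spectrum T \<subseteq> {-R..R}"
  using op_spectrum_real_bounded[OF assms(1)] assms(2) by fastforce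

lemma functional_calculus_tendsto_interval:
  assumes "symmetric_op T" "norm T \<le> R"
    and "uniform_limit {-R..R} (\<lambda>n x. poly (p n) (complex_of_real x)) F sequentially"
  shows "(\<lambda>n. op_poly (p n) T) \<longlonglongrightarrow> functional_calculus F T"
  using functional_calculus_tendsto uniform_limit_on_subset[OF assms(3) real_spectrum_subset]
    assms(1,2) by blast

lemma Weierstrass_complex_poly:
  fixes F :: "real \<Rightarrow> complex"
  assumes F: "continuous_on UNIV F"
  shows "\<exists>p. uniform_limit {-R..R} (\<lambda>n x. poly (p n) (complex_of_real x)) F sequentially"
proof -
  have real_case: "\<exists>p. \<forall>x\<in>{-R..R}. cmod (of_real (f x) - poly p (complex_of_real x)) < e"
    if f: "continuous_on UNIV f" and e: "0 < e" for f :: "real \<Rightarrow> real" and e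
  proof -
    have "continuous_on {-R..R} f" using f by (rule continuous_on_subset) simp
    from Stone_Weierstrass_real_polynomial_function[OF compact_Icc this e] obtain g
      where g: "real_polynomial_function g" "\<And>x. x \<in> {-R..R} \<Longrightarrow> \<bar>f x - g x\<bar> < e" by metis
    obtain a n where a: "g = (\<lambda>x. \<Sum>i\<le>n. a i * x ^ i)"
      using g(1) unfolding real_polynomial_function_iff_sum by auto
    have "poly (\<Sum>i\<le>n. monom (of_real (a i)) i) (complex_of_real x) = of_real (g x)" for x
      by (simp add: a poly_sum poly_monom)
    then show ?thesis using g(2)
      by (intro exI[of _ "\<Sum>i\<le>n. monom (of_real (a i)) i"]) (simp flip: of_real_diff)
  qed
  have approx: "\<exists>p. \<forall>x\<in>{-R..R}. cmod (F x - poly p (complex_of_real x)) < e" if e: "0 < e" for e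
  proof -
    have "continuous_on UNIV (\<lambda>x. Re (F x))" "continuous_on UNIV (\<lambda>x. Im (F x))"
      using F by (auto intro!: continuous_intros)
    then obtain p q where
      p: "\<And>x. x \<in> {-R..R} \<Longrightarrow> cmod (of_real (Re (F x)) - poly p (complex_of_real x)) < e / 2" and
      q: "\<And>x. x \<in> {-R..R} \<Longrightarrow> cmod (of_real (Im (F x)) - poly q (complex_of_real x)) < e / 2"
      using real_case[of "\<lambda>x. Re (F x)" "e/2"] real_case[of "\<lambda>x. Im (F x)" "e/2"] e
      by (meson half_gt_zero)
    have "cmod (F x - poly (p + smult \<i> q) (complex_of_real x)) < e" if x: "x \<in> {-R..R}" for x
    proof -
      have "F x - poly (p + smult \<i> q) (complex_of_real x) =
        (of_real (Re (F x)) - poly p (complex_of_real x)) +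
        \<i> * (of_real (Im (F x)) - poly q (complex_of_real x))"
        using complex_eq[of "F x"] by (simp add: algebra_simps)
      also have "cmod \<dots> \<le> cmod (of_real (Re (F x)) - poly p (complex_of_real x)) +
        cmod (\<i> * (of_real (Im (F x)) - poly q (complex_of_real x)))"
        by (rule norm_triangle_ineq)
      also have "\<dots> < e" using p[OF x] q[OF x] by (simp add: norm_mult)
      finally show ?thesis .
    qed
    then show ?thesis by blast
  qed
  have "\<forall>n. \<exists>p. \<forall>x\<in>{-R..R}. cmod (F x - poly p (complex_of_real x)) < 1 / real (Suc n)"
    using approx by simp
  then obtain p where p: "\<And>n x. x \<in> {-R..R} \<Longrightarrow>
      cmod (F x - poly (p n) (complex_of_real x)) < 1 / real (Suc n)"
    by metis
  have "uniform_limit {-R..R} (\<lambda>n x. poly (p n) (complex_of_real x)) F sequentially"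
  proof (rule uniform_limitI)
    fix e :: real assume e: "0 < e"
    have "\<forall>\<^sub>F n in sequentially. 1 / real (Suc n) < e"
      using order_tendstoD(2)[OF LIMSEQ_inverse_real_of_nat e] by (simp add: inverse_eq_divide)
    then show "\<forall>\<^sub>F n in sequentially. \<forall>x\<in>{-R..R}. dist (poly (p n) (complex_of_real x)) (F x) < e"
    proof (rule eventually_mono)
      fix n assume "1 / real (Suc n) < e"
      then show "\<forall>x\<in>{-R..R}. dist (poly (p n) (complex_of_real x)) (F x) < e"
        using order_less_trans[OF p[of _ n]] by (simp add: dist_norm norm_minus_commute)
    qed
  qed
  then show ?thesis by blast
qed

lemma functional_calculus_add:
  assumes T: "symmetric_op T" and F: "continuous_on UNIV F" and G: "continuous_on UNIV G"
  shows "functional_calculus (\<lambda>x. F x + G x) T = functional_calculus F T + functional_calculus G T"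
proof -
  obtain p q where
    p: "uniform_limit {-norm T..norm T} (\<lambda>n x. poly (p n) (complex_of_real x)) F sequentially" and
    q: "uniform_limit {-norm T..norm T} (\<lambda>n x. poly (q n) (complex_of_real x)) G sequentially"
    using Weierstrass_complex_poly[OF F] Weierstrass_complex_poly[OF G] by metis
  have "uniform_limit {-norm T..norm T} (\<lambda>n x. poly (p n + q n) (complex_of_real x))
      (\<lambda>x. F x + G x) sequentially"
    using uniform_limit_add[OF p q] by simp
  from functional_calculus_tendsto_interval[OF T order_refl this]
  have "(\<lambda>n. op_poly (p n) T + op_poly (q n) T) \<longlonglongrightarrow> functional_calculus (\<lambda>x. F x + G x) T"
    by (simp add: op_poly_add)
  moreover have "(\<lambda>n. op_poly (p n) T + op_poly (q n) T) \<longlonglongrightarrow>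
      functional_calculus F T + functional_calculus G T"
    by (intro tendsto_add functional_calculus_tendsto_interval[OF T order_refl] p q)
  ultimately show ?thesis by (rule LIMSEQ_unique)
qed

lemma functional_calculus_cmult:
  assumes T: "symmetric_op T" and F: "continuous_on UNIV F"
  shows "functional_calculus (\<lambda>x. c * F x) T = scalar_op c o\<^sub>L functional_calculus F T"
proof -
  obtain p where
    p: "uniform_limit {-norm T..norm T} (\<lambda>n x. poly (p n) (complex_of_real x)) F sequentially"
    using Weierstrass_complex_poly[OF F] by metis
  have "uniform_limit {-norm T..norm T} (\<lambda>n x. poly (smult c (p n)) (complex_of_real x))
      (\<lambda>x. c * F x) sequentially"
    by (simp add: bounded_linear.uniform_limit[OF bounded_linear_mult_right p])
  from functional_calculus_tendsto_interval[OF T order_refl this]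
  have "(\<lambda>n. scalar_op c o\<^sub>L op_poly (p n) T) \<longlonglongrightarrow> functional_calculus (\<lambda>x. c * F x) T"
    by (simp add: op_poly_smult)
  moreover have "(\<lambda>n. scalar_op c o\<^sub>L op_poly (p n) T) \<longlonglongrightarrow> (scalar_op c o\<^sub>L functional_calculus F T)"
    by (intro bounded_bilinear.tendsto[OF bounded_bilinear_blinfun_compose] tendsto_const functional_calculus_tendsto_interval[OF T order_refl] p)
  ultimately show ?thesis by (rule LIMSEQ_unique)
qed

lemma blinfun_apply_tendsto:
  fixes S :: "nat \<Rightarrow> operator"
  assumes "S \<longlonglongrightarrow> S'"
  shows "(\<lambda>n. S n \<phi>) \<longlonglongrightarrow> S' \<phi>"
  by (intro blinfun.tendsto assms tendsto_const)

lemma functional_calculus_commute: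
  assumes T: "symmetric_op T" and A: "symmetric_op A" and AT: "\<And>\<phi>. A (T \<phi>) = T (A \<phi>)"
    and F: "continuous_on UNIV F"
  shows "A (functional_calculus F T \<phi>) = functional_calculus F T (A \<phi>)"
proof -
  obtain p where
    p: "uniform_limit {-norm T..norm T} (\<lambda>n x. poly (p n) (complex_of_real x)) F sequentially"
    using Weierstrass_complex_poly[OF F] by metis
  note lim = functional_calculus_tendsto_interval[OF T order_refl p]
  have "(\<lambda>n. A (op_poly (p n) T \<phi>)) \<longlonglongrightarrow> A (functional_calculus F T \<phi>)"
    by (intro blinfun.tendsto tendsto_const lim)
  moreover have "(\<lambda>n. A (op_poly (p n) T \<phi>)) \<longlonglongrightarrow> functional_calculus F T (A \<phi>)"
    unfolding op_poly_commute[OF T A AT] by (intro blinfun.tendsto tendsto_const lim)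
  ultimately show ?thesis by (rule LIMSEQ_unique)
qed

lemma norm_functional_calculus_le:
  assumes T: "symmetric_op T" and F: "continuous_on UNIV F" and bound: "\<And>x. cmod (F x) \<le> c"
  shows "norm (functional_calculus F T) \<le> c"
proof (rule field_le_epsilon)
  fix e :: real assume e: "0 < e"
  obtain p where
    p: "uniform_limit {-norm T..norm T} (\<lambda>n x. poly (p n) (complex_of_real x)) F sequentially"
    using Weierstrass_complex_poly[OF F] by metis
  have "\<forall>\<^sub>F n in sequentially. norm (op_poly (p n) T) \<le> c + e"
    using uniform_limitD[OF p e]
  proof (rule eventually_mono)
    fix n assume n: "\<forall>x\<in>{-norm T..norm T}. dist (poly (p n) (complex_of_real x)) (F x) < e"
    show "norm (op_poly (p n) T) \<le> c + e"
    proof (rule norm_op_poly_le[OF T])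
      fix x assume "x \<in> real_spectrum T"
      then have "cmod (poly (p n) (complex_of_real x) - F x) < e"
        using n real_spectrum_subset[OF T order_refl] by (auto simp: dist_norm)
      then show "cmod (poly (p n) (complex_of_real x)) \<le> c + e"
        using norm_triangle_ineq2[of "poly (p n) (complex_of_real x)" "F x"] bound[of x] by linarith
    qed
  qed
  then show "norm (functional_calculus F T) \<le> c + e"
    by (intro tendsto_upperbound[OF tendsto_norm[OF functional_calculus_tendsto_interval[OF T order_refl p]]])
      auto
qed

lemma resolvent_function_continuous:
  assumes "Im z \<noteq> 0"
  shows "continuous_on UNIV (\<lambda>x. 1 / (complex_of_real x - z))"
proof -
  have "complex_of_real x - z \<noteq> 0" for x using assms by (auto simp: complex_eq_iff)
  then show ?thesis by (auto intro!: continuous_intros)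
qed

text \<open>Approximants of \<open>1 / (x - z)\<close>, multiplied by \<open>x - z\<close>, converge to \<open>1\<close>.\<close>

lemma functional_calculus_resolvent:
  assumes T: "symmetric_op T" and z: "Im z \<noteq> 0"
  shows "T (functional_calculus (\<lambda>x. 1 / (of_real x - z)) T \<phi>)
      - cscale z (functional_calculus (\<lambda>x. 1 / (of_real x - z)) T \<phi>) = \<phi>"
    (is "T (?G \<phi>) - cscale z (?G \<phi>) = \<phi>")
proof -
  note cont = resolvent_function_continuous[OF z]
  let ?I = "{-norm T..norm T}"
  obtain p where
    p: "uniform_limit ?I (\<lambda>n x. poly (p n) (complex_of_real x)) (\<lambda>x. 1 / (of_real x - z)) sequentially"
    using Weierstrass_complex_poly[OF cont] by metis
  have "bounded ((\<lambda>x. complex_of_real x - z) ` ?I)" "bounded ((\<lambda>x. 1 / (complex_of_real x - z)) ` ?I)"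
    by (intro compact_imp_bounded compact_continuous_image continuous_intros
        continuous_on_subset[OF cont]; simp)+
  from uniform_lim_mult[OF uniform_limit_const p this]
  have "uniform_limit ?I (\<lambda>n x. (of_real x - z) * poly (p n) (complex_of_real x))
      (\<lambda>x. (of_real x - z) * (1 / (of_real x - z))) sequentially" .
  moreover have "(of_real x - z) * (1 / (of_real x - z)) = 1" for x
    using z by (auto simp: complex_eq_iff)
  ultimately have "uniform_limit ?I (\<lambda>n x. poly ([:- z, 1:] * p n) (complex_of_real x))
      (\<lambda>x. 1) sequentially"
    by (simp add: algebra_simps)
  from functional_calculus_tendsto_interval[OF T order_refl this]
  have 1: "(\<lambda>n. op_poly ([:- z, 1:] * p n) T) \<longlonglongrightarrow> functional_calculus (\<lambda>x. 1) T" .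
  have "uniform_limit ?I (\<lambda>n x. poly 1 (complex_of_real x)) (\<lambda>x. 1) sequentially"
    by (simp add: uniform_limit_const)
  from functional_calculus_tendsto_interval[OF T order_refl this]
  have "functional_calculus (\<lambda>x. 1) T = id_blinfun"
    by (simp add: LIMSEQ_const_iff one_pCons op_poly_const scalar_op_simps)
  with 1 have "(\<lambda>n. op_poly ([:- z, 1:] * p n) T \<phi>) \<longlonglongrightarrow> \<phi>"
    using blinfun_apply_tendsto by fastforce
  moreover have "op_poly ([:- z, 1:] * p n) T \<phi> = T (op_poly (p n) T \<phi>) - scalar_op z (op_poly (p n) T \<phi>)" for n
    unfolding op_poly_mult[OF T]
    by (simp add: op_poly_pCons[OF T] op_poly_0 scalar_op_simps scalar_op_apply
        blinfun.bilinear_simps cscale_minus_left)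
  moreover have "(\<lambda>n. T (op_poly (p n) T \<phi>) - scalar_op z (op_poly (p n) T \<phi>)) \<longlonglongrightarrow>
      T (?G \<phi>) - scalar_op z (?G \<phi>)"
    by (intro tendsto_diff blinfun.tendsto tendsto_const
        functional_calculus_tendsto_interval[OF T order_refl p])
  ultimately show ?thesis by (simp add: scalar_op_apply LIMSEQ_unique)
qed

section \<open>Perturbations that are small on the ranges of commuting projections\<close>

text \<open>The situation of a Riemann sum: on the range of \<open>Q i\<close>, in the application a spectral projection of
  \<open>J\<close>, the operator \<open>J\<close> is replaced by \<open>T i\<close>, and \<open>\<eta>\<close> bounds the sum of all errors.\<close>

definition piecewise_close ::
    "real \<Rightarrow> nat \<Rightarrow> operator \<Rightarrow> (nat \<Rightarrow> operator) \<Rightarrow> (nat \<Rightarrow> operator) \<Rightarrow> real \<Rightarrow> bool" where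
  "piecewise_close R n J T Q \<eta> \<longleftrightarrow>
     symmetric_op J \<and> norm J \<le> R \<and> 0 \<le> \<eta> \<and>
     (\<forall>i<n. symmetric_op (T i) \<and> norm (T i) \<le> R \<and> symmetric_op (Q i) \<and> (\<forall>\<phi>. Q i (J \<phi>) = J (Q i \<phi>))) \<and>
     (\<forall>\<phi>. (\<Sum>i<n. norm ((T i - J) (Q i \<phi>))) \<le> \<eta> * norm \<phi>)"

definition calculus_error ::
    "(real \<Rightarrow> complex) \<Rightarrow> nat \<Rightarrow> operator \<Rightarrow> (nat \<Rightarrow> operator) \<Rightarrow> (nat \<Rightarrow> operator) \<Rightarrow> ell2 \<Rightarrow> real" where
  "calculus_error F n J T Q \<phi> =
     (\<Sum>i<n. norm ((functional_calculus F (T i) - functional_calculus F J) (Q i \<phi>)))"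

text \<open>The constant \<open>K\<close> must not depend on the number of pieces.  A uniform approximation of \<open>F\<close> on the
  spectrum is of no help with this: the ranges of the operators \<open>F (T i) Q i\<close> need not be orthogonal
  to one another, and an error \<open>\<epsilon>\<close> on each piece can add up.  This is why \<open>F\<close> is taken from a special
  class of functions.\<close>

definition perturbation_stable :: "(real \<Rightarrow> complex) \<Rightarrow> bool" where
  "perturbation_stable F \<longleftrightarrow> continuous_on UNIV F \<and>
     (\<forall>R. \<exists>K\<ge>0. \<forall>n J T Q \<eta> \<phi>. piecewise_close R n J T Q \<eta> \<longrightarrow>
        calculus_error F n J T Q \<phi> \<le> K * \<eta> * norm \<phi>)"

lemma perturbation_stableD:
  assumes "perturbation_stable F"
  shows "\<exists>K\<ge>0. \<forall>n J T Q \<eta> \<phi>. piecewise_close R n J T Q \<eta> \<longrightarrow>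
    calculus_error F n J T Q \<phi> \<le> K * \<eta> * norm \<phi>"
  using assms unfolding perturbation_stable_def by blast

lemma sum_norm_compose_le:
  fixes A :: "nat \<Rightarrow> operator"
  assumes "\<And>i. i < n \<Longrightarrow> norm (A i) \<le> c" "(\<Sum>i<n. norm (f i)) \<le> d" "0 \<le> c"
  shows "(\<Sum>i<n. norm (A i (f i))) \<le> c * d"
proof -
  have "(\<Sum>i<n. norm (A i (f i))) \<le> (\<Sum>i<n. c * norm (f i))"
  proof (rule sum_mono)
    fix i assume "i \<in> {..<n}"
    then show "norm (A i (f i)) \<le> c * norm (f i)"
      using norm_blinfun[of "A i" "f i"] mult_right_mono[OF assms(1)[of i], of "norm (f i)"] by simp
  qed
  also have "\<dots> \<le> c * d" unfolding sum_distrib_left[symmetric] by (intro mult_left_mono assms)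
  finally show ?thesis .
qed

lemma op_power_commute:
  fixes A T :: operator
  assumes "\<And>\<phi>. A (T \<phi>) = T (A \<phi>)"
  shows "A ((((o\<^sub>L) T ^^ k) id_blinfun) \<phi>) = (((o\<^sub>L) T ^^ k) id_blinfun) (A \<phi>)"
  by (induction k arbitrary: \<phi>) (simp_all add: assms)

lemma norm_op_power_apply_le:
  fixes T :: operator
  assumes "norm T \<le> R"
  shows "norm ((((o\<^sub>L) T ^^ k) id_blinfun) \<phi>) \<le> R ^ k * norm \<phi>"
proof (induction k)
  case (Suc k)
  have R: "0 \<le> R" using assms norm_ge_zero order_trans by blast
  have "norm (T ((((o\<^sub>L) T ^^ k) id_blinfun) \<phi>)) \<le> R * (R ^ k * norm \<phi>)"
    by (rule order_trans[OF norm_blinfun]) (intro mult_mono assms Suc.IH R norm_ge_zero)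
  then show ?case by simp
qed simp

text \<open>The telescoping identity \<open>T\<^sup>k\<^sup>+\<^sup>1 - J\<^sup>k\<^sup>+\<^sup>1 = T (T\<^sup>k - J\<^sup>k) + (T - J) J\<^sup>k\<close>; the last
  factor \<open>J\<^sup>k\<close> moves past the projections.\<close>

lemma piecewise_close_power:
  assumes close: "piecewise_close R n J T Q \<eta>"
  shows "(\<Sum>i<n. norm ((((o\<^sub>L) (T i) ^^ k) id_blinfun - ((o\<^sub>L) J ^^ k) id_blinfun) (Q i \<phi>)))
           \<le> real k * R ^ (k - 1) * \<eta> * norm \<phi>"
proof (induction k)
  case (Suc k)
  let ?P = "\<lambda>A. ((o\<^sub>L) A ^^ k) id_blinfun"
  have R: "0 \<le> R" and \<eta>: "0 \<le> \<eta>" using close norm_ge_zero[of J] unfolding piecewise_close_def by linarith+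
  have step: "(((o\<^sub>L) (T i) ^^ Suc k) id_blinfun - ((o\<^sub>L) J ^^ Suc k) id_blinfun) (Q i \<phi>) =
      T i ((?P (T i) - ?P J) (Q i \<phi>)) + (T i - J) (Q i (?P J \<phi>))" if "i < n" for i
  proof -
    have "Q i (?P J \<phi>) = ?P J (Q i \<phi>)"
      by (rule op_power_commute) (use close that in \<open>simp add: piecewise_close_def\<close>)
    then show ?thesis by (simp add: blinfun.bilinear_simps)
  qed
  have "(\<Sum>i<n. norm ((((o\<^sub>L) (T i) ^^ Suc k) id_blinfun - ((o\<^sub>L) J ^^ Suc k) id_blinfun) (Q i \<phi>)))
      \<le> (\<Sum>i<n. norm (T i ((?P (T i) - ?P J) (Q i \<phi>))) + norm ((T i - J) (Q i (?P J \<phi>))))"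
    using step by (intro sum_mono) (simp only: lessThan_iff norm_triangle_ineq)
  also have "\<dots> = (\<Sum>i<n. norm (T i ((?P (T i) - ?P J) (Q i \<phi>)))) + (\<Sum>i<n. norm ((T i - J) (Q i (?P J \<phi>))))"
    by (rule sum.distrib)
  also have "\<dots> \<le> R * (real k * R ^ (k - 1) * \<eta> * norm \<phi>) + \<eta> * (R ^ k * norm \<phi>)"
  proof (rule add_mono)
    show "(\<Sum>i<n. norm (T i ((?P (T i) - ?P J) (Q i \<phi>)))) \<le> R * (real k * R ^ (k - 1) * \<eta> * norm \<phi>)"
      by (rule sum_norm_compose_le[OF _ Suc.IH R]) (use close in \<open>simp add: piecewise_close_def\<close>)
    have "(\<Sum>i<n. norm ((T i - J) (Q i (?P J \<phi>)))) \<le> \<eta> * norm (?P J \<phi>)"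
      using close by (simp add: piecewise_close_def)
    also have "\<dots> \<le> \<eta> * (R ^ k * norm \<phi>)"
      using close \<eta> by (intro mult_left_mono norm_op_power_apply_le) (simp_all add: piecewise_close_def)
    finally show "(\<Sum>i<n. norm ((T i - J) (Q i (?P J \<phi>)))) \<le> \<eta> * (R ^ k * norm \<phi>)" .
  qed
  also have "\<dots> = real (Suc k) * R ^ (Suc k - 1) * \<eta> * norm \<phi>"
    by (cases k) (simp_all add: algebra_simps)
  finally show ?case .
qed simp

lemma piecewise_close_poly:
  assumes close: "piecewise_close R n J T Q \<eta>" and deg: "degree p \<le> N"
    and K: "(\<Sum>k\<le>N. cmod (coeff p k) * (real k * R ^ (k - 1))) \<le> K"
  shows "(\<Sum>i<n. norm ((op_poly p (T i) - op_poly p J) (Q i \<phi>))) \<le> K * \<eta> * norm \<phi>"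
proof -
  let ?d = "\<lambda>k i. (((o\<^sub>L) (T i) ^^ k) id_blinfun - ((o\<^sub>L) J ^^ k) id_blinfun) (Q i \<phi>)"
  have \<eta>: "0 \<le> \<eta>" using close by (simp add: piecewise_close_def)
  have "norm ((op_poly p (T i) - op_poly p J) (Q i \<phi>)) \<le> (\<Sum>k\<le>N. cmod (coeff p k) * norm (?d k i))" for i
  proof -
    have "(op_poly p (T i) - op_poly p J) (Q i \<phi>) = (\<Sum>k\<le>N. cscale (coeff p k) (?d k i))"
      unfolding op_poly_eq_sum[OF deg]
      by (simp add: blinfun.bilinear_simps blinfun.sum_left scalar_op_apply cscale_diff_right sum_subtractf)
    then show ?thesis by (simp only:) (rule sum_norm_le, simp add: norm_cscale)
  qed
  then have "(\<Sum>i<n. norm ((op_poly p (T i) - op_poly p J) (Q i \<phi>)))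
      \<le> (\<Sum>i<n. \<Sum>k\<le>N. cmod (coeff p k) * norm (?d k i))" by (rule sum_mono)
  also have "\<dots> = (\<Sum>k\<le>N. cmod (coeff p k) * (\<Sum>i<n. norm (?d k i)))"
    unfolding sum_distrib_left by (rule sum.swap)
  also have "\<dots> \<le> (\<Sum>k\<le>N. cmod (coeff p k) * (real k * R ^ (k - 1) * \<eta> * norm \<phi>))"
    by (intro sum_mono mult_left_mono piecewise_close_power[OF close] norm_ge_zero)
  also have "\<dots> = (\<Sum>k\<le>N. cmod (coeff p k) * (real k * R ^ (k - 1))) * (\<eta> * norm \<phi>)"
    unfolding sum_distrib_right by (intro sum.cong) (simp_all add: mult.assoc)
  also have "\<dots> \<le> K * (\<eta> * norm \<phi>)" using \<eta> by (intro mult_right_mono K) simp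
  finally show ?thesis by (simp add: mult.assoc)
qed

lemma piecewise_close_limit:
  assumes close: "piecewise_close R n J T Q \<eta>"
    and lim: "uniform_limit {-R..R} (\<lambda>N x. poly (p N) (complex_of_real x)) F sequentially"
    and K: "\<And>N. (\<Sum>k\<le>degree (p N). cmod (coeff (p N) k) * (real k * R ^ (k - 1))) \<le> K"
  shows "calculus_error F n J T Q \<phi> \<le> K * \<eta> * norm \<phi>"
  unfolding calculus_error_def
proof (rule LIMSEQ_le_const2)
  show "(\<lambda>N. \<Sum>i<n. norm ((op_poly (p N) (T i) - op_poly (p N) J) (Q i \<phi>))) \<longlonglongrightarrow>
    (\<Sum>i<n. norm ((functional_calculus F (T i) - functional_calculus F J) (Q i \<phi>)))"
    using close
    by (intro tendsto_sum tendsto_norm blinfun.tendsto tendsto_diff tendsto_const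
        functional_calculus_tendsto_interval[OF _ _ lim]) (simp_all add: piecewise_close_def)
  show "\<exists>N. \<forall>m\<ge>N. (\<Sum>i<n. norm ((op_poly (p m) (T i) - op_poly (p m) J) (Q i \<phi>))) \<le> K * \<eta> * norm \<phi>"
    using piecewise_close_poly[OF close order_refl K] by blast
qed

text \<open>The partial sums of the series admit a common constant, the value at \<open>R\<close> of the derivative of
  the majorizing series, and this constant survives the limit because the number of pieces is fixed.\<close>

lemma perturbation_stable_power_series:
  assumes F: "continuous_on UNIV F" and c: "\<And>x. (\<lambda>k. c k * complex_of_real x ^ k) sums F x"
    and summable: "\<And>R. 0 \<le> R \<Longrightarrow> summable (\<lambda>k. cmod (c k) * R ^ k)"
    and deriv_summable: "\<And>R. 0 \<le> R \<Longrightarrow> summable (\<lambda>k. cmod (c k) * (real k * R ^ (k - 1)))"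
  shows "perturbation_stable F"
  unfolding perturbation_stable_def
proof (intro conjI allI F)
  fix R :: real
  define p where "p N = (\<Sum>k<N. monom (c k) k)" for N
  have coeff: "coeff (p N) k = (if k < N then c k else 0)" for N k
    by (simp add: p_def coeff_sum)
  show "\<exists>K\<ge>0. \<forall>n J T Q \<eta> \<phi>. piecewise_close R n J T Q \<eta> \<longrightarrow>
    calculus_error F n J T Q \<phi> \<le> K * \<eta> * norm \<phi>"
  proof (cases "0 \<le> R")
    case False
    then have "\<not> piecewise_close R n J T Q \<eta>" for n J T Q \<eta>
      using norm_ge_zero[of J] unfolding piecewise_close_def by linarith
    then show ?thesis by (auto intro: exI[of _ 0])
  next
    case R: True
    define K where "K = (\<Sum>k. cmod (c k) * (real k * R ^ (k - 1)))"
    have K: "(\<Sum>k\<le>degree (p N). cmod (coeff (p N) k) * (real k * R ^ (k - 1))) \<le> K" for N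
    proof -
      have "(\<Sum>k\<le>degree (p N). cmod (coeff (p N) k) * (real k * R ^ (k - 1)))
          \<le> (\<Sum>k\<le>degree (p N). cmod (c k) * (real k * R ^ (k - 1)))"
        using R by (intro sum_mono mult_right_mono) (auto simp: coeff)
      also have "\<dots> \<le> K"
        unfolding K_def using R by (intro sum_le_suminf deriv_summable) auto
      finally show ?thesis .
    qed
    have lim: "uniform_limit {-R..R} (\<lambda>N x. poly (p N) (complex_of_real x)) F sequentially"
    proof -
      have "uniform_limit {-R..R} (\<lambda>N x. \<Sum>k<N. c k * complex_of_real x ^ k)
          (\<lambda>x. \<Sum>k. c k * complex_of_real x ^ k) sequentially"
      proof (rule Weierstrass_m_test[OF _ summable[OF R]])
        fix k x assume "x \<in> {-R..R}"
        then have "\<bar>x\<bar> ^ k \<le> R ^ k" by (intro power_mono) auto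
        then show "cmod (c k * complex_of_real x ^ k) \<le> cmod (c k) * R ^ k"
          by (simp add: norm_mult norm_power mult_left_mono)
      qed
      moreover have "(\<lambda>x. \<Sum>k. c k * complex_of_real x ^ k) = F" using sums_unique[OF c] by auto
      ultimately show ?thesis by (simp add: p_def poly_sum poly_monom)
    qed
    have "0 \<le> K" unfolding K_def using R by (intro suminf_nonneg deriv_summable) auto
    then show ?thesis using piecewise_close_limit[OF _ lim K] by blast
  qed
qed

lemma perturbation_stable_monomial: "perturbation_stable (\<lambda>x. of_real x ^ m)"
proof (rule perturbation_stable_power_series)
  let ?c = "\<lambda>k. if k = m then 1 else 0 :: complex"
  show "continuous_on UNIV (\<lambda>x. complex_of_real x ^ m)" by (intro continuous_intros)
  show "(\<lambda>k. ?c k * complex_of_real x ^ k) sums (complex_of_real x ^ m)" for x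
    using sums_single[of m "\<lambda>k. complex_of_real x ^ k"] by (simp add: if_distrib[of "\<lambda>c. c * _"] cong: if_cong)
  show "summable (\<lambda>k. cmod (?c k) * R ^ k)"
    "summable (\<lambda>k. cmod (?c k) * (real k * R ^ (k - 1)))" for R :: real
    by (rule summable_finite[of "{m}"]; simp)+
qed

lemma perturbation_stable_exponential: "perturbation_stable (\<lambda>x. exp (\<i> * of_real t * of_real x))"
proof (rule perturbation_stable_power_series)
  let ?c = "\<lambda>k. (\<i> * of_real t) ^ k / fact k :: complex"
  have norm_c: "cmod (?c k) = \<bar>t\<bar> ^ k / fact k" for k
    by (simp add: norm_divide norm_power norm_mult)
  show "continuous_on UNIV (\<lambda>x. exp (\<i> * of_real t * complex_of_real x))" by (intro continuous_intros)
  show "(\<lambda>k. ?c k * complex_of_real x ^ k) sums exp (\<i> * of_real t * of_real x)" for x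
    using exp_converges[of "\<i> * of_real t * complex_of_real x"]
    by (simp add: power_mult_distrib scaleR_conv_of_real divide_inverse mult_ac)
  show "summable (\<lambda>k. cmod (?c k) * R ^ k)" for R
    unfolding norm_c using summable_exp[of "\<bar>t\<bar> * R"] by (simp add: power_mult_distrib divide_inverse mult_ac)
  show "summable (\<lambda>k. cmod (?c k) * (real k * R ^ (k - 1)))" for R
  proof -
    have "cmod (?c (Suc k)) * (real (Suc k) * R ^ (Suc k - 1)) = \<bar>t\<bar> * (inverse (fact k) * (\<bar>t\<bar> * R) ^ k)" for k
      unfolding norm_c by (simp add: field_simps power_mult_distrib del: of_nat_Suc)
    then have "summable (\<lambda>k. cmod (?c (Suc k)) * (real (Suc k) * R ^ (Suc k - 1)))"
      using summable_mult[OF summable_exp[of "\<bar>t\<bar> * R"], of "\<bar>t\<bar>"] by simp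
    then show ?thesis by (subst (asm) summable_Suc_iff)
  qed
qed

text \<open>The second resolvent identity \<open>(T - z)\<inverse> - (J - z)\<inverse> = (T - z)\<inverse> (J - T) (J - z)\<inverse>\<close>, whose
  last factor moves past the projections.\<close>

lemma perturbation_stable_resolvent:
  assumes z: "Im z \<noteq> 0"
  shows "perturbation_stable (\<lambda>x. 1 / (of_real x - z))" (is "perturbation_stable ?F")
  unfolding perturbation_stable_def
proof (intro conjI allI exI[of _ "1 / \<bar>Im z\<bar> * (1 / \<bar>Im z\<bar>)"] impI)
  show cont: "continuous_on UNIV ?F" using z by (rule resolvent_function_continuous)
  have bound: "cmod (?F x) \<le> 1 / \<bar>Im z\<bar>" for x
    using abs_Im_le_cmod[of "of_real x - z"] z by (simp add: norm_divide frac_le)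
  fix R n J T Q \<eta> \<phi> assume close: "piecewise_close R n J T Q \<eta>"
  let ?G = "functional_calculus ?F"
  have J: "symmetric_op J" and \<eta>: "0 \<le> \<eta>" using close by (simp_all add: piecewise_close_def)
  have T: "symmetric_op (T i)" "symmetric_op (Q i)" "\<And>\<phi>. Q i (J \<phi>) = J (Q i \<phi>)" if "i < n" for i
    using close that by (simp_all add: piecewise_close_def)
  have eq: "(?G (T i) - ?G J) (Q i \<phi>) = - ?G (T i) ((T i - J) (Q i (?G J \<phi>)))" if i: "i < n" for i
  proof -
    have "Q i (?G J \<phi>) = ?G J (Q i \<phi>)"
      by (rule functional_calculus_commute[OF J T(2)[OF i] T(3)[OF i] cont])
    moreover have "?G (T i) (T i \<psi>) = T i (?G (T i) \<psi>)" for \<psi>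
      by (rule functional_calculus_commute[OF T(1) T(1) refl cont, OF i i, symmetric])
    \<comment> \<open>The resolvent is complex-linear: both sides solve the same equation.\<close>
    moreover have "?G (T i) (cscale z \<psi>) = cscale z (?G (T i) \<psi>)" for \<psi>
    proof -
      have 1: "T i (?G (T i) (cscale z \<psi>)) - cscale z (?G (T i) (cscale z \<psi>)) = cscale z \<psi>"
        by (rule functional_calculus_resolvent[OF T(1)[OF i] z])
      have 2: "T i (cscale z (?G (T i) \<psi>)) - cscale z (cscale z (?G (T i) \<psi>)) = cscale z \<psi>"
        unfolding symmetric_op_cscale[OF T(1)[OF i]] cscale_diff_right[symmetric]
          functional_calculus_resolvent[OF T(1)[OF i] z] ..
      obtain S where S: "S o\<^sub>L (T i - scalar_op z) = id_blinfun"
        using symmetric_op_resolvent[OF T(1)[OF i] z] by blast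
      have "S (T i x - cscale z x) = x" for x
        using arg_cong[OF S, of "\<lambda>A. blinfun_apply A x"] by (simp add: blinfun.bilinear_simps scalar_op_apply)
      with 1 2 show ?thesis by metis
    qed
    moreover have "T i (?G (T i) (?G J (Q i \<phi>))) - cscale z (?G (T i) (?G J (Q i \<phi>))) = ?G J (Q i \<phi>)"
      by (rule functional_calculus_resolvent[OF T(1)[OF i] z])
    moreover have "J (?G J (Q i \<phi>)) - cscale z (?G J (Q i \<phi>)) = Q i \<phi>"
      by (rule functional_calculus_resolvent[OF J z])
    then have "?G (T i) (J (?G J (Q i \<phi>))) - ?G (T i) (cscale z (?G J (Q i \<phi>))) = ?G (T i) (Q i \<phi>)"
      by (simp flip: blinfun.diff_right)
    ultimately show ?thesis by (simp add: blinfun.bilinear_simps algebra_simps)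
  qed
  have "calculus_error ?F n J T Q \<phi> =
      (\<Sum>i<n. norm (?G (T i) ((T i - J) (Q i (?G J \<phi>)))))"
    unfolding calculus_error_def by (intro sum.cong) (simp_all add: eq)
  also have "\<dots> \<le> 1 / \<bar>Im z\<bar> * (\<eta> * norm (?G J \<phi>))"
  proof (rule sum_norm_compose_le)
    show "norm (?G (T i)) \<le> 1 / \<bar>Im z\<bar>" if "i < n" for i
      by (intro norm_functional_calculus_le cont bound T that)
    show "(\<Sum>i<n. norm ((T i - J) (Q i (?G J \<phi>)))) \<le> \<eta> * norm (?G J \<phi>)"
      using close by (simp add: piecewise_close_def)
  qed simp
  also have "\<dots> \<le> 1 / \<bar>Im z\<bar> * (\<eta> * (1 / \<bar>Im z\<bar> * norm \<phi>))"
    using order_trans[OF norm_blinfun[of "?G J" \<phi>]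
        mult_right_mono[OF norm_functional_calculus_le[OF J cont bound]]] \<eta>
    by (intro mult_left_mono) auto
  finally show "calculus_error ?F n J T Q \<phi> \<le> 1 / \<bar>Im z\<bar> * (1 / \<bar>Im z\<bar>) * \<eta> * norm \<phi>"
    by (simp add: mult_ac)
qed simp

lemma piecewise_close_symmetric:
  assumes "piecewise_close R n J T Q \<eta>"
  shows "symmetric_op J" "i < n \<Longrightarrow> symmetric_op (T i)"
  using assms by (simp_all add: piecewise_close_def)

lemma perturbation_stable_add:
  assumes F: "perturbation_stable F" and G: "perturbation_stable G"
  shows "perturbation_stable (\<lambda>x. F x + G x)"
  unfolding perturbation_stable_def
proof (intro conjI allI)
  have contF: "continuous_on UNIV F" and contG: "continuous_on UNIV G"
    using F G by (simp_all add: perturbation_stable_def)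
  then show "continuous_on UNIV (\<lambda>x. F x + G x)" by (intro continuous_intros)
  fix R :: real
  obtain K where K: "0 \<le> K" and
    bK: "\<And>n J T Q \<eta> \<phi>. piecewise_close R n J T Q \<eta> \<Longrightarrow> calculus_error F n J T Q \<phi> \<le> K * \<eta> * norm \<phi>"
    using perturbation_stableD[OF F] by blast
  obtain L where L: "0 \<le> L" and
    bL: "\<And>n J T Q \<eta> \<phi>. piecewise_close R n J T Q \<eta> \<Longrightarrow> calculus_error G n J T Q \<phi> \<le> L * \<eta> * norm \<phi>"
    using perturbation_stableD[OF G] by blast
  have "calculus_error (\<lambda>x. F x + G x) n J T Q \<phi> \<le> (K + L) * \<eta> * norm \<phi>"
    if close: "piecewise_close R n J T Q \<eta>" for n J T Q \<eta> \<phi>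
  proof -
    have "calculus_error (\<lambda>x. F x + G x) n J T Q \<phi> \<le> calculus_error F n J T Q \<phi> + calculus_error G n J T Q \<phi>"
      unfolding calculus_error_def sum.distrib[symmetric]
    proof (rule sum_mono)
      fix i assume "i \<in> {..<n}"
      then have "(functional_calculus (\<lambda>x. F x + G x) (T i) - functional_calculus (\<lambda>x. F x + G x) J) (Q i \<phi>) =
          (functional_calculus F (T i) - functional_calculus F J) (Q i \<phi>) +
          (functional_calculus G (T i) - functional_calculus G J) (Q i \<phi>)"
        using piecewise_close_symmetric[OF close]
        by (simp add: functional_calculus_add[OF _ contF contG] blinfun.bilinear_simps)
      then show "norm ((functional_calculus (\<lambda>x. F x + G x) (T i) - functional_calculus (\<lambda>x. F x + G x) J) (Q i \<phi>)) \<le>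
          norm ((functional_calculus F (T i) - functional_calculus F J) (Q i \<phi>)) +
          norm ((functional_calculus G (T i) - functional_calculus G J) (Q i \<phi>))"
        by (simp only: norm_triangle_ineq)
    qed
    also have "\<dots> \<le> (K + L) * \<eta> * norm \<phi>"
      using bK[OF close, of \<phi>] bL[OF close, of \<phi>] by (simp add: algebra_simps)
    finally show ?thesis .
  qed
  then show "\<exists>K\<ge>0. \<forall>n J T Q \<eta> \<phi>. piecewise_close R n J T Q \<eta> \<longrightarrow>
      calculus_error (\<lambda>x. F x + G x) n J T Q \<phi> \<le> K * \<eta> * norm \<phi>"
    using K L by (intro exI[of _ "K + L"]) simp
qed

lemma perturbation_stable_cmult:
  assumes F: "perturbation_stable F"
  shows "perturbation_stable (\<lambda>x. c * F x)"
  unfolding perturbation_stable_def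
proof (intro conjI allI)
  have cont: "continuous_on UNIV F" using F by (simp add: perturbation_stable_def)
  then show "continuous_on UNIV (\<lambda>x. c * F x)" by (intro continuous_intros)
  fix R :: real
  obtain K where K: "0 \<le> K" and
    bK: "\<And>n J T Q \<eta> \<phi>. piecewise_close R n J T Q \<eta> \<Longrightarrow> calculus_error F n J T Q \<phi> \<le> K * \<eta> * norm \<phi>"
    using perturbation_stableD[OF F] by blast
  have "calculus_error (\<lambda>x. c * F x) n J T Q \<phi> \<le> cmod c * K * \<eta> * norm \<phi>"
    if close: "piecewise_close R n J T Q \<eta>" for n J T Q \<eta> \<phi>
  proof -
    have "norm ((functional_calculus (\<lambda>x. c * F x) (T i) - functional_calculus (\<lambda>x. c * F x) J) (Q i \<phi>)) =
        cmod c * norm ((functional_calculus F (T i) - functional_calculus F J) (Q i \<phi>))" if "i < n" for i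
      using piecewise_close_symmetric[OF close] that
      by (simp add: functional_calculus_cmult[OF _ cont] blinfun.bilinear_simps scalar_op_apply
          flip: cscale_diff_right norm_cscale)
    then have "calculus_error (\<lambda>x. c * F x) n J T Q \<phi> = cmod c * calculus_error F n J T Q \<phi>"
      by (simp add: calculus_error_def sum_distrib_left)
    also have "\<dots> \<le> cmod c * (K * \<eta> * norm \<phi>)" by (intro mult_left_mono bK[OF close]) simp
    finally show ?thesis by (simp add: mult.assoc)
  qed
  then show "\<exists>K\<ge>0. \<forall>n J T Q \<eta> \<phi>. piecewise_close R n J T Q \<eta> \<longrightarrow>
      calculus_error (\<lambda>x. c * F x) n J T Q \<phi> \<le> K * \<eta> * norm \<phi>"
    using K by (intro exI[of _ "cmod c * K"]) simp
qed

lemma perturbation_stable_span: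
  assumes "F \<in> complex_span (monomials \<union> exponentials \<union> resolvent_functions)"
  shows "perturbation_stable F"
proof -
  obtain B c where B: "finite B" "B \<subseteq> monomials \<union> exponentials \<union> resolvent_functions"
    and F: "F = (\<lambda>x. \<Sum>g\<in>B. c g * g x)"
    using assms unfolding complex_span_def by blast
  have generator: "perturbation_stable g" if "g \<in> monomials \<union> exponentials \<union> resolvent_functions" for g
  proof -
    from that consider "g \<in> monomials" | "g \<in> exponentials" | "g \<in> resolvent_functions" by blast
    then show ?thesis
    proof cases
      case 1
      then show ?thesis by (auto simp: monomials_def perturbation_stable_monomial)
    next
      case 2
      then show ?thesis by (auto simp: exponentials_def perturbation_stable_exponential)
    next
      case 3
      then show ?thesis by (auto simp: resolvent_functions_def intro: perturbation_stable_resolvent)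
    qed
  qed
  have zero: "perturbation_stable (\<lambda>x. 0)"
    using perturbation_stable_cmult[OF perturbation_stable_monomial, of 0 0] by simp
  show ?thesis
    unfolding F using B
    by (induction B rule: finite_induct)
      (simp_all add: zero perturbation_stable_add perturbation_stable_cmult generator)
qed

section \<open>Projection-valued measures\<close>

context
  fixes P :: proj_measure
  assumes P: "projection_valued_measure P"
begin

lemma pvm_symmetric: "B \<in> sets borel \<Longrightarrow> symmetric_op (P B)"
  using P by (simp add: projection_valued_measure_def orthogonal_projection_def symmetric_op_def)

lemma pvm_idem:
  assumes "B \<in> sets borel"
  shows "P B (P B \<psi>) = P B \<psi>"
proof -
  have "P B o\<^sub>L P B = P B"
    using P assms by (simp add: projection_valued_measure_def orthogonal_projection_def)
  then show ?thesis by (metis blinfun_apply_blinfun_compose)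
qed

lemma pvm_UNIV: "P UNIV \<psi> = \<psi>"
  using P by (simp add: projection_valued_measure_def)

lemma pvm_sums:
  assumes "range B \<subseteq> sets borel" "disjoint_family B"
  shows "(\<lambda>n. P (B n) \<psi>) sums P (\<Union>n. B n) \<psi>"
  using P assms by (simp add: projection_valued_measure_def)

lemma pvm_empty: "P {} \<psi> = 0"
proof -
  have "(\<lambda>n::nat. P {} \<psi>) sums P {} \<psi>"
    using pvm_sums[of "\<lambda>_. {}" \<psi>] by (simp add: disjoint_family_on_def)
  then have "(\<lambda>n::nat. P {} \<psi>) \<longlonglongrightarrow> 0" by (intro summable_LIMSEQ_zero sums_summable)
  then show ?thesis by (simp add: LIMSEQ_const_iff)
qed

lemma pvm_Un:
  assumes "A \<in> sets borel" "B \<in> sets borel" "A \<inter> B = {}"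
  shows "P (A \<union> B) \<psi> = P A \<psi> + P B \<psi>"
proof -
  have "disjoint_family (binaryset A B)"
    using assms(3) by (auto simp: disjoint_family_on_def binaryset_def)
  then have "(\<lambda>n. P (binaryset A B n) \<psi>) sums P (A \<union> B) \<psi>"
    using pvm_sums[of "binaryset A B" \<psi>] assms(1,2) by (simp add: range_binaryset_eq UN_binaryset_eq)
  moreover have "(\<lambda>n. P (binaryset A B n) \<psi>) sums (P A \<psi> + P B \<psi>)"
    by (rule binaryset_sums) (rule pvm_empty)
  ultimately show ?thesis by (rule sums_unique2)
qed

lemma pvm_Compl: "B \<in> sets borel \<Longrightarrow> P B \<psi> + P (- B) \<psi> = \<psi>"
  using pvm_Un[of B "- B" \<psi>] by (simp add: pvm_UNIV borel_comp)

lemma pvm_inner: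
  assumes "B \<in> sets borel"
  shows "inner (P B \<phi>) \<psi> = inner \<phi> (P B \<psi>)"
  using symmetric_opD[OF pvm_symmetric[OF assms], of \<phi> \<psi>] by (simp flip: Re_cinner)

lemma pvm_norm_sq:
  assumes "B \<in> sets borel"
  shows "(norm (P B \<psi>))\<^sup>2 = inner (P B \<psi>) \<psi>"
  using pvm_inner[OF assms, of "P B \<psi>" \<psi>] pvm_idem[OF assms, of \<psi>] by (simp add: power2_norm_eq_inner)

lemma pvm_norm_le:
  assumes "B \<in> sets borel"
  shows "norm (P B \<psi>) \<le> norm \<psi>"
proof (cases "P B \<psi> = 0")
  case False
  have "norm (P B \<psi>) * norm (P B \<psi>) \<le> norm (P B \<psi>) * norm \<psi>"
    using norm_cauchy_schwarz[of "P B \<psi>" \<psi>] pvm_norm_sq[OF assms, of \<psi>] by (simp add: power2_eq_square)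
  then show ?thesis using False by simp
qed simp

lemma pvm_norm_sq_Un:
  assumes "A \<in> sets borel" "B \<in> sets borel" "A \<inter> B = {}"
  shows "(norm (P (A \<union> B) \<psi>))\<^sup>2 = (norm (P A \<psi>))\<^sup>2 + (norm (P B \<psi>))\<^sup>2"
proof -
  have "(norm (P (A \<union> B) \<psi>))\<^sup>2 = inner (P (A \<union> B) \<psi>) \<psi>"
    using assms by (intro pvm_norm_sq) auto
  also have "\<dots> = inner (P A \<psi>) \<psi> + inner (P B \<psi>) \<psi>"
    by (simp add: pvm_Un[OF assms] inner_add_left)
  finally show ?thesis by (simp add: pvm_norm_sq assms)
qed

lemma pvm_norm_mono:
  assumes "A \<in> sets borel" "B \<in> sets borel" "A \<subseteq> B"
  shows "(norm (P A \<psi>))\<^sup>2 \<le> (norm (P B \<psi>))\<^sup>2"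
  using pvm_norm_sq_Un[of A "B - A" \<psi>] assms by (simp add: Un_absorb1)

lemma pvm_norm_diff_sq:
  assumes A: "A \<in> sets borel" and B: "B \<in> sets borel" and "A \<subseteq> B"
  shows "(norm (P A \<psi> - P B \<psi>))\<^sup>2 = (norm (P B \<psi>))\<^sup>2 - (norm (P A \<psi>))\<^sup>2"
proof -
  have eq: "A \<union> (B - A) = B" using assms(3) by blast
  have "P B \<psi> = P A \<psi> + P (B - A) \<psi>"
    using pvm_Un[of A "B - A" \<psi>] A B eq by simp
  moreover have "(norm (P B \<psi>))\<^sup>2 = (norm (P A \<psi>))\<^sup>2 + (norm (P (B - A) \<psi>))\<^sup>2"
    using pvm_norm_sq_Un[of A "B - A" \<psi>] A B eq by simp
  ultimately show ?thesis by (simp add: norm_minus_commute)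
qed

text \<open>A vector in the range of \<open>P B\<close> already has full norm under \<open>P (A \<union> B)\<close>, so nothing is left
  for \<open>P A\<close>.\<close>

lemma pvm_disjoint:
  assumes "A \<in> sets borel" "B \<in> sets borel" "A \<inter> B = {}"
  shows "P A (P B \<psi>) = 0"
proof -
  have "(norm (P (A \<union> B) (P B \<psi>)))\<^sup>2 \<le> (norm (P B \<psi>))\<^sup>2"
    using pvm_norm_le assms by (intro power_mono) auto
  moreover have "(norm (P (A \<union> B) (P B \<psi>)))\<^sup>2 = (norm (P A (P B \<psi>)))\<^sup>2 + (norm (P B \<psi>))\<^sup>2"
    using pvm_norm_sq_Un[OF assms] by (simp add: pvm_idem assms)
  ultimately show ?thesis by simp
qed

lemma pvm_Int:
  assumes A: "A \<in> sets borel" and B: "B \<in> sets borel"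
  shows "P A (P B \<psi>) = P (A \<inter> B) \<psi>"
proof -
  have parts: "A \<inter> B \<union> (B - A) = B" "A \<inter> B \<union> (A - B) = A" by blast+
  have "P B \<psi> = P (A \<inter> B) \<psi> + P (B - A) \<psi>"
    using pvm_Un[of "A \<inter> B" "B - A" \<psi>] A B parts by auto
  then have "P A (P B \<psi>) = P A (P (A \<inter> B) \<psi>)"
    using pvm_disjoint[of A "B - A" \<psi>] A B by (auto simp: blinfun.bilinear_simps)
  also have "\<dots> = P (A \<inter> B) (P (A \<inter> B) \<psi>) + P (A - B) (P (A \<inter> B) \<psi>)"
    using pvm_Un[of "A \<inter> B" "A - B" "P (A \<inter> B) \<psi>"] A B parts by auto
  also have "\<dots> = P (A \<inter> B) \<psi>"
    using pvm_disjoint[of "A - B" "A \<inter> B" \<psi>] pvm_idem[of "A \<inter> B"] A B by auto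
  finally show ?thesis .
qed

lemma sets_form_measure [simp]: "sets (form_measure P \<psi>) = sets borel"
  and space_form_measure [simp]: "space (form_measure P \<psi>) = UNIV"
  unfolding form_measure_def
  using sets.sigma_sets_eq[of "borel :: real measure"] by simp_all

lemma emeasure_form_measure:
  assumes "B \<in> sets borel"
  shows "emeasure (form_measure P \<psi>) B = ennreal ((norm (P B \<psi>))\<^sup>2)"
proof -
  let ?\<mu> = "\<lambda>B. ennreal (Re (cinner (P B \<psi>) \<psi>))"
  have "emeasure (form_measure P \<psi>) B = ?\<mu> B"
    unfolding form_measure_def
  proof (rule emeasure_measure_of_sigma[OF _ _ _ assms])
    show "sigma_algebra UNIV (sets (borel :: real measure))"
      using sets.sigma_algebra_axioms[of "borel :: real measure"] by simp
    show "positive (sets borel) ?\<mu>" by (simp add: positive_def pvm_empty cinner_zero_left)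
    show "countably_additive (sets borel) ?\<mu>"
    proof (rule countably_additiveI)
      fix A :: "nat \<Rightarrow> real set" assume A: "range A \<subseteq> sets borel" "disjoint_family A"
      have "(\<lambda>n. inner (P (A n) \<psi>) \<psi>) sums inner (P (\<Union>n. A n) \<psi>) \<psi>"
        by (rule bounded_linear.sums[OF bounded_linear_inner_left pvm_sums[OF A]])
      moreover have "0 \<le> inner (P (A n) \<psi>) \<psi>" for n
        using A by (simp flip: pvm_norm_sq add: range_subsetD)
      ultimately show "(\<Sum>n. ?\<mu> (A n)) = ?\<mu> (\<Union> (range A))"
        unfolding Re_cinner by (intro suminf_ennreal_eq) auto
    qed
  qed
  then show ?thesis by (simp add: Re_cinner pvm_norm_sq[OF assms])
qed

lemma measure_form_measure:
  "B \<in> sets borel \<Longrightarrow> measure (form_measure P \<psi>) B = (norm (P B \<psi>))\<^sup>2"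
  by (simp add: measure_def emeasure_form_measure)

lemma finite_measure_form_measure: "finite_measure (form_measure P \<psi>)"
  by (rule finite_measureI) (simp add: emeasure_form_measure)

lemma sets_total_measure [simp]: "sets (total_measure P) = sets borel"
  and space_total_measure [simp]: "space (total_measure P) = UNIV"
  unfolding total_measure_def
  using sets.sigma_sets_eq[of "borel :: real measure"] by simp_all

lemma emeasure_total_measure:
  assumes "B \<in> sets borel"
  shows "emeasure (total_measure P) B = ennreal ((norm (P B (delta 0)))\<^sup>2 + (norm (P B (delta 1)))\<^sup>2)"
proof -
  let ?\<mu> = "\<lambda>B. emeasure (form_measure P (delta 0)) B + emeasure (form_measure P (delta 1)) B"
  have "emeasure (total_measure P) B = ?\<mu> B"
    unfolding total_measure_def
  proof (rule emeasure_measure_of_sigma[OF _ _ _ assms])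
    show "sigma_algebra UNIV (sets (borel :: real measure))"
      using sets.sigma_algebra_axioms[of "borel :: real measure"] by simp
    show "positive (sets borel) ?\<mu>" by (simp add: positive_def)
    show "countably_additive (sets borel) ?\<mu>"
      by (rule countably_additiveI) (simp add: suminf_add[symmetric] suminf_emeasure)
  qed
  then show ?thesis by (simp add: emeasure_form_measure[OF assms] ennreal_plus)
qed

lemma measure_total_measure:
  "B \<in> sets borel \<Longrightarrow>
    measure (total_measure P) B = (norm (P B (delta 0)))\<^sup>2 + (norm (P B (delta 1)))\<^sup>2"
  by (simp add: measure_def emeasure_total_measure del: ennreal_plus)

lemma finite_measure_total_measure: "finite_measure (total_measure P)"
  by (rule finite_measureI) (simp add: emeasure_total_measure)

lemma measure_total_measure_le: "B \<in> sets borel \<Longrightarrow> measure (total_measure P) B \<le> 2"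
  using pvm_norm_le[of B "delta 0"] pvm_norm_le[of B "delta 1"]
    power_mono[of "norm (P B (delta 0))" 1 2] power_mono[of "norm (P B (delta 1))" 1 2]
  by (simp add: measure_total_measure norm_delta)

text \<open>Strong continuity from below: the squared distance to the limit is the mass of the remaining set
  under the finite measure of \<open>\<psi>\<close>.\<close>

lemma pvm_LIMSEQ_incseq:
  assumes A: "range A \<subseteq> sets borel" and inc: "incseq A"
  shows "(\<lambda>n. P (A n) \<psi>) \<longlonglongrightarrow> P (\<Union>n. A n) \<psi>"
proof -
  let ?U = "\<Union>n. A n"
  have U: "?U \<in> sets borel" using A by auto
  have An: "A n \<in> sets borel" for n using A by auto
  have "(\<lambda>n. measure (form_measure P \<psi>) (A n)) \<longlonglongrightarrow> measure (form_measure P \<psi>) ?U"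
    by (rule finite_measure.finite_Lim_measure_incseq[OF finite_measure_form_measure _ inc])
      (use A in simp)
  then have lim: "(\<lambda>n. (norm (P ?U \<psi>))\<^sup>2 - (norm (P (A n) \<psi>))\<^sup>2) \<longlonglongrightarrow> (norm (P ?U \<psi>))\<^sup>2 - (norm (P ?U \<psi>))\<^sup>2"
    by (intro tendsto_diff tendsto_const) (simp add: measure_form_measure U An)
  have eq: "(norm (P (A n) \<psi> - P ?U \<psi>))\<^sup>2 = (norm (P ?U \<psi>))\<^sup>2 - (norm (P (A n) \<psi>))\<^sup>2" for n
    by (rule pvm_norm_diff_sq[OF An U]) blast
  have "(\<lambda>n. sqrt ((norm (P (A n) \<psi> - P ?U \<psi>))\<^sup>2)) \<longlonglongrightarrow> sqrt 0"
    using lim unfolding eq by (intro tendsto_real_sqrt) simp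
  then have "(\<lambda>n. norm (P (A n) \<psi> - P ?U \<psi>)) \<longlonglongrightarrow> 0" by simp
  then show ?thesis by (rule LIM_zero_cancel[OF tendsto_norm_zero_cancel])
qed

lemma form_measure_restrict:
  assumes B: "B \<in> sets borel"
  shows "form_measure P (P B \<psi>) = density (form_measure P \<psi>) (\<lambda>x. ennreal (indicator B x))"
proof (rule measure_eqI)
  fix A assume "A \<in> sets (form_measure P (P B \<psi>))"
  then have A: "A \<in> sets borel" by simp
  have "emeasure (density (form_measure P \<psi>) (indicator B)) A = emeasure (form_measure P \<psi>) (B \<inter> A)"
    by (rule emeasure_restricted) (use A B in simp_all)
  then show "emeasure (form_measure P (P B \<psi>)) A =
      emeasure (density (form_measure P \<psi>) (\<lambda>x. ennreal (indicator B x))) A"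
    using A B by (simp add: emeasure_form_measure pvm_Int Int_commute ennreal_indicator)
qed simp

end

section \<open>A spectral measure commutes with its operator\<close>

text \<open>Polarization: the real quadratic form at \<open>\<phi> + \<psi>\<close> gives the imaginary part of the identity, and
  replacing \<open>\<psi>\<close> by \<open>\<i> \<psi>\<close> its real part.\<close>

lemma symmetric_op_if_real_form:
  fixes T :: operator
  assumes lin: "\<And>c \<phi>. T (cscale c \<phi>) = cscale c (T \<phi>)" and re: "\<And>\<phi>. Im (cinner (T \<phi>) \<phi>) = 0"
  shows "symmetric_op T"
proof -
  have im: "Im (cinner (T \<phi>) \<psi>) = Im (cinner \<phi> (T \<psi>))" for \<phi> \<psi>
    using re[of "\<phi> + \<psi>"] re[of \<phi>] re[of \<psi>] arg_cong[OF cinner_commute[of "T \<psi>" \<phi>], of Im]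
    by (simp add: blinfun.bilinear_simps cinner_add_left cinner_add_right)
  have "Re (cinner (T \<phi>) \<psi>) = Re (cinner \<phi> (T \<psi>))" for \<phi> \<psi>
    using im[of \<phi> "cscale \<i> \<psi>"] by (simp add: lin cinner_cscale_right)
  with im show ?thesis by (auto simp: symmetric_op_def complex_eq_iff)
qed

text \<open>Cutting the measure of \<open>\<psi>\<close> along \<open>B\<close> and its complement shows that the quadratic form of
  \<open>T\<close> has no cross terms between the ranges of \<open>P B\<close> and \<open>P (- B)\<close>, that is, \<open>T\<close> leaves these
  ranges invariant.\<close>

lemma spectral_measure_commute:
  fixes T :: operator
  assumes lin: "\<And>c \<phi>. T (cscale c \<phi>) = cscale c (T \<phi>)" and spec: "is_spectral_measure T P"
  shows "symmetric_op T" "B \<in> sets borel \<Longrightarrow> P B (T \<phi>) = T (P B \<phi>)"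
proof -
  have P: "projection_valued_measure P" and
    int: "integrable (form_measure P \<psi>) (\<lambda>x. x)" and
    form: "cinner (T \<psi>) \<psi> = of_real (\<integral>x. x \<partial>form_measure P \<psi>)" for \<psi>
    using spec by (auto simp: is_spectral_measure_def)
  show T: "symmetric_op T" by (rule symmetric_op_if_real_form[OF lin]) (simp add: form)
  have form': "inner (T \<psi>) \<psi> = (\<integral>x. x \<partial>form_measure P \<psi>)" for \<psi>
    by (simp add: form flip: Re_cinner)
  have cut: "inner (T (P B \<psi>)) (P B \<psi>) = (\<integral>x. indicator B x *\<^sub>R x \<partial>form_measure P \<psi>)"
    if "B \<in> sets borel" for B \<psi>
    unfolding form' form_measure_restrict[OF P that]
    by (intro integral_density)
      (simp_all add: measurable_cong_sets[OF sets_form_measure[OF P] refl] that borel_measurable_indicator)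
  have split: "inner (T \<psi>) \<psi> = inner (T (P B \<psi>)) (P B \<psi>) + inner (T (P (- B) \<psi>)) (P (- B) \<psi>)"
    if B: "B \<in> sets borel" for B \<psi>
  proof -
    have ind: "integrable (form_measure P \<psi>) (\<lambda>x. indicator B x *\<^sub>R x)" if "B \<in> sets borel" for B
      using that by (intro integrable_mult_indicator int) (simp add: P)
    have "(\<integral>x. x \<partial>form_measure P \<psi>) =
        (\<integral>x. indicator B x *\<^sub>R x + indicator (- B) x *\<^sub>R x \<partial>form_measure P \<psi>)"
      by (intro Bochner_Integration.integral_cong refl) (simp add: indicator_def)
    also have "\<dots> = (\<integral>x. indicator B x *\<^sub>R x \<partial>form_measure P \<psi>)
        + (\<integral>x. indicator (- B) x *\<^sub>R x \<partial>form_measure P \<psi>)"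
      by (intro Bochner_Integration.integral_add ind B borel_comp)
    finally show ?thesis unfolding cut[OF B] cut[OF borel_comp[OF B]] form'[of \<psi>] .
  qed
  have cross: "inner (T (P B \<phi>)) (P (- B) \<psi>) = 0" if B: "B \<in> sets borel" for B \<phi> \<psi>
  proof -
    have "P B (P B \<phi> + P (- B) \<psi>) = P B \<phi>" "P (- B) (P B \<phi> + P (- B) \<psi>) = P (- B) \<psi>"
      using B by (simp_all add: blinfun.bilinear_simps pvm_idem[OF P] pvm_disjoint[OF P] borel_comp)
    then have "inner (T (P B \<phi>)) (P (- B) \<psi>) + inner (T (P (- B) \<psi>)) (P B \<phi>) = 0"
      using split[OF B, of "P B \<phi> + P (- B) \<psi>"]
      by (simp add: blinfun.bilinear_simps inner_add_left inner_add_right)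
    moreover have "inner (T (P (- B) \<psi>)) (P B \<phi>) = inner (T (P B \<phi>)) (P (- B) \<psi>)"
      using arg_cong[OF symmetric_opD[OF T, of "P (- B) \<psi>" "P B \<phi>"], of Re]
      by (simp add: Re_cinner inner_commute)
    ultimately show ?thesis by simp
  qed
  have reduce: "P (- B) (T (P B \<phi>)) = 0" if B: "B \<in> sets borel" for B \<phi>
  proof -
    have "inner (P (- B) (T (P B \<phi>))) \<psi> = 0" for \<psi>
      using cross[OF B] B by (simp add: pvm_inner[OF P] borel_comp)
    then show ?thesis by (metis inner_eq_zero_iff)
  qed
  assume B: "B \<in> sets borel"
  have "P B (T \<phi>) = P B (T (P B \<phi>)) + P B (T (P (- B) \<phi>))"
    by (simp add: pvm_Compl[OF P B] flip: blinfun.add_right)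
  also have "P B (T (P (- B) \<phi>)) = 0" using reduce[of "- B" \<phi>] B by (simp add: borel_comp)
  also have "P B (T (P B \<phi>)) + 0 = T (P B \<phi>)"
    using pvm_Compl[OF P B, of "T (P B \<phi>)"] reduce[OF B] by simp
  finally show "P B (T \<phi>) = T (P B \<phi>)" .
qed

section \<open>Comparing two measures on the line by their symmetric derivative\<close>

text \<open>A subcover of least cardinality will do: of three intervals with a common point, the one that
  reaches farthest to the left and the one that reaches farthest to the right cover the third.\<close>

lemma interval_subcover_overlap_two:
  fixes l r :: "'i \<Rightarrow> real"
  assumes "finite I" "K \<subseteq> (\<Union>i\<in>I. {l i<..<r i})"
  shows "\<exists>I'\<subseteq>I. K \<subseteq> (\<Union>i\<in>I'. {l i<..<r i}) \<and> (\<forall>x. card {i\<in>I'. x \<in> {l i<..<r i}} \<le> 2)"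
proof -
  define \<C> where "\<C> = {I'. I' \<subseteq> I \<and> K \<subseteq> (\<Union>i\<in>I'. {l i<..<r i})}"
  have "I \<in> \<C>" using assms by (simp add: \<C>_def)
  then obtain I' where I': "I' \<in> \<C>" and minimal: "\<And>I''. I'' \<in> \<C> \<Longrightarrow> card I' \<le> card I''"
    using ex_has_least_nat[of "\<lambda>I'. I' \<in> \<C>" I card] by blast
  have fin: "finite I'" using I' assms(1) finite_subset by (auto simp: \<C>_def)
  have "card {i\<in>I'. x \<in> {l i<..<r i}} \<le> 2" for x
  proof (rule ccontr)
    define S where "S = {i\<in>I'. x \<in> {l i<..<r i}}"
    assume "\<not> card {i\<in>I'. x \<in> {l i<..<r i}} \<le> 2"
    then have card: "2 < card S" by (simp add: S_def)
    have S: "finite S" "S \<noteq> {}" using fin card by (simp add: S_def) (use card in auto)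
    obtain i where i: "i \<in> S" "\<And>k. k \<in> S \<Longrightarrow> l i \<le> l k"
      using arg_min_if_finite[OF S, of l] by (metis linorder_not_le)
    obtain j where j: "j \<in> S" "\<And>k. k \<in> S \<Longrightarrow> r k \<le> r j"
      using arg_min_if_finite[OF S, of "\<lambda>k. - r k"] by (metis linorder_not_le neg_less_iff_less)
    have "\<not> S \<subseteq> {i, j}"
    proof
      assume "S \<subseteq> {i, j}"
      then have "card S \<le> card {i, j}" by (intro card_mono) auto
      also have "\<dots> \<le> 2" by (simp add: card_insert_if)
      finally show False using card by simp
    qed
    then obtain k where k: "k \<in> S" "k \<noteq> i" "k \<noteq> j" by blast
    have "{l k<..<r k} \<subseteq> {l i<..<r i} \<union> {l j<..<r j}"
    proof
      fix y assume y: "y \<in> {l k<..<r k}"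
      show "y \<in> {l i<..<r i} \<union> {l j<..<r j}"
        using y i(1) j(1) i(2)[OF k(1)] j(2)[OF k(1)] by (cases "y \<le> x") (auto simp: S_def)
    qed
    moreover have "i \<in> I' - {k}" "j \<in> I' - {k}" using i(1) j(1) k by (auto simp: S_def)
    ultimately have "(\<Union>i\<in>I'. {l i<..<r i}) \<subseteq> (\<Union>i\<in>I' - {k}. {l i<..<r i})" by blast
    then have "I' - {k} \<in> \<C>" using I' unfolding \<C>_def by blast
    from minimal[OF this] show False
      using fin k(1) card_Diff1_less[of I' k] by (simp add: S_def)
  qed
  with I' show ?thesis unfolding \<C>_def by blast
qed

text \<open>By regularity \<open>A\<close> may be replaced by a compact subset for \<open>\<nu>\<close> and by an open superset for \<open>\<mu>\<close>.
  Centred intervals that satisfy the bound cover the former inside the latter, with overlap at most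
  two, which is where the factor two comes from.\<close>

lemma measure_le_if_interval_ratio_le:
  fixes \<mu> \<nu> :: "real measure"
  assumes sets: "sets \<mu> = sets borel" "sets \<nu> = sets borel"
    and finite: "finite_measure \<mu>" "finite_measure \<nu>"
    and A: "A \<in> sets borel" and c: "0 \<le> c"
    and ratio: "\<And>x d. x \<in> A \<Longrightarrow> 0 < d \<Longrightarrow>
      \<exists>\<epsilon>>0. \<epsilon> < d \<and> measure \<nu> {x - \<epsilon><..<x + \<epsilon>} \<le> c * measure \<mu> {x - \<epsilon><..<x + \<epsilon>}"
  shows "measure \<nu> A \<le> 2 * c * measure \<mu> A"
proof -
  interpret \<mu>: finite_measure \<mu> by fact
  interpret \<nu>: finite_measure \<nu> by fact
  have bound: "measure \<nu> A \<le> 2 * c * (measure \<mu> A + e)" if e: "0 < e" for e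
  proof (rule ccontr)
    assume "\<not> ?thesis"
    then have "ennreal (2 * c * (measure \<mu> A + e)) < emeasure \<nu> A"
      using c e by (simp add: \<nu>.emeasure_eq_measure ennreal_less_iff)
    then obtain K where K: "K \<subseteq> A" "compact K" "ennreal (2 * c * (measure \<mu> A + e)) < emeasure \<nu> K"
      using inner_regular[OF sets(2) _ A] \<nu>.emeasure_finite by (auto simp: less_SUP_iff)
    have K_gt: "2 * c * (measure \<mu> A + e) < measure \<nu> K"
      using K(3) c e by (simp add: \<nu>.emeasure_eq_measure ennreal_less_iff)
    have "emeasure \<mu> A < ennreal (measure \<mu> A + e)"
      using e by (simp add: \<mu>.emeasure_eq_measure ennreal_less_iff)
    then obtain U where U: "A \<subseteq> U" "open U" "emeasure \<mu> U < ennreal (measure \<mu> A + e)"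
      using outer_regular[OF sets(1) _ A] \<mu>.emeasure_finite by (auto simp: INF_less_iff)
    have U_le: "measure \<mu> U \<le> measure \<mu> A + e"
      using U(3) e by (simp add: \<mu>.emeasure_eq_measure ennreal_less_iff del: ennreal_plus)
    have "\<exists>\<epsilon>>0. {x - \<epsilon><..<x + \<epsilon>} \<subseteq> U \<and> measure \<nu> {x - \<epsilon><..<x + \<epsilon>} \<le> c * measure \<mu> {x - \<epsilon><..<x + \<epsilon>}"
      if x: "x \<in> K" for x
    proof -
      obtain d where d: "0 < d" "ball x d \<subseteq> U" using U K(1) x openE by blast
      obtain \<epsilon> where \<epsilon>: "0 < \<epsilon>" "\<epsilon> < d" "measure \<nu> {x - \<epsilon><..<x + \<epsilon>} \<le> c * measure \<mu> {x - \<epsilon><..<x + \<epsilon>}"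
        using ratio[OF _ d(1)] K(1) x by blast
      have "{x - \<epsilon><..<x + \<epsilon>} \<subseteq> ball x d" using \<epsilon>(2) by (auto simp: dist_real_def)
      then show ?thesis using \<epsilon> d by blast
    qed
    then obtain \<epsilon> where \<epsilon>: "\<And>x. x \<in> K \<Longrightarrow> 0 < \<epsilon> x"
      "\<And>x. x \<in> K \<Longrightarrow> {x - \<epsilon> x<..<x + \<epsilon> x} \<subseteq> U"
      "\<And>x. x \<in> K \<Longrightarrow> measure \<nu> {x - \<epsilon> x<..<x + \<epsilon> x} \<le> c * measure \<mu> {x - \<epsilon> x<..<x + \<epsilon> x}"
      by metis
    let ?I = "\<lambda>x. {x - \<epsilon> x<..<x + \<epsilon> x}"
    have "K \<subseteq> (\<Union>x\<in>K. ?I x)" using \<epsilon>(1) by force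
    then obtain X where X: "X \<subseteq> K" "finite X" "K \<subseteq> (\<Union>x\<in>X. ?I x)"
      using compactE_image[OF K(2), of K ?I] by auto
    obtain Y where Y: "Y \<subseteq> X" "K \<subseteq> (\<Union>x\<in>Y. ?I x)" "\<And>y. card {x\<in>Y. y \<in> ?I x} \<le> 2"
      using interval_subcover_overlap_two[OF X(2,3)] by blast
    have finY: "finite Y" using X(2) Y(1) finite_subset by blast
    have sum_le: "(\<Sum>x\<in>Y. measure \<mu> (?I x)) \<le> 2 * measure \<mu> U"
    proof -
      have int: "integrable \<mu> (indicator B :: real \<Rightarrow> real)" if "B \<in> sets borel" for B
        using that by (simp add: sets \<mu>.emeasure_eq_measure)
      have "(\<Sum>x\<in>Y. measure \<mu> (?I x)) = (\<Sum>x\<in>Y. \<integral>y. indicator (?I x) y \<partial>\<mu>)"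
        using sets_eq_imp_space_eq[OF sets(1)] by simp
      also have "\<dots> = (\<integral>y. (\<Sum>x\<in>Y. indicator (?I x) y) \<partial>\<mu>)"
        by (rule Bochner_Integration.integral_sum[symmetric]) (auto intro: int)
      also have "\<dots> \<le> (\<integral>y. 2 * indicator U y \<partial>\<mu>)"
      proof (rule integral_mono)
        show "integrable \<mu> (\<lambda>y. \<Sum>x\<in>Y. indicator (?I x) y :: real)"
          by (rule Bochner_Integration.integrable_sum) (auto intro: int)
        show "integrable \<mu> (\<lambda>y. 2 * indicator U y :: real)"
          using U(2) by (intro integrable_mult_right int) auto
        fix y
        have "(\<Sum>x\<in>Y. indicator (?I x) y :: real) = real (card {x\<in>Y. y \<in> ?I x})"
          using finY by (simp add: indicator_def sum.If_cases Int_def)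
        also have "\<dots> \<le> 2 * indicator U y"
        proof (cases "y \<in> U")
          case False
          then have "{x\<in>Y. y \<in> ?I x} = {}" using \<epsilon>(2) X(1) Y(1) by blast
          then show ?thesis by (metis card.empty indicator_pos_le mult_nonneg_nonneg of_nat_0 zero_le_numeral)
        qed (use Y(3)[of y] in simp)
        finally show "(\<Sum>x\<in>Y. indicator (?I x) y :: real) \<le> 2 * indicator U y" .
      qed
      also have "\<dots> = 2 * measure \<mu> U"
        using sets_eq_imp_space_eq[OF sets(1)] by simp
      finally show ?thesis .
    qed
    have "measure \<nu> K \<le> measure \<nu> (\<Union>x\<in>Y. ?I x)"
      using Y(2) finY K(2) by (intro \<nu>.finite_measure_mono) (auto simp: sets compact_imp_closed)
    also have "\<dots> \<le> (\<Sum>x\<in>Y. measure \<nu> (?I x))"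
      by (rule \<nu>.finite_measure_subadditive_finite[OF finY]) (auto simp: sets)
    also have "\<dots> \<le> (\<Sum>x\<in>Y. c * measure \<mu> (?I x))"
      using \<epsilon>(3) X(1) Y(1) by (intro sum_mono) blast
    also have "\<dots> = c * (\<Sum>x\<in>Y. measure \<mu> (?I x))" by (simp add: sum_distrib_left)
    also have "\<dots> \<le> c * (2 * (measure \<mu> A + e))"
      using sum_le U_le c by (intro mult_left_mono) auto
    finally show False using K_gt by (simp add: algebra_simps)
  qed
  show ?thesis
  proof (rule field_le_epsilon)
    fix e :: real assume e: "0 < e"
    have "measure \<nu> A \<le> 2 * c * (measure \<mu> A + e / (2 * c + 1))"
      using e c by (intro bound) simp
    also have "\<dots> \<le> 2 * c * measure \<mu> A + e"
      using e c by (simp add: field_simps)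
    finally show "measure \<nu> A \<le> 2 * c * measure \<mu> A + e" .
  qed
qed

text \<open>The function is a difference of two monotone ones.\<close>

lemma borel_measurable_measure_interval:
  fixes \<mu> :: "real measure"
  assumes sets: "sets \<mu> = sets borel" and "finite_measure \<mu>"
  shows "(\<lambda>x. measure \<mu> {x - \<epsilon><..<x + \<epsilon>}) \<in> borel_measurable borel"
proof (cases "0 < \<epsilon>")
  case True
  interpret finite_measure \<mu> by fact
  have "measure \<mu> {x - \<epsilon><..<x + \<epsilon>} = measure \<mu> {..<x + \<epsilon>} - measure \<mu> {..x - \<epsilon>}" for x
  proof -
    have eq: "{x - \<epsilon><..<x + \<epsilon>} = {..<x + \<epsilon>} - {..x - \<epsilon>}" by auto
    show ?thesis unfolding eq using True by (intro finite_measure_Diff) (auto simp: sets)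
  qed
  moreover have "mono (\<lambda>x. measure \<mu> {..<x + \<epsilon>})" "mono (\<lambda>x. measure \<mu> {..x - \<epsilon>})"
    by (auto intro!: monoI finite_measure_mono simp: sets)
  ultimately show ?thesis by (simp add: borel_measurable_diff borel_measurable_mono)
qed simp

section \<open>The perturbation that decouples the two half-lines\<close>

lemma symmetric_op_compression:
  assumes "symmetric_op T"
  shows "symmetric_op (compression A T)"
proof -
  have "cinner (restrict_to A f) g = cinner f (restrict_to A g)" for f g
    unfolding cinner_def by (intro infsum_cong) (simp add: coord_simps)
  then show ?thesis
    by (simp add: symmetric_op_def compression_apply symmetric_opD[OF assms])
qed

lemma symmetric_op_rank_one: "symmetric_op (rank_one k)"
  by (simp add: symmetric_op_def rank_one_apply cinner_cscale_left cinner_cscale_right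
      cinner_commute[of "delta k"])

lemma symmetric_op_J_theta:
  assumes "symmetric_op (jacobi a b)"
  shows "symmetric_op (J_theta a b \<theta>)"
  unfolding J_theta_def
  by (simp add: assms symmetric_op_add symmetric_op_diff symmetric_op_scaleR
      symmetric_op_compression symmetric_op_rank_one)

text \<open>The vector to which the boundary condition at angle \<open>\<theta>\<close> demands orthogonality.\<close>

definition boundary_vector :: "real \<Rightarrow> ell2" where
  "boundary_vector \<theta> = cos \<theta> *\<^sub>R delta 0 + sin \<theta> *\<^sub>R delta 1"

lemma cinner_boundary_vector:
  "cinner (boundary_vector \<theta>) \<phi> = of_real (cos \<theta>) * coord \<phi> 0 + of_real (sin \<theta>) * coord \<phi> 1"
  by (simp add: boundary_vector_def cinner_add_left cinner_scaleR_left cinner_delta)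

context
  fixes a b :: "int \<Rightarrow> real"
  assumes ab: "jacobi_coeffs a b"
begin

lemma jacobi_cscale: "jacobi a b (cscale c \<phi>) = cscale c (jacobi a b \<phi>)"
  by (rule ell2_eqI) (simp add: jacobi_apply[OF ab] coord_simps algebra_simps)

lemma J_theta_minus_jacobi_apply:
  assumes "\<theta> \<noteq> 0" "\<theta> \<noteq> pi / 2"
  shows "(J_theta a b \<theta> - jacobi a b) \<phi> =
    - (a 0 *\<^sub>R (cscale (coord \<phi> 1 + of_real (cot \<theta>) * coord \<phi> 0) (delta 0)
              + cscale (coord \<phi> 0 + of_real (tan \<theta>) * coord \<phi> 1) (delta 1)))"
proof (rule ell2_eqI)
  fix n :: int
  consider "n \<le> -1" | "n = 0" | "n = 1" | "2 \<le> n" by linarith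
  then show "coord ((J_theta a b \<theta> - jacobi a b) \<phi>) n =
    coord (- (a 0 *\<^sub>R (cscale (coord \<phi> 1 + of_real (cot \<theta>) * coord \<phi> 0) (delta 0)
              + cscale (coord \<phi> 0 + of_real (tan \<theta>) * coord \<phi> 1) (delta 1)))) n"
    using assms
    by cases (simp_all add: J_theta_def blinfun.bilinear_simps compression_apply rank_one_apply
        cinner_delta coord_simps jacobi_apply[OF ab] algebra_simps)
qed

lemma norm_J_theta_minus_jacobi_le:
  assumes "sin \<theta> \<noteq> 0" "cos \<theta> \<noteq> 0"
  shows "norm ((J_theta a b \<theta> - jacobi a b) \<phi>) \<le>
    a 0 * (1 / \<bar>sin \<theta>\<bar> + 1 / \<bar>cos \<theta>\<bar>) * cmod (cinner (boundary_vector \<theta>) \<phi>)"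
proof -
  let ?w = "cinner (boundary_vector \<theta>) \<phi>"
  have a: "0 < a 0" using ab by (simp add: jacobi_coeffs_def)
  have \<theta>: "\<theta> \<noteq> 0" "\<theta> \<noteq> pi / 2" using assms cos_pi_half sin_zero by metis+
  have "coord \<phi> 1 + of_real (cot \<theta>) * coord \<phi> 0 = ?w / of_real (sin \<theta>)"
    "coord \<phi> 0 + of_real (tan \<theta>) * coord \<phi> 1 = ?w / of_real (cos \<theta>)"
    using assms by (simp_all add: cinner_boundary_vector cot_def tan_def field_simps)
  then have "norm ((J_theta a b \<theta> - jacobi a b) \<phi>) =
      a 0 * norm (cscale (?w / of_real (sin \<theta>)) (delta 0) + cscale (?w / of_real (cos \<theta>)) (delta 1))"
    using a by (simp add: J_theta_minus_jacobi_apply[OF \<theta>] del: minus_add_distrib)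
  also have "\<dots> \<le> a 0 * (norm (cscale (?w / of_real (sin \<theta>)) (delta 0)) + norm (cscale (?w / of_real (cos \<theta>)) (delta 1)))"
    using a by (intro mult_left_mono norm_triangle_ineq) simp
  also have "\<dots> = a 0 * (1 / \<bar>sin \<theta>\<bar> + 1 / \<bar>cos \<theta>\<bar>) * cmod ?w"
    by (simp add: norm_cscale norm_delta norm_divide algebra_simps)
  finally show ?thesis .
qed

text \<open>At the two exceptional angles the boundary condition is \<open>u(0) = 0\<close> or \<open>u(1) = 0\<close>, and a whole site
  decouples.  As \<open>J\<^sub>\<theta> \<phi>\<close> vanishes at that site, \<open>J \<phi>\<close> has to vanish there, too.\<close>

lemma J_theta_0_eq:
  assumes "coord \<phi> 0 = 0" "coord (jacobi a b \<phi>) 0 = 0"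
  shows "J_theta a b 0 \<phi> = jacobi a b \<phi>"
proof (rule ell2_eqI)
  fix n :: int
  consider "n \<le> -1" | "n = 0" | "1 \<le> n" by linarith
  then show "coord (J_theta a b 0 \<phi>) n = coord (jacobi a b \<phi>) n"
    using assms
    by cases (cases "n = - 1"; cases "n = 1"; force simp: J_theta_def blinfun.bilinear_simps compression_apply
        coord_simps jacobi_apply[OF ab])+
qed

lemma J_theta_half_pi_eq:
  assumes "coord \<phi> 1 = 0" "coord (jacobi a b \<phi>) 1 = 0"
  shows "J_theta a b (pi / 2) \<phi> = jacobi a b \<phi>"
proof (rule ell2_eqI)
  fix n :: int
  consider "n \<le> 0" | "n = 1" | "2 \<le> n" by linarith
  then show "coord (J_theta a b (pi / 2) \<phi>) n = coord (jacobi a b \<phi>) n"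
    using assms
    by cases (cases "n = 0"; cases "n = 2"; force simp: J_theta_def blinfun.bilinear_simps compression_apply
        coord_simps jacobi_apply[OF ab])+
qed

end

section \<open>The angle of the subordinate solution\<close>

text \<open>A solution is continued to the left by the recurrence, since \<open>a (n - 1) \<noteq> 0\<close>.\<close>

lemma solution_eq_0_if_0_right:
  assumes a: "\<And>n. 0 < a n" and u: "solution a b E u" and right: "\<And>n. 1 \<le> n \<Longrightarrow> u n = 0"
  shows "u n = 0"
proof -
  have left: "u (1 - int k) = 0 \<and> u (2 - int k) = 0" for k
  proof (induction k)
    case (Suc k)
    have "of_real (a (1 - int k - 1)) * u (1 - int k - 1) = 0"
      using u Suc.IH unfolding solution_def jacobi_map_def
      by (metis (no_types, opaque_lifting) add.right_neutral add_0 add_diff_eq diff_add_eq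
          mult_zero_right one_add_one add.commute)
    then show ?case using Suc.IH a[of "1 - int k - 1"] by (simp add: algebra_simps)
  qed (use right in simp)
  show ?thesis
  proof (cases "1 \<le> n")
    case False
    then show ?thesis using left[of "nat (1 - n)"] by simp
  qed (rule right)
qed

lemma norm_right_eventually_pos:
  assumes a: "\<And>n. 0 < a n" and u: "solution a b E u" "\<exists>n. u n \<noteq> 0"
  shows "\<forall>\<^sub>F L in at_top. 0 < norm_right u L"
proof -
  obtain n where n: "1 \<le> n" "u n \<noteq> 0" using solution_eq_0_if_0_right[OF a u(1)] u(2) by blast
  have "0 < norm_right u L" if L: "of_int n \<le> L" for L
  proof -
    have "0 < (cmod (u n))\<^sup>2" using n by simp
    also have "\<dots> \<le> (\<Sum>n\<in>{1..\<lfloor>L\<rfloor>}. (cmod (u n))\<^sup>2)"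
      using n L by (intro member_le_sum) (auto simp: le_floor_iff)
    also have "\<dots> \<le> (\<Sum>n\<in>{1..\<lfloor>L\<rfloor>}. (cmod (u n))\<^sup>2) + (L - of_int \<lfloor>L\<rfloor>) * (cmod (u (\<lfloor>L\<rfloor> + 1)))\<^sup>2"
      by simp
    finally show ?thesis by (simp add: norm_right_def)
  qed
  then show ?thesis unfolding eventually_at_top_linorder by blast
qed

text \<open>If two subordinate solutions were independent, the quotient of their norms and its reciprocal
  would both tend to zero.\<close>

lemma subordinate_unique:
  assumes a: "\<And>n. 0 < a n" and u: "subordinate a b E u" and v: "subordinate a b E v"
  shows "\<exists>c. c \<noteq> 0 \<and> (\<forall>n. v n = c * u n)"
proof -
  have us: "solution a b E u" "\<exists>n. u n \<noteq> 0" and vs: "solution a b E v" "\<exists>n. v n \<noteq> 0"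
    using u v by (auto simp: subordinate_def)
  have "\<not> lin_indep u v"
  proof
    assume indep: "lin_indep u v"
    then have "lin_indep v u" unfolding lin_indep_def by (metis add.commute)
    then have "((\<lambda>L. norm_right u L / norm_right v L * (norm_right v L / norm_right u L)) \<longlongrightarrow> 0 * 0) at_top"
      using u v indep us vs by (intro tendsto_mult) (auto simp: subordinate_def)
    moreover have "\<forall>\<^sub>F L in at_top. norm_right u L / norm_right v L * (norm_right v L / norm_right u L) = 1"
      using norm_right_eventually_pos[OF a us] norm_right_eventually_pos[OF a vs]
      by eventually_elim simp
    then have "((\<lambda>L. norm_right u L / norm_right v L * (norm_right v L / norm_right u L)) \<longlongrightarrow> 1) at_top"
      by (rule tendsto_eventually)
    ultimately have "(0::real) * 0 = 1" by (rule tendsto_unique[OF trivial_limit_at_top_linorder])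
    then show False by simp
  qed
  then obtain c d where cd: "\<And>n. c * u n + d * v n = 0" "\<not> (c = 0 \<and> d = 0)"
    unfolding lin_indep_def by blast
  have d: "d \<noteq> 0" using cd us(2) by auto
  have c: "c \<noteq> 0" using cd vs(2) by auto
  have "v n = (- c / d) * u n" for n
    using cd(1)[of n] d by (simp add: field_simps add_eq_0_iff)
  then show ?thesis using c d by (intro exI[of _ "- c / d"]) simp
qed

lemma S_theta_iff:
  assumes a: "\<And>n. 0 < a n" and u: "normalized_subordinate a b E u"
  shows "E \<in> S_theta a b \<theta> \<longleftrightarrow> Re (u 0) * cos \<theta> + Re (u 1) * sin \<theta> = 0"
proof -
  have sub: "subordinate a b E u" and real: "Im (u n) = 0" for n
    using u by (auto simp: normalized_subordinate_def complex_is_Real_iff)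
  have eq: "u 0 * of_real (cos \<theta>) + u 1 * of_real (sin \<theta>) = 0 \<longleftrightarrow>
      Re (u 0) * cos \<theta> + Re (u 1) * sin \<theta> = 0"
    by (simp add: complex_eq_iff real)
  have "u 0 * of_real (cos \<theta>) + u 1 * of_real (sin \<theta>) = 0"
    if v: "subordinate a b E v" "v 0 * of_real (cos \<theta>) + v 1 * of_real (sin \<theta>) = 0" for v
  proof -
    obtain c where c: "c \<noteq> 0" "\<And>n. v n = c * u n" using subordinate_unique[OF a sub v(1)] by blast
    have "c * (u 0 * of_real (cos \<theta>) + u 1 * of_real (sin \<theta>)) = 0"
      using v(2) c(2) by (simp add: algebra_simps)
    then show ?thesis using c(1) by simp
  qed
  then show ?thesis unfolding S_theta_def eq[symmetric] using sub by blast
qed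

text \<open>The angle is recovered from \<open>g\<^sub>0 = u(0)\<^sup>2\<close> and \<open>g\<^sub>1 = u(0) u(1)\<close>, which do not depend on the sign
  of \<open>u\<close>.\<close>

definition angle_of_products :: "real \<Rightarrow> real \<Rightarrow> real" where
  "angle_of_products g\<^sub>0 g\<^sub>1 = (if g\<^sub>0 = 0 then 0 else pi / 2 + arctan (g\<^sub>1 / g\<^sub>0))"

lemma angle_of_products_range: "angle_of_products g\<^sub>0 g\<^sub>1 \<in> {0..<pi}"
  using arctan_lbound[of "g\<^sub>1 / g\<^sub>0"] arctan_ubound[of "g\<^sub>1 / g\<^sub>0"] by (simp add: angle_of_products_def)

lemma boundary_condition_iff_angle:
  assumes w: "w\<^sub>0\<^sup>2 + w\<^sub>1\<^sup>2 = 1" and \<theta>: "\<theta> \<in> {0..<pi}"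
  shows "w\<^sub>0 * cos \<theta> + w\<^sub>1 * sin \<theta> = 0 \<longleftrightarrow> angle_of_products (w\<^sub>0\<^sup>2) (w\<^sub>0 * w\<^sub>1) = \<theta>"
proof -
  define \<theta>' where "\<theta>' = angle_of_products (w\<^sub>0\<^sup>2) (w\<^sub>0 * w\<^sub>1)"
  have range: "\<theta>' \<in> {0..<pi}" unfolding \<theta>'_def by (rule angle_of_products_range)
  have holds: "w\<^sub>0 * cos \<theta>' + w\<^sub>1 * sin \<theta>' = 0"
  proof (cases "w\<^sub>0 = 0")
    case False
    then have "\<theta>' = pi / 2 + arctan (w\<^sub>1 / w\<^sub>0)"
      by (simp add: \<theta>'_def angle_of_products_def power2_eq_square)
    \<comment> \<open>The vector \<open>(w\<^sub>0, w\<^sub>1)\<close> is proportional to \<open>(cos \<alpha>, sin \<alpha>)\<close> with \<open>\<alpha> = arctan (w\<^sub>1 / w\<^sub>0) = \<theta>' - \<pi>/2\<close>.\<close>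
    then have "w\<^sub>0 * cos \<theta>' + w\<^sub>1 * sin \<theta>' = - (w\<^sub>0 * sin (arctan (w\<^sub>1 / w\<^sub>0))) + w\<^sub>1 * cos (arctan (w\<^sub>1 / w\<^sub>0))"
      by (simp add: cos_add sin_add)
    also have "\<dots> = 0" using False by (simp add: sin_arctan cos_arctan)
    finally show ?thesis .
  qed (simp add: \<theta>'_def angle_of_products_def)
  have "\<theta>' = \<theta>" if "w\<^sub>0 * cos \<theta> + w\<^sub>1 * sin \<theta> = 0"
  proof -
    have "w\<^sub>0 * sin (\<theta>' - \<theta>) = sin \<theta>' * (w\<^sub>0 * cos \<theta> + w\<^sub>1 * sin \<theta>) - sin \<theta> * (w\<^sub>0 * cos \<theta>' + w\<^sub>1 * sin \<theta>')"
      by (simp add: sin_diff algebra_simps)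
    then have 0: "w\<^sub>0 * sin (\<theta>' - \<theta>) = 0" unfolding that holds by simp
    have "w\<^sub>1 * sin (\<theta>' - \<theta>) = cos \<theta> * (w\<^sub>0 * cos \<theta>' + w\<^sub>1 * sin \<theta>') - cos \<theta>' * (w\<^sub>0 * cos \<theta> + w\<^sub>1 * sin \<theta>)"
      by (simp add: sin_diff algebra_simps)
    then have 1: "w\<^sub>1 * sin (\<theta>' - \<theta>) = 0" unfolding that holds by simp
    have "sin (\<theta>' - \<theta>) = 0"
    proof (rule ccontr)
      assume "sin (\<theta>' - \<theta>) \<noteq> 0"
      then have "w\<^sub>0 = 0" "w\<^sub>1 = 0" using 0 1 by simp_all
      then show False using w by simp
    qed
    moreover have "- pi < \<theta>' - \<theta>" "\<theta>' - \<theta> < pi"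
      using range \<theta> unfolding atLeastLessThan_iff by linarith+
    ultimately show ?thesis using sin_eq_0_pi[of "\<theta>' - \<theta>"] by simp
  qed
  then show ?thesis using holds unfolding \<theta>'_def by auto
qed

lemma abs_cos_diff_le: "\<bar>cos x - cos y\<bar> \<le> \<bar>x - y\<bar>" for x y :: real
proof -
  have "\<bar>cos x - cos y\<bar> = 2 * (\<bar>sin ((x + y) / 2)\<bar> * \<bar>sin ((y - x) / 2)\<bar>)"
    by (simp add: cos_diff_cos abs_mult)
  also have "\<dots> \<le> 2 * (1 * \<bar>(y - x) / 2\<bar>)"
    by (intro mult_left_mono mult_mono abs_sin_x_le_abs_x) auto
  finally show ?thesis by simp
qed

lemma abs_sin_diff_le: "\<bar>sin x - sin y\<bar> \<le> \<bar>x - y\<bar>" for x y :: real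
  using abs_cos_diff_le[of "pi / 2 - x" "pi / 2 - y"] by (simp add: cos_diff)

locale admissible =
  fixes a b :: "int \<Rightarrow> real" and P :: proj_measure and S :: "real set"
  assumes coeffs: "jacobi_coeffs a b" and spectral: "is_spectral_measure (jacobi a b) P"
    and admissible: "admissible_set a b P S"
begin

lemma pvm: "projection_valued_measure P"
  using spectral by (simp add: is_spectral_measure_def)

lemma S_borel: "S \<in> sets borel"
  using admissible by (simp add: admissible_set_def)

lemmas symmetric_jacobi = spectral_measure_commute(1)[OF jacobi_cscale[OF coeffs] spectral]
lemmas P_commute_jacobi = spectral_measure_commute(2)[OF jacobi_cscale[OF coeffs] spectral]

abbreviation span2 :: "real \<Rightarrow> real \<Rightarrow> ell2" where
  "span2 \<alpha> \<beta> \<equiv> \<alpha> *\<^sub>R delta 0 + \<beta> *\<^sub>R delta 1"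

abbreviation mass_ratio :: "real \<Rightarrow> real \<Rightarrow> real \<Rightarrow> real \<Rightarrow> real" where
  "mass_ratio \<alpha> \<beta> E \<epsilon> \<equiv> (norm (P {E - \<epsilon><..<E + \<epsilon>} (span2 \<alpha> \<beta>)))\<^sup>2
    / measure (total_measure P) {E - \<epsilon><..<E + \<epsilon>}"

text \<open>Everything that is used about the solution at a point of \<open>S\<close>: its values \<open>w\<^sub>0\<close>, \<open>w\<^sub>1\<close> at the two
  central sites decide the angle, and they give the density of the spectral measure of every real
  combination of the two central basis vectors with respect to the total measure.\<close>

lemma central_values:
  assumes E: "E \<in> S"
  shows "\<exists>w\<^sub>0 w\<^sub>1. w\<^sub>0\<^sup>2 + w\<^sub>1\<^sup>2 = 1 \<and>
    (\<forall>\<theta>. E \<in> S_theta a b \<theta> \<longleftrightarrow> w\<^sub>0 * cos \<theta> + w\<^sub>1 * sin \<theta> = 0) \<and>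
    (\<forall>\<alpha> \<beta>. (mass_ratio \<alpha> \<beta> E \<longlongrightarrow> (\<alpha> * w\<^sub>0 + \<beta> * w\<^sub>1)\<^sup>2) (at_right 0))"
proof -
  obtain u where u: "normalized_subordinate a b E u" and
    lim: "\<And>k j. ((\<lambda>\<epsilon>. entry_measure P k j {E - \<epsilon><..<E + \<epsilon>} /
        of_real (measure (total_measure P) {E - \<epsilon><..<E + \<epsilon>})) \<longlongrightarrow> u k * u j) (at_right 0)"
    using admissible E unfolding admissible_set_def by blast
  have real: "Im (u n) = 0" for n
    using u by (auto simp: normalized_subordinate_def complex_is_Real_iff)
  have a: "\<And>n. 0 < a n" using coeffs by (simp add: jacobi_coeffs_def)
  let ?I = "\<lambda>\<epsilon>. {E - \<epsilon><..<E + \<epsilon>}"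
  let ?m = "\<lambda>\<epsilon>. measure (total_measure P) (?I \<epsilon>)"
  have lim': "((\<lambda>\<epsilon>. inner (P (?I \<epsilon>) (delta k)) (delta j) / ?m \<epsilon>) \<longlongrightarrow> Re (u k) * Re (u j)) (at_right 0)" for k j
    using tendsto_Re[OF lim[of k j]] by (simp add: entry_measure_def Re_divide_of_real Re_cinner real)
  have "(mass_ratio \<alpha> \<beta> E \<longlongrightarrow> (\<alpha> * Re (u 0) + \<beta> * Re (u 1))\<^sup>2) (at_right 0)" for \<alpha> \<beta>
  proof -
    have "mass_ratio \<alpha> \<beta> E \<epsilon> =
        \<alpha>\<^sup>2 * (inner (P (?I \<epsilon>) (delta 0)) (delta 0) / ?m \<epsilon>)
        + \<alpha> * \<beta> * (inner (P (?I \<epsilon>) (delta 0)) (delta 1) / ?m \<epsilon>)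
        + \<alpha> * \<beta> * (inner (P (?I \<epsilon>) (delta 1)) (delta 0) / ?m \<epsilon>)
        + \<beta>\<^sup>2 * (inner (P (?I \<epsilon>) (delta 1)) (delta 1) / ?m \<epsilon>)" for \<epsilon>
      unfolding pvm_norm_sq[OF pvm, OF borel_open[OF open_greaterThanLessThan]]
      by (simp add: blinfun.bilinear_simps inner_add_left inner_add_right
          power2_eq_square algebra_simps add_divide_distrib)
    moreover have "(\<alpha> * Re (u 0) + \<beta> * Re (u 1))\<^sup>2 =
        \<alpha>\<^sup>2 * (Re (u 0) * Re (u 0)) + \<alpha> * \<beta> * (Re (u 0) * Re (u 1))
        + \<alpha> * \<beta> * (Re (u 1) * Re (u 0)) + \<beta>\<^sup>2 * (Re (u 1) * Re (u 1))"
      by (simp add: power2_eq_square algebra_simps)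
    ultimately show ?thesis by (simp only:) (intro tendsto_add tendsto_mult_left lim')
  qed
  moreover have "(Re (u 0))\<^sup>2 + (Re (u 1))\<^sup>2 = 1"
    using u by (simp add: normalized_subordinate_def cmod_power2 real)
  ultimately show ?thesis using S_theta_iff[OF a u] by blast
qed

text \<open>The densities are pointwise limits of measurable functions, hence so is the angle.\<close>

lemma angle_measurable:
  "\<exists>\<Theta>\<in>borel_measurable borel.
    \<forall>E\<in>S. \<forall>\<theta>\<in>{0..<pi}. E \<in> S_theta a b \<theta> \<longleftrightarrow> \<Theta> E = \<theta>"
proof -
  define r where "r \<alpha> \<beta> n E = mass_ratio \<alpha> \<beta> E (1 / real (Suc n))" for \<alpha> \<beta> n and E :: real
  \<comment> \<open>The indicator makes the sequence converge at every \<open>E\<close>, also outside \<open>S\<close>.\<close>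
  define G where "G \<alpha> \<beta> E = lim (\<lambda>n. indicator S E * r \<alpha> \<beta> n E)" for \<alpha> \<beta> and E :: real
  have seq: "filterlim (\<lambda>n. 1 / real (Suc n)) (at_right 0) sequentially"
    using LIMSEQ_inverse_real_of_nat
    by (auto simp: filterlim_at inverse_eq_divide intro!: always_eventually)
  have lim_r: "(\<lambda>n. r \<alpha> \<beta> n E) \<longlonglongrightarrow> l"
    if "(mass_ratio \<alpha> \<beta> E \<longlongrightarrow> l) (at_right 0)" for \<alpha> \<beta> E l
    unfolding r_def by (rule filterlim_compose[OF that seq])
  have G_lim: "(\<lambda>n. indicator S E * r \<alpha> \<beta> n E) \<longlonglongrightarrow> G \<alpha> \<beta> E" for \<alpha> \<beta> E
  proof (cases "E \<in> S")
    case True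
    then obtain l where "(mass_ratio \<alpha> \<beta> E \<longlongrightarrow> l) (at_right 0)" using central_values by blast
    then have "(\<lambda>n. r \<alpha> \<beta> n E) \<longlonglongrightarrow> l" by (rule lim_r)
    then show ?thesis using True limI[of "\<lambda>n. r \<alpha> \<beta> n E" l] by (simp add: G_def)
  qed (simp add: G_def)
  have "(\<lambda>E. indicator S E * r \<alpha> \<beta> n E) \<in> borel_measurable borel" for \<alpha> \<beta> n
  proof -
    let ?I = "\<lambda>E. {E - 1 / real (Suc n)<..<E + 1 / real (Suc n)}"
    have r_eq: "r \<alpha> \<beta> n = (\<lambda>E. measure (form_measure P (span2 \<alpha> \<beta>)) (?I E) / measure (total_measure P) (?I E))"
      by (rule ext) (simp add: r_def measure_form_measure[OF pvm])
    have "(\<lambda>E. measure (form_measure P (span2 \<alpha> \<beta>)) (?I E)) \<in> borel_measurable borel"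
      by (rule borel_measurable_measure_interval[OF sets_form_measure[OF pvm] finite_measure_form_measure[OF pvm]])
    moreover have "(\<lambda>E. measure (total_measure P) (?I E)) \<in> borel_measurable borel"
      by (rule borel_measurable_measure_interval[OF sets_total_measure[OF pvm] finite_measure_total_measure[OF pvm]])
    ultimately have "r \<alpha> \<beta> n \<in> borel_measurable borel"
      unfolding r_eq by (rule borel_measurable_divide)
    then show ?thesis by (rule borel_measurable_times[OF borel_measurable_indicator[OF S_borel]])
  qed
  then have G: "G \<alpha> \<beta> \<in> borel_measurable borel" for \<alpha> \<beta>
    by (rule borel_measurable_LIMSEQ_real[OF G_lim])
  \<comment> \<open>On \<open>S\<close> these are \<open>G 1 0 = w\<^sub>0\<^sup>2\<close> and \<open>G 1 1 = (w\<^sub>0 + w\<^sub>1)\<^sup>2 = 1 + 2 w\<^sub>0 w\<^sub>1\<close>.\<close>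
  define \<Theta> where "\<Theta> E = angle_of_products (G 1 0 E) ((G 1 1 E - 1) / 2)" for E
  have "\<Theta> \<in> borel_measurable borel"
    unfolding \<Theta>_def angle_of_products_def using G[measurable] by measurable
  moreover have "E \<in> S_theta a b \<theta> \<longleftrightarrow> \<Theta> E = \<theta>" if E: "E \<in> S" and \<theta>: "\<theta> \<in> {0..<pi}" for E \<theta>
  proof -
    obtain w\<^sub>0 w\<^sub>1 where w: "w\<^sub>0\<^sup>2 + w\<^sub>1\<^sup>2 = 1" and iff: "\<And>\<theta>. E \<in> S_theta a b \<theta> \<longleftrightarrow> w\<^sub>0 * cos \<theta> + w\<^sub>1 * sin \<theta> = 0"
      and lim: "\<And>\<alpha> \<beta>. (mass_ratio \<alpha> \<beta> E \<longlongrightarrow> (\<alpha> * w\<^sub>0 + \<beta> * w\<^sub>1)\<^sup>2) (at_right 0)"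
      using central_values[OF E] by blast
    have "G \<alpha> \<beta> E = (\<alpha> * w\<^sub>0 + \<beta> * w\<^sub>1)\<^sup>2" for \<alpha> \<beta>
      using limI[OF lim_r[OF lim[of \<alpha> \<beta>]]] E by (simp add: G_def)
    then have "\<Theta> E = angle_of_products (w\<^sub>0\<^sup>2) (w\<^sub>0 * w\<^sub>1)"
      using w by (simp add: \<Theta>_def power2_sum)
    then show ?thesis using iff boundary_condition_iff_angle[OF w \<theta>] by simp
  qed
  ultimately show ?thesis by blast
qed

text \<open>At an energy of angle \<open>\<theta>\<close> the spectral measure of the boundary vector has density
  \<open>sin\<^sup>2(t - \<theta>)\<close>.  The constant \<open>8\<close> is \<open>2 \<cdot> 4\<close>: this density is estimated by \<open>(2 \<delta>)\<^sup>2\<close>, and the covering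
  argument costs a factor two.\<close>

lemma boundary_vector_small:
  assumes A: "A \<in> sets borel" "A \<subseteq> S" and \<delta>: "0 \<le> \<delta>"
    and angle: "\<And>E. E \<in> A \<Longrightarrow> \<exists>\<theta>. E \<in> S_theta a b \<theta> \<and> \<bar>t - \<theta>\<bar> \<le> \<delta>"
  shows "(norm (P A (boundary_vector t)))\<^sup>2 \<le> 8 * \<delta>\<^sup>2 * measure (total_measure P) A"
proof -
  let ?\<mu> = "total_measure P" and ?\<nu> = "form_measure P (boundary_vector t)"
  have bound: "measure ?\<nu> A \<le> 2 * c * measure ?\<mu> A" if c: "4 * \<delta>\<^sup>2 < c" for c
  proof (rule measure_le_if_interval_ratio_le)
    show "0 \<le> c" using c zero_le_power2[of \<delta>] by linarith
    fix E d :: real assume E: "E \<in> A" and d: "0 < d"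
    have "E \<in> S" using A(2) E by blast
    then obtain w\<^sub>0 w\<^sub>1 where w: "w\<^sub>0\<^sup>2 + w\<^sub>1\<^sup>2 = 1" and iff: "\<And>\<theta>. E \<in> S_theta a b \<theta> \<longleftrightarrow> w\<^sub>0 * cos \<theta> + w\<^sub>1 * sin \<theta> = 0"
      and lim: "\<And>\<alpha> \<beta>. (mass_ratio \<alpha> \<beta> E \<longlongrightarrow> (\<alpha> * w\<^sub>0 + \<beta> * w\<^sub>1)\<^sup>2) (at_right 0)"
      using central_values by blast
    obtain \<theta> where \<theta>: "w\<^sub>0 * cos \<theta> + w\<^sub>1 * sin \<theta> = 0" "\<bar>t - \<theta>\<bar> \<le> \<delta>" using angle[OF E] iff by blast
    have w1: "\<bar>w\<^sub>0\<bar> \<le> 1" "\<bar>w\<^sub>1\<bar> \<le> 1"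
      using w zero_le_power2[of w\<^sub>0] zero_le_power2[of w\<^sub>1]
      unfolding abs_square_le_1[symmetric] by linarith+
    have "\<bar>cos t * w\<^sub>0 + sin t * w\<^sub>1\<bar> = \<bar>w\<^sub>0 * (cos t - cos \<theta>) + w\<^sub>1 * (sin t - sin \<theta>)\<bar>"
      using \<theta>(1) by (simp add: algebra_simps)
    also have "\<dots> \<le> 1 * \<delta> + 1 * \<delta>"
      by (rule order_trans[OF abs_triangle_ineq], unfold abs_mult)
        (intro add_mono mult_mono w1 order_trans[OF abs_cos_diff_le \<theta>(2)]
          order_trans[OF abs_sin_diff_le \<theta>(2)]; simp)
    finally have "(cos t * w\<^sub>0 + sin t * w\<^sub>1)\<^sup>2 \<le> (2 * \<delta>)\<^sup>2"
      using \<delta> unfolding abs_le_square_iff[symmetric] by simp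
    then have "(cos t * w\<^sub>0 + sin t * w\<^sub>1)\<^sup>2 < c" using c by (simp add: power_mult_distrib)
    from order_tendstoD(2)[OF lim this]
    have "\<forall>\<^sub>F \<epsilon> in at_right 0. (norm (P {E - \<epsilon><..<E + \<epsilon>} (boundary_vector t)))\<^sup>2
        / measure ?\<mu> {E - \<epsilon><..<E + \<epsilon>} < c"
      unfolding boundary_vector_def .
    then obtain e where e: "0 < e" "\<And>\<epsilon>. 0 < \<epsilon> \<Longrightarrow> \<epsilon> < e \<Longrightarrow> (norm (P {E - \<epsilon><..<E + \<epsilon>} (boundary_vector t)))\<^sup>2
        / measure ?\<mu> {E - \<epsilon><..<E + \<epsilon>} < c"
      by (auto simp: eventually_at_right_field)
    define \<epsilon> where "\<epsilon> = min d e / 2"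
    have \<epsilon>: "0 < \<epsilon>" "\<epsilon> < d" "\<epsilon> < e" using d e(1) by (auto simp: \<epsilon>_def)
    let ?I = "{E - \<epsilon><..<E + \<epsilon>}"
    have "(norm (P ?I (boundary_vector t)))\<^sup>2 \<le> c * measure ?\<mu> ?I"
    proof (cases "measure ?\<mu> ?I = 0")
      \<comment> \<open>Here the ratio is \<open>0\<close> by convention and says nothing; but the mass on the left vanishes, too.\<close>
      case True
      then have "(norm (P ?I (delta 0)))\<^sup>2 = 0 \<and> (norm (P ?I (delta 1)))\<^sup>2 = 0"
        unfolding measure_total_measure[OF pvm, OF borel_open[OF open_greaterThanLessThan]]
        by (simp add: add_nonneg_eq_0_iff)
      then show ?thesis using True by (simp add: boundary_vector_def blinfun.bilinear_simps)
    next
      case False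
      then have "0 < measure ?\<mu> ?I" by (simp add: less_le)
      then show ?thesis using e(2)[OF \<epsilon>(1,3)] by (simp add: divide_less_eq)
    qed
    then show "\<exists>\<epsilon>>0. \<epsilon> < d \<and> measure ?\<nu> {E - \<epsilon><..<E + \<epsilon>} \<le> c * measure ?\<mu> {E - \<epsilon><..<E + \<epsilon>}"
      using \<epsilon> by (intro exI[of _ \<epsilon>]) (simp add: measure_form_measure[OF pvm])
  qed (use A pvm in \<open>simp_all add: finite_measure_form_measure finite_measure_total_measure\<close>)
  have "measure ?\<nu> A \<le> 8 * \<delta>\<^sup>2 * measure ?\<mu> A"
  proof (rule field_le_epsilon)
    fix e :: real assume e: "0 < e"
    have "measure ?\<nu> A \<le> 2 * (4 * \<delta>\<^sup>2 + e / 4) * measure ?\<mu> A" using e by (intro bound) simp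
    also have "\<dots> = 8 * \<delta>\<^sup>2 * measure ?\<mu> A + e / 2 * measure ?\<mu> A" by (simp add: algebra_simps)
    also have "\<dots> \<le> 8 * \<delta>\<^sup>2 * measure ?\<mu> A + e / 2 * 2"
      using e measure_total_measure_le[OF pvm A(1)] by (intro add_left_mono mult_left_mono) auto
    finally show "measure ?\<nu> A \<le> 8 * \<delta>\<^sup>2 * measure ?\<mu> A + e" by simp
  qed
  then show ?thesis by (simp add: measure_form_measure[OF pvm A(1)])
qed

end

section \<open>Riemann sums over the angle\<close>

lemma partition_mono:
  fixes x :: "nat \<Rightarrow> real"
  assumes x: "\<And>i. i < n \<Longrightarrow> x i < x (Suc i)" and "i \<le> j" "j \<le> n"
  shows "x i \<le> x j"
  using assms(2,3)
proof (induction j rule: dec_induct)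
  case (step m)
  then show ?case using x[of m] by simp
qed simp

context admissible
begin

definition angle_set :: "real set \<Rightarrow> real set" where
  "angle_set B = (\<Union>\<theta>\<in>B. S_theta a b \<theta>) \<inter> S"

lemma Q_eq: "Q_measure a b P S B = P (angle_set B)"
  by (simp add: Q_measure_def angle_set_def)

lemma angle_set_subset: "angle_set B \<subseteq> S"
  by (simp add: angle_set_def)

lemma angle_set_mono: "B \<subseteq> C \<Longrightarrow> angle_set B \<subseteq> angle_set C"
  by (auto simp: angle_set_def)

lemma angle_set_Un: "angle_set (B \<union> C) = angle_set B \<union> angle_set C"
  by (auto simp: angle_set_def)

lemma angle_set_UN: "angle_set (\<Union>i. B i) = (\<Union>i. angle_set (B i))"
  by (auto simp: angle_set_def)

lemma angle_set_disjoint: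
  assumes "B \<subseteq> {0..<pi}" "C \<subseteq> {0..<pi}" "B \<inter> C = {}"
  shows "angle_set B \<inter> angle_set C = {}"
proof -
  obtain \<Theta> where "\<forall>E\<in>S. \<forall>\<theta>\<in>{0..<pi}. E \<in> S_theta a b \<theta> \<longleftrightarrow> \<Theta> E = \<theta>"
    using angle_measurable by blast
  then have unique: "\<theta> = \<Theta> E" if "E \<in> S" "\<theta> \<in> {0..<pi}" "E \<in> S_theta a b \<theta>" for E \<theta>
    using that by metis
  have False if E: "E \<in> angle_set B" "E \<in> angle_set C" for E
  proof -
    obtain \<theta> \<theta>' where "E \<in> S" "\<theta> \<in> B" "E \<in> S_theta a b \<theta>" "\<theta>' \<in> C" "E \<in> S_theta a b \<theta>'"
      using E unfolding angle_set_def by blast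
    moreover from this have "\<theta> = \<Theta> E" "\<theta>' = \<Theta> E" using unique assms(1,2) by blast+
    ultimately show False using assms(3) by blast
  qed
  then show ?thesis by blast
qed

lemma angle_set_borel:
  assumes "B \<in> sets borel" "B \<subseteq> {0..<pi}"
  shows "angle_set B \<in> sets borel"
proof -
  obtain \<Theta> where \<Theta>: "\<Theta> \<in> borel_measurable borel"
    and iff: "\<forall>E\<in>S. \<forall>\<theta>\<in>{0..<pi}. E \<in> S_theta a b \<theta> \<longleftrightarrow> \<Theta> E = \<theta>"
    using angle_measurable by blast
  have "angle_set B = \<Theta> -` B \<inter> S"
  proof (intro set_eqI iffI)
    fix E assume "E \<in> angle_set B"
    then obtain \<theta> where "\<theta> \<in> B" "E \<in> S_theta a b \<theta>" "E \<in> S" unfolding angle_set_def by blast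
    then show "E \<in> \<Theta> -` B \<inter> S" using iff assms(2) by auto
  next
    fix E assume "E \<in> \<Theta> -` B \<inter> S"
    then show "E \<in> angle_set B" using iff assms(2) unfolding angle_set_def by auto
  qed
  moreover have "\<Theta> -` B \<in> sets borel"
    using measurable_sets[OF \<Theta> assms(1)] by simp
  ultimately show ?thesis using S_borel by simp
qed

lemma Q_Un:
  assumes "B \<in> sets borel" "C \<in> sets borel" "B \<subseteq> {0..<pi}" "C \<subseteq> {0..<pi}" "B \<inter> C = {}"
  shows "P (angle_set (B \<union> C)) \<psi> = P (angle_set B) \<psi> + P (angle_set C) \<psi>"
    and "(norm (P (angle_set (B \<union> C)) \<psi>))\<^sup>2 = (norm (P (angle_set B) \<psi>))\<^sup>2 + (norm (P (angle_set C) \<psi>))\<^sup>2"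
  unfolding angle_set_Un using assms
  by (intro pvm_Un[OF pvm] pvm_norm_sq_Un[OF pvm] angle_set_borel angle_set_disjoint; simp)+

lemma Q_partition:
  assumes x: "\<And>i. i < n \<Longrightarrow> x i < x (Suc i)" and range: "0 \<le> x 0" "x n < pi"
  shows "(\<Sum>i<n. P (angle_set {x i..<x (Suc i)}) \<psi>) = P (angle_set {x 0..<x n}) \<psi>"
    and "(\<Sum>i<n. (norm (P (angle_set {x i..<x (Suc i)}) \<psi>))\<^sup>2) = (norm (P (angle_set {x 0..<x n}) \<psi>))\<^sup>2"
proof -
  note mono = partition_mono[of n x, OF x]
  have "m \<le> n \<Longrightarrow> (\<Sum>i<m. P (angle_set {x i..<x (Suc i)}) \<psi>) = P (angle_set {x 0..<x m}) \<psi> \<and>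
    (\<Sum>i<m. (norm (P (angle_set {x i..<x (Suc i)}) \<psi>))\<^sup>2) = (norm (P (angle_set {x 0..<x m}) \<psi>))\<^sup>2" for m
  proof (induction m)
    case 0
    then show ?case by (simp add: angle_set_def pvm_empty[OF pvm])
  next
    case (Suc m)
    have le: "x 0 \<le> x m" "x m \<le> x (Suc m)" "x (Suc m) \<le> x n" using mono Suc.prems by auto
    then have un: "{x 0..<x (Suc m)} = {x 0..<x m} \<union> {x m..<x (Suc m)}" by auto
    have sub: "{x 0..<x m} \<subseteq> {0..<pi}" "{x m..<x (Suc m)} \<subseteq> {0..<pi}" using le range by auto
    show ?case
      using Suc.IH Suc.prems Q_Un[OF _ _ sub, of \<psi>] unfolding un by simp
  qed
  then show "(\<Sum>i<n. P (angle_set {x i..<x (Suc i)}) \<psi>) = P (angle_set {x 0..<x n}) \<psi>"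
    "(\<Sum>i<n. (norm (P (angle_set {x i..<x (Suc i)}) \<psi>))\<^sup>2) = (norm (P (angle_set {x 0..<x n}) \<psi>))\<^sup>2"
    by blast+
qed

lemma norm_boundary_vector_le: "norm (boundary_vector t) \<le> 2"
proof -
  have "norm (boundary_vector t) \<le> \<bar>cos t\<bar> + \<bar>sin t\<bar>"
    unfolding boundary_vector_def by (rule order_trans[OF norm_triangle_ineq]) (simp add: norm_delta)
  also have "\<dots> \<le> 1 + 1" by (intro add_mono) auto
  finally show ?thesis by simp
qed

lemma cinner_boundary_projection_le:
  assumes B: "B \<in> sets borel" "B \<subseteq> {0..<pi}"
  shows "cmod (cinner (boundary_vector t) (P (angle_set B) \<phi>)) \<le>
    norm (P (angle_set B) (boundary_vector t)) * norm (P (angle_set B) \<phi>)"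
proof -
  have A: "angle_set B \<in> sets borel" by (rule angle_set_borel[OF B])
  have "cinner (boundary_vector t) (P (angle_set B) \<phi>) =
      cinner (P (angle_set B) (boundary_vector t)) (P (angle_set B) \<phi>)"
    using symmetric_opD[OF pvm_symmetric[OF pvm A], of "boundary_vector t" "P (angle_set B) \<phi>"]
    by (simp add: pvm_idem[OF pvm A])
  then show ?thesis by (simp add: norm_cinner_le)
qed

lemma boundary_projection_small:
  assumes B: "B \<in> sets borel" "B \<subseteq> {0..<pi}" and \<delta>: "0 \<le> \<delta>" "\<And>\<theta>. \<theta> \<in> B \<Longrightarrow> \<bar>t - \<theta>\<bar> \<le> \<delta>"
  shows "(norm (P (angle_set B) (boundary_vector t)))\<^sup>2 \<le> 8 * \<delta>\<^sup>2 * measure (total_measure P) (angle_set B)"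
  by (rule boundary_vector_small[OF angle_set_borel[OF B] angle_set_subset \<delta>(1)])
    (use \<delta>(2) in \<open>auto simp: angle_set_def\<close>)

text \<open>The Cauchy--Schwarz inequality over the pieces: the boundary vectors contribute the mesh times
  the square root of the total mass, the pieces of \<open>\<phi>\<close> at most the norm of \<open>\<phi>\<close>.\<close>

lemma sum_boundary_terms_le:
  assumes x: "\<And>i. i < n \<Longrightarrow> x i < x (Suc i) \<and> x (Suc i) - x i < d \<and> t i \<in> {x i..<x (Suc i)}"
    and range: "0 \<le> x 0" "x n < pi" and d: "0 < d"
  shows "(\<Sum>i<n. cmod (cinner (boundary_vector (t i)) (P (angle_set {x i..<x (Suc i)}) \<phi>))) \<le> 4 * d * norm \<phi>"
proof -
  let ?B = "\<lambda>i. {x i..<x (Suc i)}"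
  note mono = partition_mono[of n x, OF conjunct1[OF x]]
  have sub: "?B i \<subseteq> {0..<pi}" if "i < n" for i
    using mono[of 0 i] mono[of "Suc i" n] that range by auto
  have total: "{x 0..<x n} \<subseteq> {0..<pi}" using range by auto
  have part: "(\<Sum>i<n. (norm (P (angle_set (?B i)) \<psi>))\<^sup>2) = (norm (P (angle_set {x 0..<x n}) \<psi>))\<^sup>2" for \<psi>
    by (rule Q_partition(2)) (use x range in auto)
  have "(\<Sum>i<n. cmod (cinner (boundary_vector (t i)) (P (angle_set (?B i)) \<phi>)))
      \<le> (\<Sum>i<n. \<bar>norm (P (angle_set (?B i)) (boundary_vector (t i)))\<bar> * \<bar>norm (P (angle_set (?B i)) \<phi>)\<bar>)"
    using sub cinner_boundary_projection_le by (intro sum_mono) simp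
  also have "\<dots> \<le> L2_set (\<lambda>i. norm (P (angle_set (?B i)) (boundary_vector (t i)))) {..<n}
      * L2_set (\<lambda>i. norm (P (angle_set (?B i)) \<phi>)) {..<n}"
    by (rule L2_set_mult_ineq)
  also have "\<dots> \<le> (4 * d) * norm \<phi>"
  proof (rule mult_mono)
    have "(\<Sum>i<n. (norm (P (angle_set (?B i)) (boundary_vector (t i))))\<^sup>2)
        \<le> (\<Sum>i<n. 8 * d\<^sup>2 * measure (total_measure P) (angle_set (?B i)))"
    proof (rule sum_mono)
      fix i assume "i \<in> {..<n}"
      then have i: "i < n" by simp
      show "(norm (P (angle_set (?B i)) (boundary_vector (t i))))\<^sup>2
          \<le> 8 * d\<^sup>2 * measure (total_measure P) (angle_set (?B i))"
        using x[OF i] d by (intro boundary_projection_small sub[OF i]) auto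
    qed
    also have "\<dots> = 8 * d\<^sup>2 * ((\<Sum>i<n. (norm (P (angle_set (?B i)) (delta 0)))\<^sup>2)
        + (\<Sum>i<n. (norm (P (angle_set (?B i)) (delta 1)))\<^sup>2))"
      using sub by (simp add: sum_distrib_left sum.distrib[symmetric] measure_total_measure[OF pvm] angle_set_borel)
    also have "\<dots> = 8 * d\<^sup>2 * measure (total_measure P) (angle_set {x 0..<x n})"
      by (simp add: part measure_total_measure[OF pvm] angle_set_borel[OF _ total])
    also have "\<dots> \<le> 8 * d\<^sup>2 * 2"
      by (intro mult_left_mono measure_total_measure_le[OF pvm] angle_set_borel total) auto
    also have "\<dots> = (4 * d)\<^sup>2" by (simp add: power_mult_distrib)
    finally show "L2_set (\<lambda>i. norm (P (angle_set (?B i)) (boundary_vector (t i)))) {..<n} \<le> 4 * d"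
      unfolding L2_set_def using d by (intro real_le_lsqrt) auto
    have "(\<Sum>i<n. (norm (P (angle_set (?B i)) \<phi>))\<^sup>2) \<le> (norm \<phi>)\<^sup>2"
      unfolding part by (intro power_mono pvm_norm_le[OF pvm] angle_set_borel total) auto
    then show "L2_set (\<lambda>i. norm (P (angle_set (?B i)) \<phi>)) {..<n} \<le> norm \<phi>"
      unfolding L2_set_def by (intro real_le_lsqrt) auto
  qed (use d in \<open>auto intro: L2_set_nonneg\<close>)
  finally show ?thesis .
qed

text \<open>Away from the exceptional angles \<open>1 / \<bar>sin t\<bar> + 1 / \<bar>cos t\<bar>\<close> is bounded, which bounds both the
  norms of the operators \<open>J\<^sub>t\<close> and the factor in front of the boundary terms.\<close>

lemma mesh_integral:
  assumes F: "perturbation_stable F" and l: "0 < l" "l < r" "r < pi"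
    and cos: "\<And>t. l \<le> t \<Longrightarrow> t \<le> r \<Longrightarrow> cos t \<noteq> 0"
  shows "has_mesh_integral (\<lambda>\<theta>. functional_calculus F (J_theta a b \<theta>)) (Q_measure a b P S) l r
    (functional_calculus F (jacobi a b) o\<^sub>L Q_measure a b P S {l..<r})"
proof -
  let ?J = "jacobi a b" and ?c = "\<lambda>t. a 0 * (1 / \<bar>sin t\<bar> + 1 / \<bar>cos t\<bar>)"
  have sin: "sin t \<noteq> 0" if "l \<le> t" "t \<le> r" for t using sin_gt_zero[of t] that l by auto
  have "bounded (?c ` {l..r})"
    using sin cos by (intro compact_imp_bounded compact_continuous_image continuous_intros) auto
  then obtain C where "\<forall>t\<in>{l..r}. norm (?c t) \<le> C" unfolding bounded_iff by blast
  then have C: "\<And>t. t \<in> {l..r} \<Longrightarrow> ?c t \<le> C" by force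
  have a0: "0 < a 0" using coeffs by (simp add: jacobi_coeffs_def)
  have C0: "0 \<le> C" using C[of l] a0 l by (force intro: order_trans[rotated])
  have diff: "norm ((J_theta a b t - ?J) \<phi>) \<le> C * cmod (cinner (boundary_vector t) \<phi>)"
    if "l \<le> t" "t \<le> r" for t \<phi>
    using order_trans[OF norm_J_theta_minus_jacobi_le[OF coeffs sin cos] mult_right_mono[OF C]] that by simp
  define R where "R = norm ?J + 2 * C"
  have R: "norm (J_theta a b t) \<le> R" if t: "l \<le> t" "t \<le> r" for t
  proof -
    have "norm (J_theta a b t - ?J) \<le> 2 * C"
    proof (rule norm_blinfun_bound)
      fix \<phi>
      have "cmod (cinner (boundary_vector t) \<phi>) \<le> 2 * norm \<phi>"
        using order_trans[OF norm_cinner_le mult_right_mono[OF norm_boundary_vector_le]] by simp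
      then have "C * cmod (cinner (boundary_vector t) \<phi>) \<le> C * (2 * norm \<phi>)"
        using C0 by (intro mult_left_mono)
      then show "norm ((J_theta a b t - ?J) \<phi>) \<le> 2 * C * norm \<phi>"
        using diff[OF t, of \<phi>] by (simp add: mult_ac)
    qed (use C0 in simp)
    then show ?thesis using norm_triangle_sub[of "J_theta a b t" ?J] by (simp add: R_def)
  qed
  obtain K where K: "0 \<le> K" and
    stable: "\<And>n J T Q \<eta> \<phi>. piecewise_close R n J T Q \<eta> \<Longrightarrow> calculus_error F n J T Q \<phi> \<le> K * \<eta> * norm \<phi>"
    using perturbation_stableD[OF F] by blast
  show ?thesis
    unfolding has_mesh_integral_def
  proof (intro allI impI)
    fix e :: real assume e: "0 < e"
    \<comment> \<open>The error will be at most \<open>4 K C d\<close>; the added \<open>1\<close> makes the denominator positive.\<close>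
    define d where "d = e / (4 * K * C + 1)"
    have KC: "0 < 4 * K * C + 1" using K C0 by (simp add: add_nonneg_pos)
    have "e * (4 * K * C) < e * (4 * K * C + 1)" using e by simp
    then have d: "0 < d" "K * (4 * C * d) < e"
      using e KC by (simp_all add: d_def pos_divide_less_eq mult_ac)
    show "\<exists>d>0. \<forall>n x t. x 0 = l \<and> x n = r \<and> (\<forall>i<n. x i < x (Suc i) \<and> x (Suc i) - x i < d \<and> t i \<in> {x i..<x (Suc i)}) \<longrightarrow>
      norm ((\<Sum>i<n. functional_calculus F (J_theta a b (t i)) o\<^sub>L Q_measure a b P S {x i..<x (Suc i)})
        - (functional_calculus F ?J o\<^sub>L Q_measure a b P S {l..<r})) < e"
    proof (intro exI[of _ d] conjI allI impI d(1))
      fix n and x t :: "nat \<Rightarrow> real"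
      assume "x 0 = l \<and> x n = r \<and> (\<forall>i<n. x i < x (Suc i) \<and> x (Suc i) - x i < d \<and> t i \<in> {x i..<x (Suc i)})"
      then have x0: "x 0 = l" and xn: "x n = r" and
        x: "\<And>i. i < n \<Longrightarrow> x i < x (Suc i) \<and> x (Suc i) - x i < d \<and> t i \<in> {x i..<x (Suc i)}" by auto
      let ?Q = "\<lambda>i. P (angle_set {x i..<x (Suc i)})"
      note mono = partition_mono[of n x, OF conjunct1[OF x]]
      have t: "l \<le> t i" "t i \<le> r" if "i < n" for i
        using mono[of 0 i] mono[of "Suc i" n] x[OF that] that x0 xn by auto
      have borel: "angle_set {x i..<x (Suc i)} \<in> sets borel" if "i < n" for i
        using mono[of 0 i] mono[of "Suc i" n] that x0 xn l by (intro angle_set_borel) auto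
      have range: "0 \<le> x 0" "x n < pi" using l x0 xn by auto
      have close: "piecewise_close R n ?J (\<lambda>i. J_theta a b (t i)) ?Q (4 * C * d)"
        unfolding piecewise_close_def
      proof (intro conjI allI impI)
        show "symmetric_op ?J" by (rule symmetric_jacobi)
        show "norm ?J \<le> R" "0 \<le> 4 * C * d" using C0 d by (simp_all add: R_def)
        fix i assume i: "i < n"
        show "symmetric_op (J_theta a b (t i))" by (rule symmetric_op_J_theta[OF symmetric_jacobi])
        show "norm (J_theta a b (t i)) \<le> R" by (rule R[OF t[OF i]])
        show "symmetric_op (?Q i)" by (rule pvm_symmetric[OF pvm borel[OF i]])
        show "?Q i (?J \<phi>) = ?J (?Q i \<phi>)" for \<phi> by (rule P_commute_jacobi[OF borel[OF i]])
      next
        fix \<phi>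
        have "(\<Sum>i<n. norm ((J_theta a b (t i) - ?J) (?Q i \<phi>)))
            \<le> (\<Sum>i<n. C * cmod (cinner (boundary_vector (t i)) (?Q i \<phi>)))"
          using diff t by (intro sum_mono) simp
        also have "\<dots> \<le> C * (4 * d * norm \<phi>)"
          unfolding sum_distrib_left[symmetric]
          by (intro mult_left_mono sum_boundary_terms_le[OF x range d(1)] C0)
        finally show "(\<Sum>i<n. norm ((J_theta a b (t i) - ?J) (?Q i \<phi>))) \<le> 4 * C * d * norm \<phi>"
          by (simp add: mult_ac)
      qed
      have "norm ((\<Sum>i<n. functional_calculus F (J_theta a b (t i)) o\<^sub>L ?Q i)
          - (functional_calculus F ?J o\<^sub>L P (angle_set {l..<r}))) \<le> K * (4 * C * d)"
      proof (rule norm_blinfun_bound)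
        fix \<phi>
        have "P (angle_set {l..<r}) \<phi> = (\<Sum>i<n. ?Q i \<phi>)"
          using Q_partition(1)[of n x \<phi>] x range x0 xn by simp
        then have "((\<Sum>i<n. functional_calculus F (J_theta a b (t i)) o\<^sub>L ?Q i)
            - (functional_calculus F ?J o\<^sub>L P (angle_set {l..<r}))) \<phi> =
          (\<Sum>i<n. (functional_calculus F (J_theta a b (t i)) - functional_calculus F ?J) (?Q i \<phi>))"
          by (simp add: blinfun.bilinear_simps blinfun.sum_left blinfun.sum_right sum_subtractf)
        then show "norm (((\<Sum>i<n. functional_calculus F (J_theta a b (t i)) o\<^sub>L ?Q i)
            - (functional_calculus F ?J o\<^sub>L P (angle_set {l..<r}))) \<phi>) \<le> K * (4 * C * d) * norm \<phi>"
          using order_trans[OF norm_sum stable[OF close, unfolded calculus_error_def]] by simp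
      qed (use K C0 d in simp)
      then show "norm ((\<Sum>i<n. functional_calculus F (J_theta a b (t i)) o\<^sub>L Q_measure a b P S {x i..<x (Suc i)})
        - (functional_calculus F ?J o\<^sub>L Q_measure a b P S {l..<r})) < e"
        unfolding Q_eq using d(2) by linarith
    qed
  qed
qed

text \<open>Along growing intervals the projections converge strongly, and by monotonicity every larger
  interval is at least as close to the limit.\<close>

lemma Q_tendsto_open_interval:
  assumes range: "0 \<le> lo" "lo < hi" "hi \<le> pi"
  shows "((\<lambda>(l, r). P (angle_set {l..<r}) \<psi>) \<longlongrightarrow> P (angle_set {lo<..<hi}) \<psi>) (at_right lo \<times>\<^sub>F at_left hi)"
proof (rule tendstoI)
  fix e :: real assume e: "0 < e"
  let ?A = "\<lambda>n. angle_set {lo + inverse (Suc n)..<hi - inverse (Suc n)}" and ?U = "angle_set {lo<..<hi}"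
  have borel: "angle_set {l..<r} \<in> sets borel" if "lo < l" "r < hi" for l r
    using that range by (intro angle_set_borel) auto
  have A: "range ?A \<subseteq> sets borel" using borel by auto
  have U: "?U \<in> sets borel" using range by (intro angle_set_borel) auto
  have inc: "incseq ?A"
  proof (rule incseq_SucI)
    fix n
    have "inverse (real (Suc (Suc n))) \<le> inverse (real (Suc n))" by (intro le_imp_inverse_le) auto
    then show "?A n \<subseteq> ?A (Suc n)" by (intro angle_set_mono) auto
  qed
  have "{lo<..<hi} = (\<Union>n. {lo + inverse (Suc n)..<hi - inverse (Suc n)})"
  proof (intro set_eqI iffI)
    fix x assume "x \<in> {lo<..<hi}"
    then have "0 < min (x - lo) (hi - x)" by simp
    from reals_Archimedean[OF this] obtain n where "inverse (real (Suc n)) < min (x - lo) (hi - x)" by blast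
    then show "x \<in> (\<Union>n. {lo + inverse (Suc n)..<hi - inverse (Suc n)})" by (intro UN_I[of n]) auto
  next
    fix x assume "x \<in> (\<Union>n. {lo + inverse (Suc n)..<hi - inverse (Suc n)})"
    then obtain n where "lo + inverse (Suc n) \<le> x" "x < hi - inverse (Suc n)" by auto
    moreover have "0 < inverse (real (Suc n))" by simp
    ultimately show "x \<in> {lo<..<hi}" unfolding greaterThanLessThan_iff by linarith
  qed
  then have "(\<lambda>n. P (?A n) \<psi>) \<longlonglongrightarrow> P ?U \<psi>"
    using pvm_LIMSEQ_incseq[OF pvm A inc, of \<psi>] by (simp add: angle_set_UN)
  then obtain n where n: "dist (P (?A n) \<psi>) (P ?U \<psi>) < e"
    using metric_LIMSEQ_D[OF _ e] by blast
  have "\<forall>\<^sub>F p in at_right lo \<times>\<^sub>F at_left hi.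
      fst p \<in> {lo<..<lo + inverse (Suc n)} \<and> snd p \<in> {hi - inverse (Suc n)<..<hi}"
    by (intro eventually_prodI eventually_at_right_real eventually_at_left_real) auto
  then show "\<forall>\<^sub>F p in at_right lo \<times>\<^sub>F at_left hi.
      dist (case p of (l, r) \<Rightarrow> P (angle_set {l..<r}) \<psi>) (P ?U \<psi>) < e"
  proof (rule eventually_mono)
    fix p assume p: "fst p \<in> {lo<..<lo + inverse (Suc n)} \<and> snd p \<in> {hi - inverse (Suc n)<..<hi}"
    obtain l r where lr: "p = (l, r)" by (cases p)
    have B: "angle_set {l..<r} \<in> sets borel" "angle_set {l..<r} \<subseteq> ?U" "?A n \<subseteq> angle_set {l..<r}"
      using p lr borel by (auto intro!: angle_set_mono)
    have An: "?A n \<in> sets borel" "?A n \<subseteq> ?U" using A B by auto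
    have "(norm (P (angle_set {l..<r}) \<psi> - P ?U \<psi>))\<^sup>2 \<le> (norm (P (?A n) \<psi> - P ?U \<psi>))\<^sup>2"
      unfolding pvm_norm_diff_sq[OF pvm B(1) U B(2)] pvm_norm_diff_sq[OF pvm An(1) U An(2)]
      using pvm_norm_mono[OF pvm An(1) B(1,3), of \<psi>] by simp
    then have "norm (P (angle_set {l..<r}) \<psi> - P ?U \<psi>) \<le> norm (P (?A n) \<psi> - P ?U \<psi>)"
      by (simp add: power2_le_iff_abs_le)
    then show "dist (case p of (l, r) \<Rightarrow> P (angle_set {l..<r}) \<psi>) (P ?U \<psi>) < e"
      using n lr by (simp add: dist_norm)
  qed
qed

lemma open_integral:
  assumes F: "perturbation_stable F" and range: "0 \<le> lo" "lo < hi" "hi \<le> pi"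
    and cos: "\<And>t. lo < t \<Longrightarrow> t < hi \<Longrightarrow> cos t \<noteq> 0"
  shows "has_open_integral (\<lambda>\<theta>. functional_calculus F (J_theta a b \<theta>)) (Q_measure a b P S) lo hi
    (functional_calculus F (jacobi a b) o\<^sub>L Q_measure a b P S {lo<..<hi})"
  unfolding has_open_integral_def
proof (intro exI[of _ "\<lambda>l r. functional_calculus F (jacobi a b) o\<^sub>L Q_measure a b P S {l..<r}"]
    conjI allI impI)
  fix l r assume "lo < l" "l < r" "r < hi"
  then show "has_mesh_integral (\<lambda>\<theta>. functional_calculus F (J_theta a b \<theta>)) (Q_measure a b P S) l r
    (functional_calculus F (jacobi a b) o\<^sub>L Q_measure a b P S {l..<r})"
    using range by (intro mesh_integral F cos) auto
next
  fix \<psi>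
  have "((\<lambda>p. functional_calculus F (jacobi a b) (case p of (l, r) \<Rightarrow> P (angle_set {l..<r}) \<psi>)) \<longlongrightarrow>
      functional_calculus F (jacobi a b) (P (angle_set {lo<..<hi}) \<psi>)) (at_right lo \<times>\<^sub>F at_left hi)"
    by (intro blinfun.tendsto tendsto_const Q_tendsto_open_interval range)
  then show "((\<lambda>(l, r). (functional_calculus F (jacobi a b) o\<^sub>L Q_measure a b P S {l..<r}) \<psi>) \<longlongrightarrow>
      (functional_calculus F (jacobi a b) o\<^sub>L Q_measure a b P S {lo<..<hi}) \<psi>) (at_right lo \<times>\<^sub>F at_left hi)"
    by (simp add: Q_eq case_prod_unfold)
qed

text \<open>At an exceptional angle \<open>J\<close> and \<open>J\<^sub>\<theta>\<close> agree on the range of the projection; this is the case of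
  one piece and no error.\<close>

lemma point_term:
  assumes F: "perturbation_stable F" and \<theta>: "\<theta> \<in> {0..<pi}"
    and agree: "\<And>\<phi>. cinner (boundary_vector \<theta>) \<phi> = 0 \<Longrightarrow> cinner (boundary_vector \<theta>) (jacobi a b \<phi>) = 0 \<Longrightarrow>
      J_theta a b \<theta> \<phi> = jacobi a b \<phi>"
  shows "functional_calculus F (J_theta a b \<theta>) o\<^sub>L Q_measure a b P S {\<theta>} =
    functional_calculus F (jacobi a b) o\<^sub>L Q_measure a b P S {\<theta>}"
proof -
  let ?Q = "P (angle_set {\<theta>})" and ?J = "jacobi a b" and ?R = "max (norm (jacobi a b)) (norm (J_theta a b \<theta>))"
  have B: "{\<theta>} \<in> sets borel" "{\<theta>} \<subseteq> {0..<pi}" using \<theta> by auto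
  note A = angle_set_borel[OF B]
  have "(norm (?Q (boundary_vector \<theta>)))\<^sup>2 \<le> 0"
    using boundary_projection_small[OF B, of 0 \<theta>] by simp
  then have orth: "cinner (boundary_vector \<theta>) (?Q \<phi>) = 0" for \<phi>
    using cinner_boundary_projection_le[OF B, of \<theta> \<phi>] by simp
  have "J_theta a b \<theta> (?Q \<phi>) = ?J (?Q \<phi>)" for \<phi>
    using agree[of "?Q \<phi>"] orth[of \<phi>] orth[of "?J \<phi>"] P_commute_jacobi[OF A, of \<phi>] by simp
  then have close: "piecewise_close ?R 1 ?J (\<lambda>_. J_theta a b \<theta>) (\<lambda>_. ?Q) 0"
    unfolding piecewise_close_def
    by (simp add: symmetric_jacobi symmetric_op_J_theta[OF symmetric_jacobi] pvm_symmetric[OF pvm A]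
        P_commute_jacobi[OF A] blinfun.bilinear_simps)
  obtain K where "\<And>n J T Q \<eta> \<phi>. piecewise_close ?R n J T Q \<eta> \<Longrightarrow> calculus_error F n J T Q \<phi> \<le> K * \<eta> * norm \<phi>"
    using perturbation_stableD[OF F] by blast
  from this[OF close] have "functional_calculus F (J_theta a b \<theta>) (?Q \<phi>) = functional_calculus F ?J (?Q \<phi>)" for \<phi>
    by (simp add: calculus_error_def blinfun.bilinear_simps)
  then show ?thesis unfolding Q_eq by (intro blinfun_eqI) simp
qed

lemma angle_integral:
  assumes F: "perturbation_stable F"
  shows "has_angle_integral (\<lambda>\<theta>. functional_calculus F (J_theta a b \<theta>)) (Q_measure a b P S)
    (functional_calculus F (jacobi a b) o\<^sub>L Q_measure a b P S {0..<pi})"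
proof -
  let ?F = "functional_calculus F (jacobi a b)" and ?Q = "Q_measure a b P S"
  have 1: "has_open_integral (\<lambda>\<theta>. functional_calculus F (J_theta a b \<theta>)) ?Q 0 (pi / 2) (?F o\<^sub>L ?Q {0<..<pi / 2})"
  proof (rule open_integral[OF F])
    show "cos t \<noteq> 0" if "0 < t" "t < pi / 2" for t using cos_gt_zero[OF that] by simp
  qed simp_all
  have 2: "has_open_integral (\<lambda>\<theta>. functional_calculus F (J_theta a b \<theta>)) ?Q (pi / 2) pi (?F o\<^sub>L ?Q {pi / 2<..<pi})"
  proof (rule open_integral[OF F])
    show "cos t \<noteq> 0" if "pi / 2 < t" "t < pi" for t
      using sin_gt_zero[of "t - pi / 2"] that by (simp add: sin_diff)
  qed simp_all
  have 3: "functional_calculus F (J_theta a b 0) o\<^sub>L ?Q {0} = ?F o\<^sub>L ?Q {0}"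
    by (rule point_term[OF F]) (auto simp: cinner_boundary_vector intro: J_theta_0_eq[OF coeffs])
  have 4: "functional_calculus F (J_theta a b (pi / 2)) o\<^sub>L ?Q {pi / 2} = ?F o\<^sub>L ?Q {pi / 2}"
    by (rule point_term[OF F]) (auto simp: cinner_boundary_vector intro: J_theta_half_pi_eq[OF coeffs])
  have "P (angle_set {0..<pi}) \<psi> = P (angle_set {0<..<pi / 2}) \<psi> + P (angle_set {pi / 2<..<pi}) \<psi>
      + P (angle_set {0}) \<psi> + P (angle_set {pi / 2}) \<psi>" for \<psi>
  proof -
    have "{0..<pi} = {0<..<pi / 2} \<union> {pi / 2<..<pi} \<union> {0} \<union> {pi / 2}"
      by (auto simp: less_le)
    then have "P (angle_set {0..<pi}) \<psi> = P (angle_set ({0<..<pi / 2} \<union> {pi / 2<..<pi} \<union> {0} \<union> {pi / 2})) \<psi>"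
      by simp
    also have "\<dots> = P (angle_set ({0<..<pi / 2} \<union> {pi / 2<..<pi} \<union> {0})) \<psi> + P (angle_set {pi / 2}) \<psi>"
      by (rule Q_Un(1)) auto
    also have "P (angle_set ({0<..<pi / 2} \<union> {pi / 2<..<pi} \<union> {0})) \<psi>
        = P (angle_set ({0<..<pi / 2} \<union> {pi / 2<..<pi})) \<psi> + P (angle_set {0}) \<psi>"
      by (rule Q_Un(1)) auto
    also have "P (angle_set ({0<..<pi / 2} \<union> {pi / 2<..<pi})) \<psi>
        = P (angle_set {0<..<pi / 2}) \<psi> + P (angle_set {pi / 2<..<pi}) \<psi>"
      by (rule Q_Un(1)) auto
    finally show ?thesis .
  qed
  then have "?F o\<^sub>L ?Q {0..<pi} = (?F o\<^sub>L ?Q {0<..<pi / 2}) + (?F o\<^sub>L ?Q {pi / 2<..<pi})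
      + (functional_calculus F (J_theta a b 0) o\<^sub>L ?Q {0})
      + (functional_calculus F (J_theta a b (pi / 2)) o\<^sub>L ?Q {pi / 2})"
    unfolding 3 4 unfolding Q_eq by (intro blinfun_eqI) (simp add: blinfun.bilinear_simps)
  with 1 2 show ?thesis unfolding has_angle_integral_def by blast
qed

end

theorem theorem4p6:
  fixes a b :: "int \<Rightarrow> real" and P :: "real set \<Rightarrow> operator" and S' :: "real set"
    and F :: "real \<Rightarrow> complex"
  assumes "jacobi_coeffs a b"
    and "is_spectral_measure (jacobi a b) P"
    and "admissible_set a b P S'"
    and "F \<in> complex_span (monomials \<union> exponentials \<union> resolvent_functions)"
  shows "has_angle_integral (\<lambda>\<theta>. functional_calculus F (J_theta a b \<theta>)) (Q_measure a b P S')
           (functional_calculus F (jacobi a b) o\<^sub>L Q_measure a b P S' {0..<pi})"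
proof -
  interpret admissible a b P S' using assms(1-3) by unfold_locales
  show ?thesis by (rule angle_integral[OF perturbation_stable_span[OF assms(4)]])
qed

end
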